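(* Let $T>0$, $\alpha\in[1/2,1)$, and consider the Volterra integral equation $$g(t)=\int_0^t\frac{\tilde f(u)\,k(t,u)}{u^\alpha(t-u)^{1/2}}\,du,\qquad 0< t\le T,$$ where $g$ is continuous on $[0,T]$ and $k(t,t)\neq0$ for all $t\in[0,T]$. Assume that the kernel $k(t,u)$ and the solution $\tilde f(t)$ are 1. twice continuously differentiable; 2. such that the derivatives $\tilde f^{(3)}$, $\partial^3k/\partial u^3$ and $\partial^3k/\partial t\,\partial u^2$ are bounded on the domain $0\le u\le t\le T$. For $m\ge1$ let $\Delta t=T/m$, $t_i=i\Delta t$, and let $\hat f_0,\dots,\hat f_m$ be the approximations produced by the product trapezoidal rule (defined in the context) for this equation. Then the error satisfies $$\max_{0\le i\le m}\bigl|\tilde f(t_i)-\hat f_i\bigr|=\mathcal{O}\left(\Delta t^{3/2}\right).$$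
   Context: Product trapezoidal rule: write $g_i=g(t_i)$ and $k_{i,j}=k(t_i,t_j)$. The starting value is $$\hat f_0=\frac{g(0)}{\pi\,k(0,0)}\ \text{ if }\alpha=1/2,\qquad \hat f_0=0\ \text{ if }\alpha\in(1/2,1).$$ The values $\hat f_1,\dots,\hat f_m$ are determined by the lower-triangular system $$\Delta t^{\alpha-1/2}g_i=k_{i,0}W^{(1)}_{i,0}\hat f_0+\sum_{j=1}^{i-1}k_{i,j}\bigl(W^{(1)}_{i,j}+W^{(2)}_{i,j-1}\bigr)\hat f_j+k_{i,i}W^{(2)}_{i,i-1}\hat f_i,\qquad i=1,\dots,m,$$ with weights, for $0\le j\le i-1$, $$W^{(1)}_{i,j}=\int_j^{j+1}(j+1-u)\,u^{-\alpha}(i-u)^{-1/2}\,du,\qquad W^{(2)}_{i,j}=\int_j^{j+1}(u-j)\,u^{-\alpha}(i-u)^{-1/2}\,du.$$ (This corresponds to replacing $\tilde f(u)k(t_i,u)$ by its piecewise linear interpolant on the grid.) The $\mathcal{O}$ is as $\Delta t\to0$ (equivalently $m\to\infty$) with $T$ fixed. *)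

theory Defs
  imports "HOL-Analysis.Analysis" "HOL-Library.Landau_Symbols"
begin

definition time_triangle :: "real \<Rightarrow> (real \<times> real) set" where
  "time_triangle T = {(t, u). 0 \<le> u \<and> u \<le> t \<and> t \<le> T}"

text \<open>
  The functions \<open>h\<^sub>t\<close> and \<open>h\<^sub>u\<close> are the partial derivatives of \<open>h\<close> on \<open>D\<close> with respect to the
  first and the second variable.  The total derivative within \<open>D\<close> is used because a closed
  triangle has corners at which a coordinate slice is a single point, so that one-sided partial
  derivatives would not be determined there.  With \<open>h\<^sub>t\<close> and \<open>h\<^sub>u\<close> continuous on \<open>D\<close> this is
  continuous differentiability on \<open>D\<close>.
\<close>

definition has_partials_on ::
  "(real \<times> real) set \<Rightarrow> (real \<Rightarrow> real \<Rightarrow> real) \<Rightarrow> (real \<Rightarrow> real \<Rightarrow> real) \<Rightarrow> (real \<Rightarrow> real \<Rightarrow> real) \<Rightarrow> bool"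
where
  "has_partials_on D h h\<^sub>t h\<^sub>u \<longleftrightarrow>
     (\<forall>(t, u) \<in> D. ((\<lambda>(s, v). h s v) has_derivative (\<lambda>(s, v). h\<^sub>t t u * s + h\<^sub>u t u * v))
                     (at (t, u) within D))"

definition volterra_solution ::
  "real \<Rightarrow> real \<Rightarrow> (real \<Rightarrow> real \<Rightarrow> real) \<Rightarrow> (real \<Rightarrow> real) \<Rightarrow> (real \<Rightarrow> real) \<Rightarrow> bool"
where
  "volterra_solution T \<alpha> k g f \<longleftrightarrow>
     (\<forall>t. 0 < t \<and> t \<le> T \<longrightarrow>
        ((\<lambda>u. f u * k t u / (u powr \<alpha> * (t - u) powr (1/2))) has_integral g t) {0..t})"

text \<open>
  The integrands below may be singular at \<open>u = 0\<close> and \<open>u = i\<close>, where \<open>powr\<close> returns \<open>0\<close>; this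
  affects a null set only.
\<close>

definition W1 :: "real \<Rightarrow> nat \<Rightarrow> nat \<Rightarrow> real" where
  "W1 \<alpha> i j = integral {real j..real j + 1}
     (\<lambda>u. (real j + 1 - u) * u powr (- \<alpha>) * (real i - u) powr (- (1/2)))"

definition W2 :: "real \<Rightarrow> nat \<Rightarrow> nat \<Rightarrow> real" where
  "W2 \<alpha> i j = integral {real j..real j + 1}
     (\<lambda>u. (u - real j) * u powr (- \<alpha>) * (real i - u) powr (- (1/2)))"

definition grid :: "real \<Rightarrow> nat \<Rightarrow> nat \<Rightarrow> real" where
  "grid T m i = real i * (T / real m)"

text \<open>
  The values \<open>F 0, \<dots>, F m\<close> are the approximations of the product trapezoidal rule with \<open>m\<close> steps.
  The system determines them uniquely when \<open>k\<close> does not vanish on the diagonal, since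
  \<open>W2 \<alpha> i (i - 1) > 0\<close>.
\<close>

definition product_trapezoidal ::
  "real \<Rightarrow> real \<Rightarrow> (real \<Rightarrow> real \<Rightarrow> real) \<Rightarrow> (real \<Rightarrow> real) \<Rightarrow> nat \<Rightarrow> (nat \<Rightarrow> real) \<Rightarrow> bool"
where
  "product_trapezoidal T \<alpha> k g m F \<longleftrightarrow>
     F 0 = (if \<alpha> = 1/2 then g 0 / (pi * k 0 0) else 0) \<and>
     (\<forall>i\<in>{1..m}.
        (T / real m) powr (\<alpha> - 1/2) * g (grid T m i) =
          k (grid T m i) (grid T m 0) * W1 \<alpha> i 0 * F 0
          + (\<Sum>j = 1..i - 1. k (grid T m i) (grid T m j) * (W1 \<alpha> i j + W2 \<alpha> i (j - 1)) * F j)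
          + k (grid T m i) (grid T m i) * W2 \<alpha> i (i - 1) * F i)"

end

theory Submission imports Defs begin

text \<open>
  Write \<open>h = T / m\<close> and \<open>e j = f (t\<^sub>j) - F j\<close>.  The substitution \<open>u = h * v\<close> turns the equation at \<open>t\<^sub>i\<close> into
  an integral of \<open>\<phi> v = f (h * v) * k t\<^sub>i (h * v)\<close> against the density \<open>v powr (- \<alpha>) * (i - v) powr (- 1/2)\<close> over
  \<open>{0..i}\<close>, and the scheme replaces \<open>\<phi>\<close> by its piecewise linear interpolant.  The limit \<open>t \<longlongrightarrow> 0\<close> of the
  equation shows \<open>e 0 = 0\<close> (\<open>volterra_initial_value\<close>), so subtracting gives a lower triangular system
  \<open>(\<Sum>j=1..i. k t\<^sub>i t\<^sub>j * w i j * e j) = d i\<close>.  The interpolation error is of order \<open>h\<^sup>2\<close> and the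
  density has integral of order \<open>i powr (1/2 - \<alpha>)\<close>, hence \<open>\<bar>d i\<bar> \<le> c * h\<^sup>2 * i powr (1/2 - \<alpha>)\<close>
  (\<open>product_trapezoidal_quadrature_error\<close>).

  Everything else is stability: residuals of this size only cause errors \<open>\<bar>e i\<bar> \<le> C * h\<^sup>2 * sqrt i\<close>
  (\<open>abel_system_stability\<close>).  Since \<open>i \<le> T / h\<close>, this is of order \<open>h powr (3/2)\<close>; the half order is lost
  because the weights \<open>w i j\<close> carry the factor \<open>j powr (- \<alpha>)\<close>, so that inverting them amplifies by \<open>i powr \<alpha>\<close>.

  For stability, \<open>w i j\<close> is compared with \<open>j powr (- \<alpha>) * a (i - j)\<close>, where \<open>a n\<close> are the trapezoidal weights
  for the pure Abel kernel (\<open>abel_weight\<close>); the relative error is of order \<open>1 / j\<close> (\<open>trap_weight_deviation\<close>).  The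
  sequence \<open>a\<close> discretises a half integral, so it is convolved with a discrete half derivative, the Taylor
  coefficients \<open>b\<close> of \<open>(1 - z) powr (1/2)\<close>.  The resulting sequence \<open>q\<close> (\<open>abel_symbol\<close>) satisfies
  \<open>q 0 = 4/3\<close>, whereas its other terms sum to at most \<open>5/4\<close> in absolute value (\<open>sum_abs_abel_symbol\<close>).  This
  diagonal dominance replaces an exact inverse of the matrix.  It holds because
  \<open>a n = sqrt pi * (3/4 * c n + 1/4 * c (n - 1)) + \<rho> n\<close>, where \<open>c\<close> are the Taylor coefficients of
  \<open>(1 - z) powr (- 1/2)\<close> and \<open>\<rho>\<close> is small, so that \<open>q\<close> has generating function \<open>sqrt pi * (3 + z) / 4\<close> up to a
  small error.

  Two perturbations remain (\<open>scaled_error_recurrence\<close>).  The variation of the kernel contributes entries of order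
  \<open>h\<close>, which a discrete Gronwall inequality absorbs; the relative error \<open>1 / j\<close> of the weights contributes row sums
  that tend to zero, so they are absorbed by the diagonal from some row \<open>J\<close> on, and the rows up to \<open>J\<close> are solved by
  forward substitution.
\<close>

section \<open>Power sums and discrete convolutions\<close>

text \<open>
  The mean value theorem bounds each term by an increment of \<open>x powr s / s\<close>, and the increments telescope.
\<close>
lemma sum_powr_le:
  fixes s :: real
  assumes "0 < s" "s \<le> 1"
  shows "(\<Sum>j=1..N. real j powr (s - 1)) \<le> real N powr s / s"
proof (induction N)
  case 0
  then show ?case by simp
next
  case (Suc N)
  have "real (Suc N) powr (s - 1) \<le> (real (Suc N) powr s - real N powr s) / s"
  proof (cases "N = 0")
    case True
    then show ?thesis using assms by (simp add: field_simps)
  next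
    case False
    have der: "((\<lambda>x. x powr s) has_real_derivative s * x powr (s - 1)) (at x)" if "x \<in> {real N..real (Suc N)}" for x
      using that False by (auto intro!: derivative_eq_intros)
    obtain z where z: "real N < z" "z < real (Suc N)"
      "real (Suc N) powr s - real N powr s = (real (Suc N) - real N) * (s * z powr (s - 1))"
      using MVT2[of "real N" "real (Suc N)" "\<lambda>x. x powr s" "\<lambda>x. s * x powr (s - 1)"] der by force
    have "real (Suc N) powr (s - 1) \<le> z powr (s - 1)"
      using z assms False by (intro powr_mono2') auto
    then show ?thesis using z assms by (simp add: field_simps)
  qed
  then show ?case using Suc assms by (simp add: field_simps)
qed

text \<open>
  A discrete Beta integral: the exponents add up to \<open>- 1\<close>, so the sum is scale invariant.  At every
  index one of the two factors has argument at least \<open>(i + 1) / 2\<close>; pulling it out leaves a power sum.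
\<close>
lemma beta_sum_bounded:
  fixes s :: real
  assumes "0 < s" "s < 1"
  obtains C where "\<And>i::nat. (\<Sum>j=1..i. real j powr (s - 1) * real (i + 1 - j) powr (- s)) \<le> C"
proof -
  have "(\<Sum>j=1..i. real j powr (s - 1) * real (i + 1 - j) powr (- s)) \<le> 4 / s + 4 / (1 - s)"
    for i :: nat
  proof -
    define h where "h = (real i + 1) / 2"
    have h: "h > 0" by (simp add: h_def)
    have ineq: "real j powr (s - 1) * real (i + 1 - j) powr (- s)
      \<le> h powr (-s) * real j powr (s - 1) + h powr (s - 1) * real (i + 1 - j) powr (- s)"
      if j: "j \<in> {1..i}" for j
    proof (cases "real j \<ge> h")
      case True
      then have "real j powr (s - 1) \<le> h powr (s - 1)"
        using h assms by (intro powr_mono2') auto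
      then have "real j powr (s - 1) * real (i + 1 - j) powr (- s) \<le> h powr (s - 1) * real (i + 1 - j) powr (- s)"
        by (intro mult_right_mono) auto
      then show ?thesis by (smt (verit) mult_nonneg_nonneg powr_ge_zero)
    next
      case False
      then have "real (i + 1 - j) \<ge> h" using j unfolding h_def by (simp add: of_nat_diff field_simps)
      then have "real (i + 1 - j) powr (- s) \<le> h powr (- s)"
        using h assms by (intro powr_mono2') auto
      then have "real j powr (s - 1) * real (i + 1 - j) powr (- s) \<le> real j powr (s - 1) * h powr (-s)"
        by (intro mult_left_mono) auto
      then show ?thesis by (smt (verit) mult_nonneg_nonneg powr_ge_zero mult.commute)
    qed
    have refl: "(\<Sum>j=1..i. real (i + 1 - j) powr (- s)) = (\<Sum>j=1..i. real j powr (- s))"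
      by (rule sum.reindex_bij_witness[of _ "\<lambda>j. i + 1 - j" "\<lambda>j. i + 1 - j"]) auto
    have "(\<Sum>j=1..i. real j powr (s - 1) * real (i + 1 - j) powr (- s))
       \<le> (\<Sum>j=1..i. h powr (-s) * real j powr (s - 1) + h powr (s - 1) * real (i + 1 - j) powr (- s))"
      by (intro sum_mono ineq)
    also have "\<dots> = h powr (-s) * (\<Sum>j=1..i. real j powr (s - 1)) + h powr (s - 1) * (\<Sum>j=1..i. real j powr (- s))"
      by (simp only: sum.distrib sum_distrib_left[symmetric] refl)
    also have "\<dots> \<le> h powr (-s) * (real i powr s / s) + h powr (s - 1) * (real i powr (1 - s) / (1 - s))"
      using sum_powr_le[of s i] sum_powr_le[of "1 - s" i] assms
      by (intro add_mono mult_left_mono) auto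
    also have "\<dots> \<le> 4 / s + 4 / (1 - s)"
    proof -
      have *: "h powr (- r) * real i powr r \<le> 4" if "0 < r" "r < 1" for r
      proof -
        have "real i powr r \<le> (2 * h) powr r"
          using that by (intro powr_mono2) (auto simp: h_def)
        also have "\<dots> = 2 powr r * h powr r" using h by (simp add: powr_mult)
        also have "\<dots> \<le> 4 * h powr r"
          using powr_mono[of r 2 "2::real"] that by (intro mult_right_mono) auto
        finally have "h powr (- r) * real i powr r \<le> h powr (- r) * (4 * h powr r)"
          by (intro mult_left_mono) auto
        also have "\<dots> = 4" using h by (simp add: powr_minus)
        finally show ?thesis .
      qed
      have "h powr (-s) * (real i powr s / s) \<le> 4 / s"
        using *[of s] assms by (simp add: divide_right_mono)
      moreover have "h powr (s - 1) * (real i powr (1 - s) / (1 - s)) \<le> 4 / (1 - s)"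
        using *[of "1 - s"] assms by (simp add: divide_right_mono)
      ultimately show ?thesis by linarith
    qed
    finally show ?thesis .
  qed
  then show thesis using that by blast
qed

text \<open>
  These are the row sums of the error made by freezing \<open>u powr (- \<alpha>)\<close> at the grid points.  Since \<open>j * (i + 1 - j) \<ge> i\<close>,
  half of the exponent \<open>\<gamma>\<close> can be traded for a factor \<open>i powr (- \<gamma> / 2)\<close>, which leaves a bounded Beta sum.
\<close>
lemma harmonic_convolution_tendsto_0:
  fixes \<gamma> :: real
  assumes "0 < \<gamma>" "\<gamma> < 1"
  shows "(\<lambda>i. \<Sum>j=1..i. real (i + 1 - j) powr (- \<gamma>) / real j) \<longlonglongrightarrow> 0"
proof -
  define s where "s = \<gamma> / 2"
  have s: "0 < s" "s < 1" "\<gamma> = s + s" using assms by (auto simp: s_def)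
  obtain C where C: "\<And>i::nat. (\<Sum>j=1..i. real j powr (s - 1) * real (i + 1 - j) powr (- s)) \<le> C"
    using beta_sum_bounded[OF s(1,2)] by metis
  have le: "(\<Sum>j=1..i. real (i + 1 - j) powr (- \<gamma>) / real j) \<le> C * real i powr (- s)" for i :: nat
  proof -
    have "(\<Sum>j=1..i. real (i + 1 - j) powr (- \<gamma>) / real j)
      \<le> (\<Sum>j=1..i. real i powr (- s) * (real j powr (s - 1) * real (i + 1 - j) powr (- s)))"
    proof (rule sum_mono)
      fix j assume j: "j \<in> {1..i}"
      have "real i \<le> real j * real (i + 1 - j)"
      proof -
        have "(real j - 1) * (real i - real j) \<ge> 0" using j by simp
        then show ?thesis using j by (simp add: of_nat_diff algebra_simps)
      qed
      then have "(real j * real (i + 1 - j)) powr (- s) \<le> real i powr (- s)"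
        using j s by (intro powr_mono2') auto
      moreover have "(real j * real (i + 1 - j)) powr (- s) = real j powr (- s) * real (i + 1 - j) powr (- s)"
        by (simp add: powr_mult)
      ultimately have "(real j powr (s - 1) * real (i + 1 - j) powr (- s)) * (real j powr (- s) * real (i + 1 - j) powr (- s)) \<le>
          (real j powr (s - 1) * real (i + 1 - j) powr (- s)) * real i powr (- s)"
        by (intro mult_left_mono) auto
      moreover have "(real j powr (s - 1) * real (i + 1 - j) powr (- s)) * (real j powr (- s) * real (i + 1 - j) powr (- s))
         = real (i + 1 - j) powr (- \<gamma>) / real j"
      proof -
        have "real j powr (s - 1) * real j powr (- s) = 1 / real j"
          using j powr_add[of "real j" "s - 1" "- s"] by (simp add: powr_neg_one)
        moreover have "real (i + 1 - j) powr (- s) * real (i + 1 - j) powr (- s) = real (i + 1 - j) powr (- \<gamma>)"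
          using s(3) by (simp add: powr_add[symmetric])
        ultimately show ?thesis by (metis (no_types, lifting) mult.assoc mult.left_commute mult.right_neutral times_divide_eq_right)
      qed
      ultimately show "real (i + 1 - j) powr (- \<gamma>) / real j \<le> real i powr (- s) * (real j powr (s - 1) * real (i + 1 - j) powr (- s))"
        by (simp add: mult_ac)
    qed
    also have "\<dots> \<le> real i powr (- s) * C"
      unfolding sum_distrib_left[symmetric] by (intro mult_left_mono C) auto
    finally show ?thesis by (simp add: mult.commute)
  qed
  have lim: "(\<lambda>i. C * real i powr (- s)) \<longlonglongrightarrow> C * 0"
    using s by (intro tendsto_intros tendsto_neg_powr filterlim_real_sequentially) auto
  show ?thesis
  proof (rule tendsto_sandwich)
    show "\<forall>\<^sub>F i in sequentially. 0 \<le> (\<Sum>j=1..i. real (i + 1 - j) powr (- \<gamma>) / real j)"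
      by (intro always_eventually allI sum_nonneg) auto
    show "\<forall>\<^sub>F i in sequentially. (\<Sum>j=1..i. real (i + 1 - j) powr (- \<gamma>) / real j) \<le> C * real i powr (- s)"
      using le by (intro always_eventually allI)
    show "(\<lambda>i. C * real i powr (- s)) \<longlonglongrightarrow> 0" using lim by simp
  qed auto
qed

text \<open>
  Each term is at most a decrement of \<open>2 / sqrt j\<close>.  The value \<open>2\<close> is one of the constants on which the
  diagonal dominance below depends.
\<close>
lemma sum_three_halves_from_2: "(\<Sum>j=2..N. real j powr (-3/2)) \<le> 2 - 2 / sqrt (real N)" if "N \<ge> 1"
  using that
proof (induction N rule: dec_induct)
  case base
  then show ?case by simp
next
  case (step N)
  define x y where "x = sqrt (real N)" and "y = sqrt (real (Suc N))"
  have x: "x > 0" and y: "y > 0" "y * y = x * x + 1" using step(1) by (auto simp: x_def y_def)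
  have xy: "x \<le> y" by (simp add: x_def y_def)
  have "real (Suc N) powr (-3/2) = 1 / (y * y * y)"
  proof -
    have "real (Suc N) powr (-3/2) = 1 / real (Suc N) powr (1 + 1/2)" by (simp add: powr_minus_divide)
    also have "real (Suc N) powr (1 + 1/2) = y * y * y"
      unfolding powr_add by (simp add: powr_half_sqrt y_def)
    finally show ?thesis .
  qed
  also have "\<dots> \<le> 2 / x - 2 / y"
  proof -
    have "2 / x - 2 / y = 2 * ((y - x) * (y + x)) / (x * y * (x + y))"
    proof -
      have "x + y \<noteq> 0" using x y by simp
      then show ?thesis using x y by (simp add: divide_simps) (simp add: algebra_simps)
    qed
    also have "(y - x) * (y + x) = 1" using y by (simp add: algebra_simps)
    finally have eq: "2 / x - 2 / y = 2 / (x * y * (x + y))" by simp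
    have "x * y * (x + y) \<le> 2 * (y * y * y)"
    proof -
      have "x * y \<le> y * y" using xy y by (intro mult_right_mono) auto
      moreover have "x + y \<le> 2 * y" using xy by simp
      ultimately have "(x * y) * (x + y) \<le> (y * y) * (2 * y)"
        using x y by (intro mult_mono) auto
      then show ?thesis by (simp add: mult_ac)
    qed
    then have "2 / (2 * (y * y * y)) \<le> 2 / (x * y * (x + y))"
    proof (rule divide_left_mono)
      have "0 < x * y * (x + y)" "0 < y * y * y" using x(1) y(1) by (auto intro!: mult_pos_pos add_pos_pos)
      then have "0 < (y * y * y) * (x * y * (x + y))" by (rule mult_pos_pos[rotated])
      then show "0 < 2 * (y * y * y) * (x * y * (x + y))" by linarith
    qed auto
    then show ?thesis unfolding eq by simp
  qed
  finally show ?case using step x_def y_def by simp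
qed

lemma sum_three_halves: "(\<Sum>j=1..N. real j powr (-3/2)) \<le> 3"
proof (cases "N = 0")
  case False
  then have "{1..N} = insert 1 {2..N}" by auto
  then have "(\<Sum>j=1..N. real j powr (-3/2)) = 1 + (\<Sum>j=2..N. real j powr (-3/2))" by simp
  also have "(\<Sum>j=2..N. real j powr (-3/2)) \<le> 2 - 2 / sqrt (real N)"
    using sum_three_halves_from_2[of N] False by simp
  finally show ?thesis using False by (smt (verit) divide_nonneg_nonneg real_sqrt_ge_zero of_nat_0_le_iff)
qed auto

text \<open>
  The sequence \<open>(n + 1) powr (-3/2)\<close> is summable, so convolving with it preserves every decay rate
  up to its own.  In each term the larger of the two arguments is at least \<open>(n + 1) / 2\<close>.
\<close>
lemma convolution_three_halves:
  fixes s :: real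
  assumes "0 \<le> s" "s \<le> 3/2"
  shows "(\<Sum>k=0..n. real (k + 1) powr (-3/2) * real (n - k + 1) powr (- s)) \<le> 24 * real (n + 1) powr (- s)"
proof -
  define h where "h = real (n + 1) / 2"
  have h: "h > 0" by (simp add: h_def)
  have ineq: "real (k + 1) powr (-3/2) * real (n - k + 1) powr (- s)
      \<le> h powr (- s) * (real (k + 1) powr (-3/2) + real (n - k + 1) powr (-3/2))"
    if k: "k \<in> {0..n}" for k
  proof -
    have key: "x powr (-3/2) * y powr (- s) \<le> h powr (- s) * (x powr (-3/2) + y powr (-3/2))"
      if xy: "x > 0" "y > 0" "x + y \<ge> 2 * h" for x y :: real
    proof (cases "y \<ge> h")
      case True
      then have "y powr (- s) \<le> h powr (- s)"
        using h assms by (intro powr_mono2') auto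
      then have "x powr (-3/2) * y powr (- s) \<le> x powr (-3/2) * h powr (- s)"
        by (intro mult_left_mono) auto
      then show ?thesis by (smt (verit) distrib_left mult.commute mult_nonneg_nonneg powr_ge_zero)
    next
      case False
      then have xh: "x \<ge> h" "x \<ge> y" using xy by auto
      have "x powr (-3/2) = x powr (- s) * x powr (- (3/2 - s))"
        by (simp add: powr_add[symmetric])
      also have "\<dots> \<le> h powr (- s) * y powr (- (3/2 - s))"
        using xh xy h assms by (intro mult_mono powr_mono2') auto
      finally have "x powr (-3/2) * y powr (- s) \<le> h powr (- s) * y powr (- (3/2 - s)) * y powr (- s)"
        by (intro mult_right_mono) auto
      also have "\<dots> = h powr (- s) * y powr (-3/2)"
        by (simp add: powr_add[symmetric])
      finally show ?thesis by (smt (verit) distrib_left mult_nonneg_nonneg powr_ge_zero)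
    qed
    show ?thesis using k by (intro key) (auto simp: h_def of_nat_diff)
  qed
  have S: "(\<Sum>k=0..n. real (k + 1) powr (-3/2)) \<le> 3"
  proof -
    have "(\<Sum>k=0..n. real (k + 1) powr (-3/2)) = (\<Sum>j=1..n+1. real j powr (-3/2))"
      by (rule sum.reindex_bij_witness[of _ "\<lambda>j. j - 1" "\<lambda>j. j + 1"]) auto
    then show ?thesis using sum_three_halves[of "n+1"] by simp
  qed
  have S': "(\<Sum>k=0..n. real (n - k + 1) powr (-3/2)) \<le> 3"
  proof -
    have "(\<Sum>k=0..n. real (n - k + 1) powr (-3/2)) = (\<Sum>k=0..n. real (k + 1) powr (-3/2))"
      by (rule sum.reindex_bij_witness[of _ "\<lambda>j. n - j" "\<lambda>j. n - j"]) auto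
    then show ?thesis using S by simp
  qed
  have "(\<Sum>k=0..n. real (k + 1) powr (-3/2) * real (n - k + 1) powr (- s))
     \<le> (\<Sum>k=0..n. h powr (- s) * (real (k + 1) powr (-3/2) + real (n - k + 1) powr (-3/2)))"
    by (intro sum_mono ineq)
  also have "\<dots> = h powr (- s) * ((\<Sum>k=0..n. real (k + 1) powr (-3/2)) + (\<Sum>k=0..n. real (n - k + 1) powr (-3/2)))"
    by (simp only: sum.distrib sum_distrib_left[symmetric])
  also have "\<dots> \<le> h powr (- s) * 6"
    using S S' by (intro mult_left_mono) auto
  also have "h powr (- s) = 2 powr s * real (n + 1) powr (- s)"
    by (simp add: h_def powr_divide powr_minus_divide)
  also have "\<dots> * 6 \<le> (4 * real (n + 1) powr (- s)) * 6"
    using powr_mono[of s 2 "2::real"] assms by (intro mult_right_mono) auto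
  finally show ?thesis by simp
qed

section \<open>The power series of the square root and of its reciprocal\<close>

text \<open>
  The numbers \<open>rsqrt_coeff n\<close> and \<open>sqrt_coeff n\<close> are the Taylor coefficients of \<open>(1 - z) powr (- 1/2)\<close>
  and of \<open>(1 - z) powr (1/2)\<close>.  Up to the factor \<open>sqrt pi\<close> the former are the weights of the half
  integral on the grid to leading order, and convolution with the latter is a discrete half derivative.
\<close>

definition rsqrt_coeff :: "nat \<Rightarrow> real" where
  "rsqrt_coeff n = (- 1) ^ n * ((- 1/2) gchoose n)"

text \<open>
  Multiplying the series of the reciprocal root by \<open>1 - z\<close> gives the series of the root.
\<close>
definition sqrt_coeff :: "nat \<Rightarrow> real" where
  "sqrt_coeff n = (if n = 0 then 1 else rsqrt_coeff n - rsqrt_coeff (n - 1))"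

lemma rsqrt_coeff_0 [simp]: "rsqrt_coeff 0 = 1"
  by (simp add: rsqrt_coeff_def)

lemma rsqrt_coeff_Suc: "rsqrt_coeff (Suc n) = rsqrt_coeff n * (2 * real n + 1) / (2 * real n + 2)"
proof -
  have "real (Suc n) * ((- 1/2 :: real) gchoose Suc n) = (- 1/2 - real n) * ((- 1/2) gchoose n)"
    using gbinomial_mult_1[of "- 1/2 :: real" n] by (simp add: algebra_simps)
  then have "((- 1/2 :: real) gchoose Suc n) = (- 1/2 - real n) * ((- 1/2) gchoose n) / real (Suc n)"
    by (simp add: field_simps del: of_nat_Suc)
  then have "rsqrt_coeff (Suc n) = - ((- 1) ^ n * ((- 1/2 - real n) * ((- 1/2) gchoose n) / real (Suc n)))"
    by (simp add: rsqrt_coeff_def)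
  also have "\<dots> = rsqrt_coeff n * (2 * real n + 1) / (2 * real n + 2)"
    by (simp add: rsqrt_coeff_def divide_simps) (simp add: algebra_simps)
  finally show ?thesis .
qed

lemma rsqrt_coeff_pos: "rsqrt_coeff n > 0"
  by (induction n) (auto simp: rsqrt_coeff_Suc)

text \<open>
  The square of \<open>(1 - z) powr (- 1/2)\<close> is the geometric series.
\<close>
lemma rsqrt_coeff_convolution: "(\<Sum>k\<le>n. rsqrt_coeff k * rsqrt_coeff (n - k)) = 1"
proof -
  have "(\<Sum>k\<le>n. rsqrt_coeff k * rsqrt_coeff (n - k))
     = (\<Sum>k\<in>{0..n}. (- 1) ^ n * (((- 1/2) gchoose k) * ((- 1/2) gchoose (n - k))))"
    by (intro sum.cong) (auto simp: rsqrt_coeff_def power_add[symmetric])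
  also have "\<dots> = (- 1) ^ n * ((- 1/2 + - 1/2 :: real) gchoose n)"
    by (simp only: sum_distrib_left[symmetric] gbinomial_Vandermonde)
  also have "\<dots> = 1"
    using gbinomial_minus[of "1::real" n] binomial_gbinomial[of n n, where 'a = real] by simp
  finally show ?thesis .
qed

lemma sqrt_coeff_convolution:
  "(\<Sum>k\<le>n. sqrt_coeff k * rsqrt_coeff (n - k)) = (if n = 0 then 1 else 0)"
proof (cases n)
  case (Suc m)
  have "(\<Sum>k\<le>Suc m. sqrt_coeff k * rsqrt_coeff (Suc m - k))
     = rsqrt_coeff (Suc m) + (\<Sum>k\<le>m. (rsqrt_coeff (Suc k) - rsqrt_coeff k) * rsqrt_coeff (m - k))"
    by (subst sum.atMost_Suc_shift) (simp add: sqrt_coeff_def)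
  also have "\<dots> = (\<Sum>k\<le>Suc m. rsqrt_coeff k * rsqrt_coeff (Suc m - k)) - (\<Sum>k\<le>m. rsqrt_coeff k * rsqrt_coeff (m - k))"
    by (subst sum.atMost_Suc_shift) (simp add: left_diff_distrib sum_subtractf)
  also have "\<dots> = 0" by (simp only: rsqrt_coeff_convolution)
  finally show ?thesis using Suc by simp
qed (simp add: sqrt_coeff_def)

lemma sqrt_coeff_Suc: "sqrt_coeff (Suc n) = - rsqrt_coeff n / (2 * real n + 2)"
  by (simp add: sqrt_coeff_def rsqrt_coeff_Suc divide_simps) (simp add: algebra_simps)

text \<open>
  All coefficients but the first are negative differences of a decreasing sequence, so the sum telescopes.
\<close>
lemma sum_abs_sqrt_coeff: "(\<Sum>k\<le>n. \<bar>sqrt_coeff k\<bar>) \<le> 2"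
proof -
  have "(\<Sum>k\<le>n. \<bar>sqrt_coeff k\<bar>) = 2 - rsqrt_coeff n"
  proof (induction n)
    case 0
    then show ?case by (simp add: sqrt_coeff_def)
  next
    case (Suc n)
    have "\<bar>sqrt_coeff (Suc n)\<bar> = - sqrt_coeff (Suc n)"
      using rsqrt_coeff_pos[of n] by (simp add: sqrt_coeff_Suc)
    also have "\<dots> = rsqrt_coeff n - rsqrt_coeff (Suc n)" by (simp add: sqrt_coeff_def)
    finally show ?case using Suc by simp
  qed
  then show ?thesis using rsqrt_coeff_pos[of n] by simp
qed

lemma powr_minus_three_halves: "x powr (-3/2) = 1 / (x * sqrt x)" if "x \<ge> 0" for x :: real
proof -
  have "x powr (-3/2) = 1 / x powr (1 + 1/2)" by (simp add: powr_minus_divide)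
  also have "x powr (1 + 1/2) = x * sqrt x"
    using that unfolding powr_add by (simp add: powr_half_sqrt)
  finally show ?thesis .
qed

lemma rsqrt_coeff_le: "rsqrt_coeff n \<le> 1 / sqrt (real (n + 1))"
proof -
  have "(rsqrt_coeff n)\<^sup>2 * real (n + 1) \<le> 1"
  proof (induction n)
    case (Suc n)
    have "(2 * real n + 1)\<^sup>2 * (real n + 2) \<le> (2 * real n + 2)\<^sup>2 * (real n + 1)"
      by (simp add: power2_eq_square algebra_simps)
    then have "(2 * real n + 1)\<^sup>2 * (real n + 2) / (2 * real n + 2)\<^sup>2 \<le> real n + 1"
      by (simp add: divide_simps mult.commute)
    then have "(rsqrt_coeff n)\<^sup>2 * ((2 * real n + 1)\<^sup>2 * (real n + 2) / (2 * real n + 2)\<^sup>2) \<le> (rsqrt_coeff n)\<^sup>2 * (real n + 1)"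
      by (intro mult_left_mono) auto
    then have "(rsqrt_coeff (Suc n))\<^sup>2 * real (Suc n + 1) \<le> (rsqrt_coeff n)\<^sup>2 * (real n + 1)"
      by (simp add: rsqrt_coeff_Suc power_mult_distrib power_divide mult_ac add_ac)
    also have "\<dots> \<le> 1" using Suc by (simp add: add_ac)
    finally show ?case .
  qed auto
  then have "sqrt ((rsqrt_coeff n)\<^sup>2 * real (n + 1)) \<le> 1" by simp
  then have "rsqrt_coeff n * sqrt (real (n + 1)) \<le> 1"
    using rsqrt_coeff_pos[of n] by (simp add: real_sqrt_mult)
  then show ?thesis by (simp add: field_simps)
qed

lemma abs_sqrt_coeff_le: "\<bar>sqrt_coeff n\<bar> \<le> 2 * real (n + 1) powr (-3/2)"
proof (cases n)
  case 0
  then show ?thesis by (simp add: sqrt_coeff_def)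
next
  case (Suc m)
  have "\<bar>sqrt_coeff n\<bar> = rsqrt_coeff m / (2 * real (m + 1))"
    using rsqrt_coeff_pos[of m] Suc by (simp add: sqrt_coeff_Suc add_ac)
  also have "\<dots> \<le> (1 / sqrt (real (m + 1))) / (2 * real (m + 1))"
    by (intro divide_right_mono rsqrt_coeff_le) auto
  also have "\<dots> = (1/2) * real (m + 1) powr (-3/2)"
    by (subst powr_minus_three_halves) auto
  also have "\<dots> \<le> (1/2) * (real (n + 1) / 2) powr (-3/2)"
    using Suc by (intro mult_left_mono powr_mono2') auto
  also have "(real (n + 1) / 2) powr (-3/2) = 2 powr (3/2) * real (n + 1) powr (-3/2)"
    by (simp add: powr_divide powr_minus_divide)
  also have "(1/2) * (2 powr (3/2) * real (n + 1) powr (-3/2)) \<le> (1/2) * (2 powr 2 * real (n + 1) powr (-3/2))"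
    by (intro mult_left_mono mult_right_mono powr_mono) auto
  finally show ?thesis by simp
qed

text \<open>
  Wallis' product, whose limit is \<open>pi / 2\<close>, is what links the coefficients to \<open>pi\<close>.
\<close>
lemma wallis_partial_product:
  "(\<Prod>k=1..n. (4 * real k ^ 2) / (4 * real k ^ 2 - 1)) = 1 / ((rsqrt_coeff n)\<^sup>2 * (2 * real n + 1))"
proof (induction n)
  case (Suc n)
  have c: "rsqrt_coeff n \<noteq> 0" using rsqrt_coeff_pos[of n] by simp
  have "4 * real (Suc n) ^ 2 - 1 = (2 * real n + 1) * (2 * real n + 3)"
    by (simp add: power2_eq_square algebra_simps)
  moreover have "4 * real (Suc n) ^ 2 = (2 * real n + 2)\<^sup>2" by (simp add: power2_eq_square algebra_simps)
  ultimately have "(\<Prod>k=1..Suc n. (4 * real k ^ 2) / (4 * real k ^ 2 - 1))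
     = 1 / ((rsqrt_coeff n)\<^sup>2 * (2 * real n + 1)) * ((2 * real n + 2)\<^sup>2 / ((2 * real n + 1) * (2 * real n + 3)))"
    using Suc by simp
  also have "\<dots> = 1 / ((rsqrt_coeff (Suc n))\<^sup>2 * (2 * real (Suc n) + 1))"
    using c by (simp add: rsqrt_coeff_Suc power_divide power_mult_distrib)
      (simp add: power2_eq_square mult_ac add_ac)
  finally show ?case .
qed simp

text \<open>
  The partial products increase to \<open>pi / 2\<close>.
\<close>
lemma rsqrt_coeff_wallis_lower: "1 \<le> pi * (rsqrt_coeff n)\<^sup>2 * (real n + 1/2)"
proof -
  let ?P = "\<lambda>n. \<Prod>k=1..n. (4 * real k ^ 2) / (4 * real k ^ 2 - 1)"
  have "incseq ?P"
  proof (rule incseq_SucI)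
    fix n
    have "?P n \<ge> 0" unfolding wallis_partial_product by simp
    moreover have "1 \<le> (4 * real (Suc n) ^ 2) / (4 * real (Suc n) ^ 2 - 1)"
      by (subst le_divide_eq_1_pos) (auto simp: power2_eq_square algebra_simps intro!: add_pos_nonneg)
    ultimately have "?P n * 1 \<le> ?P n * ((4 * real (Suc n) ^ 2) / (4 * real (Suc n) ^ 2 - 1))"
      by (intro mult_left_mono)
    then show "?P n \<le> ?P (Suc n)" by simp
  qed
  then have "?P n \<le> pi / 2" using wallis by (rule incseq_le)
  then have "1 / X \<le> pi / 2" if "X = (rsqrt_coeff n)\<^sup>2 * (2 * real n + 1)" for X
    unfolding wallis_partial_product that .
  moreover have "(rsqrt_coeff n)\<^sup>2 * (2 * real n + 1) > 0"
    using rsqrt_coeff_pos[of n] by (intro mult_pos_pos) auto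
  ultimately have "1 \<le> pi / 2 * ((rsqrt_coeff n)\<^sup>2 * (2 * real n + 1))"
    by (simp add: divide_le_eq)
  also have "\<dots> = pi * (rsqrt_coeff n)\<^sup>2 * (real n + 1/2)" by (simp add: algebra_simps)
  finally show ?thesis .
qed

text \<open>
  The left-hand side without \<open>pi\<close> increases in \<open>n\<close> and has limit \<open>1 / pi\<close>.
\<close>
lemma rsqrt_coeff_wallis_upper: "pi * (rsqrt_coeff n)\<^sup>2 * real n \<le> 1"
proof -
  let ?P = "\<lambda>n. \<Prod>k=1..n. (4 * real k ^ 2) / (4 * real k ^ 2 - 1)"
  let ?c = "\<lambda>n. (rsqrt_coeff n)\<^sup>2 * real n"
  have "incseq ?c"
  proof (rule incseq_SucI)
    fix n
    have "real n * (2 * real n + 2)\<^sup>2 \<le> (2 * real n + 1)\<^sup>2 * (real n + 1)"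
      by (simp add: power2_eq_square algebra_simps)
    then have "real n \<le> (2 * real n + 1)\<^sup>2 * (real n + 1) / (2 * real n + 2)\<^sup>2"
      by (simp add: field_simps)
    then have "(rsqrt_coeff n)\<^sup>2 * real n \<le> (rsqrt_coeff n)\<^sup>2 * ((2 * real n + 1)\<^sup>2 * (real n + 1) / (2 * real n + 2)\<^sup>2)"
      by (intro mult_left_mono) auto
    also have "\<dots> = ?c (Suc n)"
      by (simp add: rsqrt_coeff_Suc power_divide power_mult_distrib mult_ac add_ac)
    finally show "?c n \<le> ?c (Suc n)" .
  qed
  moreover have "?c \<longlonglongrightarrow> 1 / pi"
  proof -
    have "(\<lambda>n. inverse (?P n) * (real n / (2 * real n + 1))) \<longlonglongrightarrow> inverse (pi / 2) * (1/2)"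
    proof (intro tendsto_mult tendsto_inverse wallis)
      have "(\<lambda>n. 1 / (2 * real n + 1)) \<longlonglongrightarrow> 0"
      proof (rule tendsto_sandwich)
        show "\<forall>\<^sub>F n in sequentially. 1 / (2 * real n + 1) \<le> inverse (real (Suc n))"
          by (intro always_eventually allI) (simp add: field_simps)
        show "\<forall>\<^sub>F n in sequentially. 0 \<le> 1 / (2 * real n + 1)"
          by (intro always_eventually allI) simp
      qed (use LIMSEQ_inverse_real_of_nat in auto)
      then have "(\<lambda>n. 1/2 - (1/2) * (1 / (2 * real n + 1))) \<longlonglongrightarrow> 1/2 - (1/2) * 0"
        by (intro tendsto_intros)
      moreover have "1/2 - (1/2) * (1 / (2 * real n + 1)) = real n / (2 * real n + 1)" for n
        by (simp add: field_simps)
      ultimately show "(\<lambda>n. real n / (2 * real n + 1)) \<longlonglongrightarrow> 1 / 2" by simp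
    qed auto
    moreover have "inverse (?P n) * (real n / (2 * real n + 1)) = ?c n" for n
      unfolding wallis_partial_product by (simp add: field_simps)
    ultimately show ?thesis by simp
  qed
  ultimately have "?c n \<le> 1 / pi" by (rule incseq_le)
  then show ?thesis by (simp add: field_simps)
qed

section \<open>The trapezoidal weights of the pure Abel kernel\<close>

text \<open>
  For \<open>\<alpha> = 0\<close> the weights of the scheme depend only on \<open>n = i - j\<close>: they are the integrals of
  \<open>(i - u) powr (- 1/2)\<close> against the hat function at \<open>j\<close>.  Integrating twice gives the second
  difference of \<open>4/3 * x powr (3/2)\<close>; at \<open>n = 0\<close> only half of the hat lies in the domain.
\<close>

definition abel_weight :: "nat \<Rightarrow> real" where
  "abel_weight n = (if n = 0 then 4/3 else
     4/3 * (real (n + 1) * sqrt (real (n + 1)) - 2 * (real n * sqrt (real n))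
            + real (n - 1) * sqrt (real (n - 1))))"

text \<open>
  A hat function has mass one, so the weight is \<open>1 / sqrt n\<close> up to a relative error of order
  \<open>1 / n\<^sup>2\<close>, and it is larger by convexity.  With \<open>x = sqrt (n + 1)\<close>, \<open>y = sqrt n\<close>, \<open>z = sqrt (n - 1)\<close> and
  \<open>t = (x + z) / (2 * y)\<close> both the weight and \<open>1 / y\<close> become \<open>y ^ 3\<close> times a polynomial in \<open>t\<close>, because
  \<open>1 / y ^ 4 = 4 * t\<^sup>2 * (1 - t\<^sup>2)\<close>.  Both bounds are then polynomial inequalities in \<open>r = 1 - t\<close>,
  which is small.
\<close>
lemma abel_weight_bounds:
  assumes "n \<ge> 2"
  shows "1 / sqrt (real n) \<le> abel_weight n"
    and "abel_weight n \<le> 1 / sqrt (real n) * (1 + 1 / (12 * (real n)\<^sup>2))"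
proof -
  define x y z where "x = sqrt (real n + 1)" and "y = sqrt (real n)" and "z = sqrt (real n - 1)"
  define t where "t = (x + z) / (2 * y)"
  define r where "r = 1 - t"
  have n: "real n \<ge> 2" using assms by simp
  have pos: "x > 0" "y > 0" "z > 0" using n by (auto simp: x_def y_def z_def)
  have sq: "x\<^sup>2 = y\<^sup>2 + 1" "z\<^sup>2 = y\<^sup>2 - 1" "y\<^sup>2 = real n"
    using n by (auto simp: x_def y_def z_def)
  have xz2: "(x * z)\<^sup>2 = y ^ 4 - 1"
  proof -
    have "(x * z)\<^sup>2 = (y\<^sup>2 + 1) * (y\<^sup>2 - 1)" by (simp only: power_mult_distrib sq(1,2))
    also have "\<dots> = (y\<^sup>2)\<^sup>2 - 1" by (simp only: power2_eq_square[of "y\<^sup>2"] algebra_simps)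
    also have "(y\<^sup>2)\<^sup>2 = y ^ 4" by simp
    finally show ?thesis .
  qed
  have y4: "y ^ 4 \<ge> 4"
  proof -
    have "y ^ 4 = (y\<^sup>2)\<^sup>2" by simp
    also have "\<dots> \<ge> 2\<^sup>2" using n unfolding sq by (intro power_mono) auto
    finally show ?thesis by simp
  qed
  have xz_low: "x * z \<ge> 17/20 * y\<^sup>2"
  proof (rule power2_le_imp_le)
    have "(17/20 * y\<^sup>2)\<^sup>2 = (17/20)\<^sup>2 * (y\<^sup>2)\<^sup>2" by (rule power_mult_distrib)
    also have "\<dots> = 289/400 * y ^ 4" by (simp add: power_divide)
    also have "\<dots> \<le> y ^ 4 - 1" using y4 by simp
    finally show "(17/20 * y\<^sup>2)\<^sup>2 \<le> (x * z)\<^sup>2" using xz2 by simp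
  qed (use pos in simp)
  have xz_high: "x * z \<le> y\<^sup>2"
  proof (rule power2_le_imp_le)
    have "(y\<^sup>2)\<^sup>2 = y ^ 4" by simp
    then show "(x * z)\<^sup>2 \<le> (y\<^sup>2)\<^sup>2" using xz2 by linarith
  qed simp
  have ty: "2 * t * y = x + z" using pos by (simp add: t_def)
  have "4 * t\<^sup>2 * y\<^sup>2 = (x + z)\<^sup>2" unfolding ty[symmetric] by (simp add: power_mult_distrib)
  also have "\<dots> = x\<^sup>2 + z\<^sup>2 + 2 * (x * z)" by (simp add: power2_eq_square algebra_simps)
  also have "\<dots> = 2 * y\<^sup>2 + 2 * (x * z)" unfolding sq(1,2) by simp
  finally have t2: "2 * t\<^sup>2 * y\<^sup>2 = y\<^sup>2 + x * z" by linarith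
  have tpos: "t > 0" using pos by (simp add: t_def)
  have t_high: "t \<le> 1"
  proof -
    have "(t\<^sup>2) * y\<^sup>2 \<le> 1 * y\<^sup>2" using t2 xz_high by linarith
    then have "t\<^sup>2 \<le> 1" by (rule mult_right_le_imp_le) (use pos in simp)
    then show ?thesis using power2_le_imp_le[of t 1] by simp
  qed
  have t_low: "t \<ge> 19/20"
  proof (rule power2_le_imp_le)
    have "(37/40) * y\<^sup>2 \<le> t\<^sup>2 * y\<^sup>2" using t2 xz_low by linarith
    then have "37/40 \<le> t\<^sup>2" by (rule mult_right_le_imp_le) (use pos in simp)
    moreover have "(19/20 :: real)\<^sup>2 \<le> 37/40" by (simp add: power2_eq_square)
    ultimately show "(19/20)\<^sup>2 \<le> t\<^sup>2" by linarith
  qed (use tpos in simp)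
  have r: "0 \<le> r" "r \<le> 1/20" using t_high t_low by (auto simp: r_def)
  have xz: "x * z = y\<^sup>2 * (2 * t\<^sup>2 - 1)"
  proof -
    have "y\<^sup>2 * (2 * t\<^sup>2 - 1) = 2 * t\<^sup>2 * y\<^sup>2 - y\<^sup>2" by (simp add: algebra_simps)
    then show ?thesis using t2 by linarith
  qed
  define \<sigma> where "\<sigma> = 4 * t\<^sup>2 * (1 - t\<^sup>2)"
  have y4\<sigma>: "y ^ 4 * \<sigma> = 1"
  proof -
    have "y ^ 4 * (2 * t\<^sup>2 - 1)\<^sup>2 = y ^ 4 - 1"
      using xz2 unfolding xz by (simp add: power_mult_distrib)
    moreover have "y ^ 4 * \<sigma> = y ^ 4 - y ^ 4 * (2 * t\<^sup>2 - 1)\<^sup>2"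
      by (simp add: \<sigma>_def power2_eq_square algebra_simps)
    ultimately show ?thesis by simp
  qed
  have w: "abel_weight n = 4/3 * y ^ 3 * (6 * t - 4 * t ^ 3 - 2)"
  proof -
    have "abel_weight n = 4/3 * (x ^ 3 + z ^ 3 - 2 * y ^ 3)"
    proof -
      have "x ^ 3 = real (n + 1) * sqrt (real (n + 1))" "z ^ 3 = real (n - 1) * sqrt (real (n - 1))"
        "y ^ 3 = real n * sqrt (real n)"
        using assms by (simp_all add: x_def y_def z_def power3_eq_cube of_nat_diff add.commute)
      then show ?thesis using assms by (simp add: abel_weight_def)
    qed
    also have "x ^ 3 + z ^ 3 = (x + z) * (x\<^sup>2 + z\<^sup>2 - x * z)" by (simp add: power2_eq_square power3_eq_cube algebra_simps)
    also have "\<dots> = (2 * t * y) * (2 * y\<^sup>2 - y\<^sup>2 * (2 * t\<^sup>2 - 1))"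
      unfolding ty xz using sq by simp
    also have "\<dots> = y ^ 3 * (6 * t - 4 * t ^ 3)" by (simp add: power2_eq_square power3_eq_cube algebra_simps)
    finally have "abel_weight n = 4/3 * (y ^ 3 * (6 * t - 4 * t ^ 3) - 2 * y ^ 3)" .
    moreover have "y ^ 3 * (6 * t - 4 * t ^ 3) - 2 * y ^ 3 = y ^ 3 * (6 * t - 4 * t ^ 3 - 2)"
      by (simp add: algebra_simps)
    ultimately show ?thesis by (simp only: mult.assoc)
  qed
  have inv_y: "1 / y = y ^ 3 * \<sigma>"
  proof -
    have "y * (y ^ 3 * \<sigma>) = 1" using y4\<sigma> by (simp only: power4_eq_xxxx power3_eq_cube mult_ac)
    then show ?thesis using pos by (simp add: divide_eq_eq mult.commute)
  qed
  have \<sigma>r: "\<sigma> = 4 * r * (2 - r) * (1 - r)\<^sup>2"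
    by (simp add: \<sigma>_def r_def power2_eq_square algebra_simps)
  have diff: "4/3 * (6 * t - 4 * t ^ 3 - 2) - \<sigma> = r\<^sup>2 * (4 - 32/3 * r + 4 * r\<^sup>2)"
  proof -
    have "4 * (6 * t - 4 * t ^ 3 - 2) - 3 * \<sigma> = r\<^sup>2 * (12 - 32 * r + 12 * r\<^sup>2)"
      by (simp add: \<sigma>_def r_def power2_eq_square power3_eq_cube algebra_simps)
    moreover have "r\<^sup>2 * (12 - 32 * r + 12 * r\<^sup>2) = 3 * (r\<^sup>2 * (4 - 32/3 * r + 4 * r\<^sup>2))"
      by (simp add: algebra_simps)
    ultimately show ?thesis by linarith
  qed
  show "1 / sqrt (real n) \<le> abel_weight n"
  proof -
    have "32/3 * r \<le> 4" using r by simp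
    then have "0 \<le> 4 - 32/3 * r + 4 * r\<^sup>2" using zero_le_power2[of r] by linarith
    then have "0 \<le> r\<^sup>2 * (4 - 32/3 * r + 4 * r\<^sup>2)" by (rule mult_nonneg_nonneg[OF zero_le_power2])
    then have "\<sigma> \<le> 4/3 * (6 * t - 4 * t ^ 3 - 2)" using diff by linarith
    then have "y ^ 3 * \<sigma> \<le> y ^ 3 * (4/3 * (6 * t - 4 * t ^ 3 - 2))" using pos by (intro mult_left_mono) auto
    also have "\<dots> = abel_weight n" unfolding w by simp
    finally show ?thesis using inv_y by (simp add: y_def)
  qed
  show "abel_weight n \<le> 1 / sqrt (real n) * (1 + 1 / (12 * (real n)\<^sup>2))"
  proof -
    have "1 / y ^ 4 = \<sigma>" using y4\<sigma> pos by (simp add: field_simps)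
    moreover have "y ^ 4 = (real n)\<^sup>2" unfolding sq(3)[symmetric] by simp
    ultimately have "1 / (real n)\<^sup>2 = \<sigma>" by simp
    then have rhs: "1 / sqrt (real n) * (1 + 1 / (12 * (real n)\<^sup>2)) = y ^ 3 * (\<sigma> + \<sigma>\<^sup>2 / 12)"
    proof -
      have "1 / (12 * (real n)\<^sup>2) = \<sigma> / 12" using \<open>1 / (real n)\<^sup>2 = \<sigma>\<close> by simp
      then have "1 / sqrt (real n) * (1 + 1 / (12 * (real n)\<^sup>2)) = (y ^ 3 * \<sigma>) * (1 + \<sigma> / 12)"
        using inv_y y_def by simp
      then show ?thesis by (simp add: power2_eq_square algebra_simps)
    qed
    have "4 - 32/3 * r + 4 * r\<^sup>2 \<le> 4"
    proof -
      have "r\<^sup>2 \<le> r" using r by (simp add: power2_eq_square mult_left_le)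
      then show ?thesis using r by simp
    qed
\<comment> \<open>the lower bound for \<open>t\<close>, hence the assumption \<open>n \<ge> 2\<close>, enters here: \<open>r \<le> 1/20\<close> is
  small enough for the constant \<open>1/12\<close>\<close>
    also have "(4::real) \<le> 4/3 * ((39/20)\<^sup>2 * ((19/20)\<^sup>2)\<^sup>2)" by (simp add: power2_eq_square)
    also have "\<dots> \<le> 4/3 * ((2 - r)\<^sup>2 * ((1 - r)\<^sup>2)\<^sup>2)"
      using r by (intro mult_left_mono mult_mono power_mono) auto
    finally have "r\<^sup>2 * (4 - 32/3 * r + 4 * r\<^sup>2) \<le> r\<^sup>2 * (4/3 * ((2 - r)\<^sup>2 * ((1 - r)\<^sup>2)\<^sup>2))"
      by (intro mult_left_mono) auto
    also have "\<dots> = \<sigma>\<^sup>2 / 12" unfolding \<sigma>r by (simp add: power_mult_distrib)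
    finally have "4/3 * (6 * t - 4 * t ^ 3 - 2) \<le> \<sigma> + \<sigma>\<^sup>2 / 12" using diff by linarith
    then have "y ^ 3 * (4/3 * (6 * t - 4 * t ^ 3 - 2)) \<le> y ^ 3 * (\<sigma> + \<sigma>\<^sup>2 / 12)"
      using pos by (intro mult_left_mono) auto
    also have "y ^ 3 * (4/3 * (6 * t - 4 * t ^ 3 - 2)) = abel_weight n" unfolding w by simp
    finally show ?thesis using rhs by simp
  qed
qed

lemma sqrt_pi_bounds: "1772/1000 \<le> sqrt pi" "sqrt pi \<le> 17725/10000"
proof -
  show "1772/1000 \<le> sqrt pi" using pi_approx by (intro real_le_rsqrt) (simp add: power2_eq_square)
  show "sqrt pi \<le> 17725/10000" using pi_approx by (intro real_le_lsqrt) (simp_all add: power2_eq_square)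
qed

lemma abel_weight_0: "abel_weight 0 = 4/3"
  by (simp add: abel_weight_def)

lemma abel_weight_1: "abel_weight 1 = 8/3 * (sqrt 2 - 1)"
  by (simp add: abel_weight_def)

lemma sqrt_2_bounds: "14142/10000 \<le> sqrt 2" "sqrt 2 \<le> 14143/10000"
proof -
  show "14142/10000 \<le> sqrt 2" by (intro real_le_rsqrt) (simp add: power2_eq_square)
  show "sqrt 2 \<le> 14143/10000" by (intro real_le_lsqrt) (simp_all add: power2_eq_square)
qed

text \<open>
  Averaging over a hat shifts the comparison sequence by a quarter of a step:
  \<open>sqrt pi * rsqrt_coeff n\<close> is \<open>1 / sqrt n * (1 - 1 / (8 * n))\<close> to second order, and the weights \<open>3/4\<close>
  and \<open>1/4\<close> cancel the correction \<open>1 / (8 * n)\<close>.  What remains is numerically small.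
\<close>
definition abel_defect :: "nat \<Rightarrow> real" where
  "abel_defect n = abel_weight n -
     sqrt pi * (3/4 * rsqrt_coeff n + (if n = 0 then 0 else 1/4 * rsqrt_coeff (n - 1)))"

lemma abs_abel_defect_0: "\<bar>abel_defect 0\<bar> \<le> 1/100"
  using sqrt_pi_bounds by (simp add: abel_defect_def abel_weight_0)

lemma abs_abel_defect_1: "\<bar>abel_defect 1\<bar> \<le> 1/100"
proof -
  have c: "rsqrt_coeff (Suc 0) = 1/2" by (simp add: rsqrt_coeff_Suc)
  have "abel_defect 1 = 8/3 * (sqrt 2 - 1) - 5/8 * sqrt pi"
    unfolding abel_defect_def abel_weight_1 by (simp add: c)
  moreover have "11045/10000 \<le> 8/3 * (sqrt 2 - 1)" "8/3 * (sqrt 2 - 1) \<le> 11049/10000"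
    using sqrt_2_bounds by simp_all
  moreover have "11075/10000 \<le> 5/8 * sqrt pi" "5/8 * sqrt pi \<le> 11079/10000"
    using sqrt_pi_bounds by simp_all
  ultimately show ?thesis by (simp only: abs_le_iff) (intro conjI; linarith)
qed

text \<open>
  Both sides are expanded around \<open>Y = 1 / sqrt n\<close>; the Wallis bounds give
  \<open>Y * (1 - 1 / (4 * n)) \<le> sqrt pi * rsqrt_coeff n \<le> Y\<close>.  The constant \<open>3/16\<close> is crude, but small enough for
  the diagonal dominance that follows.
\<close>
lemma abs_abel_defect_le:
  assumes "n \<ge> 2"
  shows "\<bar>abel_defect n\<bar> \<le> 3/16 * real n powr (-3/2)"
proof -
  define Y S u where "Y = 1 / sqrt (real n)" and "S = sqrt pi * rsqrt_coeff n" and "u = 1 / real n"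
  obtain m where m: "n = Suc m" using assms by (cases n) auto
  have n: "real n \<ge> 2" using assms by simp
  have Y: "Y > 0" "Y\<^sup>2 = u" using n by (auto simp: Y_def u_def power_divide)
  have u: "0 < u" "u \<le> 1/2" "u * real n = 1" using n by (auto simp: u_def divide_simps)
  have S: "S > 0" using rsqrt_coeff_pos[of n] by (simp add: S_def)
  have S2: "S\<^sup>2 = pi * (rsqrt_coeff n)\<^sup>2" by (simp add: S_def power_mult_distrib)
  have prev: "rsqrt_coeff (n - 1) = rsqrt_coeff n * (2 * real n) / (2 * real n - 1)"
  proof -
    have "rsqrt_coeff n * (2 * real n) = rsqrt_coeff (n - 1) * (2 * real n - 1)"
      using m by (simp add: rsqrt_coeff_Suc divide_simps) (simp add: algebra_simps)
    then show ?thesis using n by (simp add: divide_simps)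
  qed
  have eq: "3/4 * c + 1/4 * (c * (2 * real n) / (2 * real n - 1)) = c * (1 + 1 / (4 * (2 * real n - 1)))" for c :: real
    using n by (simp add: divide_simps) (simp add: algebra_simps)
  have "n \<noteq> 0" using assms by simp
  then have def: "abel_defect n = abel_weight n - S * (1 + 1 / (4 * (2 * real n - 1)))"
    unfolding abel_defect_def prev by (simp only: if_False eq S_def mult.assoc)
  have S_le: "S \<le> Y"
  proof (rule power2_le_imp_le)
    have "S\<^sup>2 * real n \<le> 1" using rsqrt_coeff_wallis_upper[of n] unfolding S2 .
    then show "S\<^sup>2 \<le> Y\<^sup>2" unfolding Y(2) u_def using n by (simp add: field_simps)
  qed (use Y in simp)
  have S_ge: "Y * (1 - u / 4) \<le> S"
  proof (rule power2_le_imp_le)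
    have "1 \<le> S\<^sup>2 * (real n + 1/2)" using rsqrt_coeff_wallis_lower[of n] unfolding S2 .
    then have "u * 1 \<le> u * (S\<^sup>2 * (real n + 1/2))" using u by (intro mult_left_mono) auto
    also have "\<dots> = S\<^sup>2 * (u * real n + u / 2)" by (simp add: algebra_simps)
    finally have 1: "u \<le> S\<^sup>2 * (1 + u / 2)" using u by simp
    have "(1 - u / 4)\<^sup>2 * (1 + u / 2) = 1 - u\<^sup>2 * (3/16 - u / 32)"
      by (simp add: power2_eq_square field_simps)
    also have "\<dots> \<le> 1" using u by simp
    finally have "u * ((1 - u / 4)\<^sup>2 * (1 + u / 2)) \<le> u * 1" using u by (intro mult_left_mono) auto
    then have "(Y * (1 - u / 4))\<^sup>2 * (1 + u / 2) \<le> S\<^sup>2 * (1 + u / 2)"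
      using 1 Y(2) by (simp add: power_mult_distrib mult.assoc)
    then show "(Y * (1 - u / 4))\<^sup>2 \<le> S\<^sup>2"
      using u by (subst (asm) mult_le_cancel_right) auto
  qed (use S in simp)
  have frac: "u / 8 \<le> 1 / (4 * (2 * real n - 1))" "1 / (4 * (2 * real n - 1)) \<le> u / 6"
    using n by (auto simp: u_def divide_simps)
  have up: "abel_weight n \<le> Y * (1 + u\<^sup>2 / 12)"
    using abel_weight_bounds(2)[OF assms] by (simp add: Y_def u_def power_divide mult.commute)
  have low: "Y \<le> abel_weight n"
    using abel_weight_bounds(1)[OF assms] by (simp add: Y_def)
  have "abel_defect n \<le> Y * (1 + u\<^sup>2 / 12) - (Y * (1 - u / 4)) * (1 + u / 8)"
  proof -
    have "(Y * (1 - u / 4)) * (1 + u / 8) \<le> S * (1 + 1 / (4 * (2 * real n - 1)))"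
      using frac S_ge S u by (intro mult_mono) auto
    then show ?thesis using up def by linarith
  qed
  also have "\<dots> = Y * u * (1/8 + 11/96 * u)" by (simp add: power2_eq_square algebra_simps)
  also have "\<dots> \<le> Y * u * (3/16)" using Y u by (intro mult_left_mono) auto
  finally have A: "abel_defect n \<le> 3/16 * (Y * u)" by simp
  have "S * (1 + 1 / (4 * (2 * real n - 1))) \<le> Y * (1 + u / 6)"
    using frac S_le S u Y n by (intro mult_mono) auto
  then have "abel_defect n \<ge> Y - Y * (1 + u / 6)" using low def by linarith
  then have B: "abel_defect n \<ge> - (3/16 * (Y * u))"
  proof -
    have "Y - Y * (1 + u / 6) = - (1/6 * (Y * u))" by (simp add: algebra_simps)
    moreover have "1/6 * (Y * u) \<le> 3/16 * (Y * u)" using Y u by (intro mult_right_mono) auto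
    ultimately show ?thesis using \<open>abel_defect n \<ge> Y - Y * (1 + u / 6)\<close> by linarith
  qed
  have "Y * u = real n powr (-3/2)"
    using n by (subst powr_minus_three_halves) (auto simp: Y_def u_def)
  then show ?thesis using A B by (simp add: abs_le_iff)
qed

section \<open>Diagonal dominance after a discrete half derivative\<close>

text \<open>
  The convolution matrix of \<open>abel_weight\<close> is not diagonally dominant.  Multiplied by the discrete
  half derivative it becomes the convolution matrix of \<open>abel_symbol\<close>, which is.
\<close>

definition abel_symbol :: "nat \<Rightarrow> real" where
  "abel_symbol n = (\<Sum>k\<le>n. sqrt_coeff k * abel_weight (n - k))"

lemma abel_symbol_0: "abel_symbol 0 = 4/3"
  by (simp add: abel_symbol_def abel_weight_0 sqrt_coeff_def)

text \<open>
  In terms of generating functions the symbol is \<open>sqrt pi * (3/4 + z/4)\<close> plus the product of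
  \<open>(1 - z) powr (1/2)\<close> with the series of the defects.
\<close>
lemma abel_symbol_decomposition:
  "abel_symbol n = sqrt pi * (if n = 0 then 3/4 else if n = 1 then 1/4 else 0)
     + (\<Sum>k\<le>n. sqrt_coeff k * abel_defect (n - k))"
proof -
  have shifted: "(\<Sum>k\<le>n. sqrt_coeff k * (if n - k = 0 then 0 else 1/4 * rsqrt_coeff (n - k - 1)))
      = (if n = 1 then 1/4 else 0)"
  proof (cases n)
    case (Suc m)
    have "(\<Sum>k\<le>Suc m. sqrt_coeff k * (if Suc m - k = 0 then 0 else 1/4 * rsqrt_coeff (Suc m - k - 1)))
       = (\<Sum>k\<le>m. 1/4 * (sqrt_coeff k * rsqrt_coeff (m - k)))"
      by (simp add: Suc_diff_le cong: sum.cong_simp)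
    then show ?thesis using Suc by (simp only: sum_distrib_left[symmetric] sqrt_coeff_convolution) simp
  qed simp
  have "abel_symbol n = (\<Sum>k\<le>n. sqrt pi * (3/4) * (sqrt_coeff k * rsqrt_coeff (n - k))
       + sqrt pi * (sqrt_coeff k * (if n - k = 0 then 0 else 1/4 * rsqrt_coeff (n - k - 1)))
       + sqrt_coeff k * abel_defect (n - k))"
    unfolding abel_symbol_def abel_defect_def by (intro sum.cong refl) (simp add: algebra_simps)
  also have "\<dots> = sqrt pi * (3/4) * (if n = 0 then 1 else 0) + sqrt pi * (if n = 1 then 1/4 else 0)
       + (\<Sum>k\<le>n. sqrt_coeff k * abel_defect (n - k))"
    by (simp only: sum.distrib sum_distrib_left[symmetric] shifted sqrt_coeff_convolution)
  finally show ?thesis by (simp add: algebra_simps)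
qed

lemma sum_convolution_le:
  fixes x y :: "nat \<Rightarrow> real"
  assumes "\<And>n. 0 \<le> x n" "\<And>n. 0 \<le> y n"
  shows "(\<Sum>n\<le>N. \<Sum>k\<le>n. x k * y (n - k)) \<le> (\<Sum>k\<le>N. x k) * (\<Sum>k\<le>N. y k)"
proof -
  have "(\<Sum>n\<le>N. \<Sum>k\<le>n. x k * y (n - k)) = (\<Sum>(i,j)\<in>{(i,j). i + j \<le> N}. x i * y j)"
    by (rule sum.triangle_reindex_eq[symmetric])
  also have "\<dots> \<le> (\<Sum>(i,j)\<in>{..N} \<times> {..N}. x i * y j)"
    using assms by (intro sum_mono2) auto
  also have "\<dots> = (\<Sum>k\<le>N. x k) * (\<Sum>k\<le>N. y k)"
    by (simp add: sum_product sum.cartesian_product)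
  finally show ?thesis .
qed

lemma sum_abs_abel_defect: "(\<Sum>n\<le>N. \<bar>abel_defect n\<bar>) \<le> 395/1000"
proof -
  have "(\<Sum>n\<le>N. \<bar>abel_defect n\<bar>) \<le> (\<Sum>n\<in>{0,1} \<union> {2..N+1}. \<bar>abel_defect n\<bar>)"
    by (intro sum_mono2) auto
  also have "\<dots> = \<bar>abel_defect 0\<bar> + \<bar>abel_defect 1\<bar> + (\<Sum>n=2..N+1. \<bar>abel_defect n\<bar>)"
    by (subst sum.union_disjoint) auto
  also have "(\<Sum>n=2..N+1. \<bar>abel_defect n\<bar>) \<le> (\<Sum>n=2..N+1. 3/16 * real n powr (-3/2))"
    by (intro sum_mono abs_abel_defect_le) auto
  also have "\<dots> = 3/16 * (\<Sum>n=2..N+1. real n powr (-3/2))" by (rule sum_distrib_left[symmetric])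
  also have "\<dots> \<le> 3/16 * 2"
  proof (intro mult_left_mono)
    have "(\<Sum>n=2..N+1. real n powr (-3/2)) \<le> 2 - 2 / sqrt (real (N + 1))"
      by (rule sum_three_halves_from_2) simp
    also have "\<dots> \<le> 2" by simp
    finally show "(\<Sum>n=2..N+1. real n powr (-3/2)) \<le> 2" .
  qed simp
  finally show ?thesis using abs_abel_defect_0 abs_abel_defect_1 by linarith
qed

text \<open>
  The key inequality of the stability proof: the off-diagonal entries sum to less than the diagonal
  entry \<open>4/3\<close>.  They are bounded by \<open>sqrt pi / 4\<close> plus twice the sum of the defects, the factor two being
  the bound on the sum of \<open>\<bar>sqrt_coeff k\<bar>\<close>.
\<close>
lemma sum_abs_abel_symbol: "(\<Sum>n=1..N. \<bar>abel_symbol n\<bar>) \<le> 5/4"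
proof -
  let ?r = "\<lambda>n. \<Sum>k\<le>n. \<bar>sqrt_coeff k\<bar> * \<bar>abel_defect (n - k)\<bar>"
  have "(\<Sum>n=1..N. \<bar>abel_symbol n\<bar>) \<le> (\<Sum>n=1..N. sqrt pi * (if n = 1 then 1/4 else 0) + ?r n)"
  proof (rule sum_mono)
    fix n assume n: "n \<in> {1..N}"
    have "\<bar>\<Sum>k\<le>n. sqrt_coeff k * abel_defect (n - k)\<bar> \<le> ?r n"
      by (rule order_trans[OF sum_abs]) (simp add: abs_mult)
    moreover have "abel_symbol n = sqrt pi * (if n = 1 then 1/4 else 0) + (\<Sum>k\<le>n. sqrt_coeff k * abel_defect (n - k))"
      using n by (subst abel_symbol_decomposition) auto
    moreover have "0 \<le> sqrt pi * (if n = 1 then 1/4 else 0)" by simp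
    ultimately show "\<bar>abel_symbol n\<bar> \<le> sqrt pi * (if n = 1 then 1/4 else 0) + ?r n" by linarith
  qed
  also have "\<dots> = sqrt pi * (\<Sum>n=1..N. if n = 1 then 1/4 else 0) + (\<Sum>n=1..N. ?r n)"
    by (simp only: sum.distrib sum_distrib_left)
  also have "\<dots> \<le> sqrt pi * (1/4) + (\<Sum>n\<le>N. ?r n)"
    by (intro add_mono mult_left_mono sum_mono2) (auto intro!: sum_nonneg)
  also have "(\<Sum>n\<le>N. ?r n) \<le> (\<Sum>k\<le>N. \<bar>sqrt_coeff k\<bar>) * (\<Sum>k\<le>N. \<bar>abel_defect k\<bar>)"
    by (rule sum_convolution_le) auto
  also have "\<dots> \<le> 2 * (395/1000)"
    by (intro mult_mono sum_abs_sqrt_coeff sum_abs_abel_defect) (auto intro!: sum_nonneg)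
  finally show ?thesis using sqrt_pi_bounds by simp
qed

lemma abs_abel_defect_decay: "\<bar>abel_defect n\<bar> \<le> real (n + 1) powr (-3/2)"
proof -
  consider "n = 0" | "n = 1" | "n \<ge> 2" by linarith
  then show ?thesis
  proof cases
    case 1
    then show ?thesis using abs_abel_defect_0 by simp
  next
    case 2
    have "1/4 \<le> (2::real) powr (-3/2)"
    proof -
      have "(2::real) powr (-2) \<le> 2 powr (-3/2)" by (intro powr_mono) auto
      then show ?thesis by (simp add: powr_minus_divide)
    qed
    then show ?thesis using 2 abs_abel_defect_1 by simp
  next
    case 3
    have "real n powr (-3/2) \<le> (real (n + 1) / 2) powr (-3/2)"
      using 3 by (intro powr_mono2') auto
    also have "\<dots> = 2 powr (3/2) * real (n + 1) powr (-3/2)"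
      by (simp add: powr_divide powr_minus_divide)
    also have "\<dots> \<le> 2 powr 2 * real (n + 1) powr (-3/2)"
      by (intro mult_right_mono powr_mono) auto
    finally have "real n powr (-3/2) \<le> 4 * real (n + 1) powr (-3/2)" by simp
    then show ?thesis using abs_abel_defect_le[OF 3] powr_ge_zero[of "real (n+1)" "-3/2"] by linarith
  qed
qed

lemma abs_abel_symbol_le: "\<bar>abel_symbol n\<bar> \<le> 50 * real (n + 1) powr (-3/2)"
proof -
  have "\<bar>\<Sum>k\<le>n. sqrt_coeff k * abel_defect (n - k)\<bar> \<le> (\<Sum>k\<le>n. \<bar>sqrt_coeff k * abel_defect (n - k)\<bar>)"
    by (rule sum_abs)
  also have "\<dots> \<le> (\<Sum>k\<le>n. 2 * (real (k + 1) powr (-3/2) * real (n - k + 1) powr (-3/2)))"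
  proof (rule sum_mono)
    fix k assume "k \<in> {..n}"
    have "\<bar>sqrt_coeff k\<bar> * \<bar>abel_defect (n - k)\<bar> \<le> (2 * real (k + 1) powr (-3/2)) * real (n - k + 1) powr (-3/2)"
      by (intro mult_mono abs_sqrt_coeff_le abs_abel_defect_decay) auto
    then show "\<bar>sqrt_coeff k * abel_defect (n - k)\<bar> \<le> 2 * (real (k + 1) powr (-3/2) * real (n - k + 1) powr (-3/2))"
      by (simp add: abs_mult mult.assoc)
  qed
  also have "\<dots> = 2 * (\<Sum>k=0..n. real (k + 1) powr (-3/2) * real (n - k + 1) powr (- (3/2)))"
    by (simp add: sum_distrib_left atMost_atLeast0)
  also have "\<dots> \<le> 2 * (24 * real (n + 1) powr (- (3/2)))"
    by (intro mult_left_mono convolution_three_halves) auto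
  finally have "\<bar>\<Sum>k\<le>n. sqrt_coeff k * abel_defect (n - k)\<bar> \<le> 48 * real (n + 1) powr (-3/2)" by simp
  moreover have "\<bar>sqrt pi * (if n = 0 then 3/4 else if n = 1 then 1/4 else 0)\<bar> \<le> 2 * real (n + 1) powr (-3/2)"
  proof -
    have "(2::real) powr (-2) \<le> 2 powr (-3/2)" by (intro powr_mono) auto
    then have "1/4 \<le> (2::real) powr (-3/2)" by (simp add: powr_minus_divide)
    then show ?thesis using sqrt_pi_bounds by auto
  qed
  ultimately show ?thesis by (subst abel_symbol_decomposition) linarith
qed

lemma abel_weight_le: "\<bar>abel_weight n\<bar> \<le> 2 * real (n + 1) powr (-1/2)"
proof -
  have half: "real (n + 1) powr (-1/2) = 1 / sqrt (real (n + 1))"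
    by (simp add: powr_minus_divide powr_half_sqrt)
  consider "n = 0" | "n = 1" | "n \<ge> 2" by linarith
  then show ?thesis
  proof cases
    case 1
    then show ?thesis by (simp add: abel_weight_0)
  next
    case 2
    have "abel_weight (Suc 0) \<le> 12/10" "0 \<le> abel_weight (Suc 0)" using abel_weight_1 sqrt_2_bounds by simp_all
    moreover have "7/10 \<le> 1 / sqrt 2" using sqrt_2_bounds by (simp add: divide_simps)
    ultimately show ?thesis unfolding half using 2 by simp
  next
    case 3
    define B where "B = 1 / sqrt (real (n + 1))"
    have B: "B \<ge> 0" by (simp add: B_def)
    have "1 / sqrt (real n) \<le> (3/2) * B"
    proof -
      have "sqrt (real (n + 1)) \<le> sqrt ((3/2)\<^sup>2 * real n)" using 3 by (intro real_sqrt_le_mono) (simp add: power2_eq_square)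
      also have "\<dots> = 3/2 * sqrt (real n)" by (simp add: real_sqrt_mult)
      finally show ?thesis using 3 unfolding B_def by (simp add: divide_simps)
    qed
    then have "1 / sqrt (real n) * (1 + 1 / (12 * (real n)\<^sup>2)) \<le> (3/2) * B * (13/12)"
    proof (intro mult_mono)
      have "1 \<le> (real n)\<^sup>2" using 3 by simp
      then show "1 + 1 / (12 * (real n)\<^sup>2) \<le> 13/12" using 3 by (simp add: divide_simps)
    qed (use B in auto)
    moreover have "0 \<le> 1 / sqrt (real n)" by simp
    ultimately have "0 \<le> abel_weight n" "abel_weight n \<le> (3/2) * B * (13/12)"
      using abel_weight_bounds[OF 3] by linarith+
    then show ?thesis unfolding half B_def[symmetric] using B by simp
  qed
qed

section \<open>The weights of the scheme\<close>

definition abel_density :: "real \<Rightarrow> real \<Rightarrow> real \<Rightarrow> real" where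
  "abel_density \<alpha> t u = u powr (- \<alpha>) * (t - u) powr (- (1/2))"

lemma abel_density_nonneg: "0 \<le> abel_density \<alpha> t u"
  by (simp add: abel_density_def)

text \<open>
  The Beta integral, rescaled from the unit interval to \<open>{0..t}\<close>.
\<close>
lemma has_integral_abel_density:
  assumes "\<alpha> < 1" "0 < t"
  shows "(abel_density \<alpha> t has_integral t powr (1/2 - \<alpha>) * Beta (1 - \<alpha>) (1/2)) {0..t}"
proof -
  define w where "w = (\<lambda>s :: real. s powr (- \<alpha>) * (1 - s) powr (- (1/2)))"
  have "(w has_integral Beta (1 - \<alpha>) (1/2)) {0..1}"
    using has_integral_Beta_real[of "1 - \<alpha>" "1/2"] assms unfolding w_def by simp
  from has_integral_stretch_real[OF this, of "1 / t"]
  have "((\<lambda>x. w (x / t)) has_integral t * Beta (1 - \<alpha>) (1/2)) ((\<lambda>x. x * t) ` {0..1})"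
    using assms by simp
  also have "(\<lambda>x. x * t) ` {0..1} = {0..t}"
    using assms by (auto simp: image_def intro!: bexI[of _ "_ / t"])
  finally have "((\<lambda>x. t powr (- \<alpha> - 1/2) * w (x / t)) has_integral
       t powr (- \<alpha> - 1/2) * (t * Beta (1 - \<alpha>) (1/2))) {0..t}"
    by (rule has_integral_mult_right)
  moreover have "t powr (- \<alpha> - 1/2) * w (x / t) = abel_density \<alpha> t x" if "x \<in> {0..t}" for x
  proof -
    have "1 - x / t = (t - x) / t" using assms by (simp add: field_simps)
    then have "t powr (- \<alpha> - 1/2) * w (x / t) =
        t powr (- \<alpha> - 1/2) * (x powr (- \<alpha>) / t powr (- \<alpha>)) * ((t - x) powr (- (1/2)) / t powr (- (1/2)))"
      using that assms by (simp add: w_def powr_divide)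
    moreover have "t powr (- \<alpha> - 1/2) = t powr (- \<alpha>) * t powr (- (1/2))" by (simp only: powr_add[symmetric]) simp
    ultimately have "t powr (- \<alpha> - 1/2) * w (x / t) = (t powr (- \<alpha>) * t powr (- (1/2)))
        * (x powr (- \<alpha>) / t powr (- \<alpha>)) * ((t - x) powr (- (1/2)) / t powr (- (1/2)))" by (simp only:)
    then show ?thesis using assms by (simp add: abel_density_def)
  qed
  moreover have "t powr (- \<alpha> - 1/2) * (t * Beta (1 - \<alpha>) (1/2)) = t powr (1/2 - \<alpha>) * Beta (1 - \<alpha>) (1/2)"
  proof -
    have "t powr (- \<alpha> - 1/2) * t powr 1 = t powr (1/2 - \<alpha>)" by (simp only: powr_add[symmetric]) simp
    then show ?thesis using assms by (simp add: mult.assoc[symmetric])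
  qed
  ultimately show ?thesis by (metis (no_types, lifting) has_integral_eq)
qed

lemma integrable_continuous_times_abel_density:
  fixes \<phi> :: "real \<Rightarrow> real"
  assumes "\<alpha> < 1" "0 \<le> a" "a \<le> b" "b \<le> t" "0 < t" "continuous_on {a..b} \<phi>"
  shows "(\<lambda>u. \<phi> u * abel_density \<alpha> t u) integrable_on {a..b}"
proof -
  have "abel_density \<alpha> t integrable_on {0..t}"
    using has_integral_abel_density[OF assms(1,5)] by blast
  then have "abel_density \<alpha> t integrable_on {a..b}"
    by (rule integrable_on_subinterval) (use assms in auto)
  then have "abel_density \<alpha> t absolutely_integrable_on {a..b}"
    by (intro nonnegative_absolutely_integrable_1) (auto simp: abel_density_nonneg)
  then have "(\<lambda>u. \<phi> u * abel_density \<alpha> t u) absolutely_integrable_on {a..b}"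
    using assms(6)
    by (intro absolutely_integrable_bounded_measurable_product_real continuous_imp_measurable_on_sets_lebesgue
          compact_imp_bounded compact_continuous_image) auto
  then show ?thesis by (rule set_lebesgue_integral_eq_integral(1))
qed

lemma W1_eq: "W1 \<alpha> i j = integral {real j..real j + 1} (\<lambda>u. (real j + 1 - u) * abel_density \<alpha> (real i) u)"
  by (simp add: W1_def abel_density_def mult.assoc)

lemma W2_eq: "W2 \<alpha> i j = integral {real j..real j + 1} (\<lambda>u. (u - real j) * abel_density \<alpha> (real i) u)"
  by (simp add: W2_def abel_density_def mult.assoc)

text \<open>
  The coefficient of \<open>k i j * F j\<close> in row \<open>i \<ge> j \<ge> 1\<close> of the scheme: the integral of the density
  against the hat function at \<open>j\<close>.  At \<open>j = i\<close> the right half of the hat lies outside the domain.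
\<close>
definition trap_weight :: "real \<Rightarrow> nat \<Rightarrow> nat \<Rightarrow> real" where
  "trap_weight \<alpha> i j = (if j < i then W1 \<alpha> i j else 0) + W2 \<alpha> i (j - 1)"

lemma has_integral_half_power:
  assumes "0 \<le> a" "a \<le> b" "b \<le> t"
  shows "((\<lambda>u. (t - u) powr (- (1/2))) has_integral 2 * sqrt (t - a) - 2 * sqrt (t - b)) {a..b}"
proof -
  have "((\<lambda>u. (t - u) powr (- (1/2))) has_integral (- 2 * sqrt (t - b)) - (- 2 * sqrt (t - a))) {a..b}"
  proof (rule fundamental_theorem_of_calculus_interior)
    fix u assume u: "u \<in> {a<..<b}"
    then have "t - u > 0" using assms by auto
    then show "((\<lambda>u. - 2 * sqrt (t - u)) has_vector_derivative (t - u) powr (- (1/2))) (at u)"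
      unfolding has_real_derivative_iff_has_vector_derivative[symmetric]
      by (auto intro!: derivative_eq_intros simp: powr_minus_divide powr_half_sqrt field_simps)
  qed (use assms in \<open>auto intro!: continuous_intros\<close>)
  then show ?thesis by simp
qed

lemma has_integral_linear_half_power:
  fixes a b c t :: real
  assumes "0 \<le> a" "a \<le> b" "b \<le> t"
  defines "G \<equiv> \<lambda>s :: real. 2/3 * (s * sqrt s) + 2 * (c - t) * sqrt s"
  shows "((\<lambda>u. (c - u) * abel_density 0 t u) has_integral G (t - a) - G (t - b)) {a..b}"
proof -
  have "((\<lambda>u. (c - u) * abel_density 0 t u) has_integral - G (t - b) - (- G (t - a))) {a..b}"
  proof (rule fundamental_theorem_of_calculus_interior)
    fix u assume u: "u \<in> {a<..<b}"
    then have pos: "t - u > 0" "u > 0" using assms by auto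
    define r where "r = sqrt (t - u)"
    have r: "r > 0" "t - u = r * r" using pos by (auto simp: r_def)
    have "((\<lambda>u. - G (t - u)) has_real_derivative
         2/3 * (r + (t - u) * (inverse r / 2)) + 2 * (c - t) * (inverse r / 2)) (at u)"
      using pos unfolding G_def r_def
      by (auto intro!: derivative_eq_intros simp: field_simps)
    also have "2/3 * (r + (t - u) * (inverse r / 2)) + 2 * (c - t) * (inverse r / 2) = (c - u) / r"
    proof -
      have "c - u = (c - t) + r * r" using r by simp
      then show ?thesis unfolding r(2) using r(1) by (simp add: field_simps)
    qed
    also have "(c - u) / r = (c - u) * abel_density 0 t u"
      using pos by (simp add: abel_density_def powr_minus_divide powr_half_sqrt r_def)
    finally show "((\<lambda>u. - G (t - u)) has_vector_derivative (c - u) * abel_density 0 t u) (at u)"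
      unfolding has_real_derivative_iff_has_vector_derivative[symmetric] .
  qed (use assms in \<open>auto intro!: continuous_intros\<close>)
  then show ?thesis by simp
qed

lemma W1_0_eq:
  assumes "j < i"
  shows "W1 0 i j = 2/3 * (real (i - j) * sqrt (real (i - j)) - real (i - j - 1) * sqrt (real (i - j - 1)))
     - 2 * real (i - j - 1) * (sqrt (real (i - j)) - sqrt (real (i - j - 1)))"
proof -
  define p q where "p = real (i - j)" and "q = real (i - j - 1)"
  have e: "real i - real j = p" "real i - (real j + 1) = q" "real j + 1 - real i = - q"
    using assms by (auto simp: p_def q_def of_nat_diff)
  have "0 \<le> real j" "real j \<le> real j + 1" "real j + 1 \<le> real i" using assms by auto
  from has_integral_linear_half_power[OF this, of "real j + 1"]
  have "W1 0 i j = (2/3 * (p * sqrt p) + 2 * (- q) * sqrt p) - (2/3 * (q * sqrt q) + 2 * (- q) * sqrt q)"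
    unfolding e W1_eq by (rule integral_unique)
  then show ?thesis unfolding p_def[symmetric] q_def[symmetric] by (simp add: algebra_simps)
qed

lemma W2_0_eq:
  assumes "j < i"
  shows "W2 0 i j = 2 * real (i - j) * (sqrt (real (i - j)) - sqrt (real (i - j - 1)))
     - 2/3 * (real (i - j) * sqrt (real (i - j)) - real (i - j - 1) * sqrt (real (i - j - 1)))"
proof -
  define p q where "p = real (i - j)" and "q = real (i - j - 1)"
  have e: "real i - real j = p" "real i - (real j + 1) = q" "real j - real i = - p"
    using assms by (auto simp: p_def q_def of_nat_diff)
  have neg: "W2 0 i j = integral {real j..real j + 1} (\<lambda>u. - ((real j - u) * abel_density 0 (real i) u))"
    unfolding W2_eq by (intro integral_cong) (simp add: algebra_simps)
  have "0 \<le> real j" "real j \<le> real j + 1" "real j + 1 \<le> real i" using assms by auto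
  from has_integral_neg[OF has_integral_linear_half_power[OF this, of "real j"]]
  have "W2 0 i j = - ((2/3 * (p * sqrt p) + 2 * (- p) * sqrt p) - (2/3 * (q * sqrt q) + 2 * (- p) * sqrt q))"
    unfolding e neg by (rule integral_unique)
  then show ?thesis unfolding p_def[symmetric] q_def[symmetric] by (simp add: algebra_simps)
qed

lemma trap_weight_0:
  assumes "1 \<le> j" "j \<le> i"
  shows "trap_weight 0 i j = abel_weight (i - j)"
proof (cases "j = i")
  case True
  then show ?thesis using assms W2_0_eq[of "i - 1" i] by (simp add: trap_weight_def abel_weight_def)
next
  case False
  then have j: "j < i" using assms by simp
  define n where "n = i - j"
  have n: "n \<ge> 1" "i - (j - 1) = n + 1" "i - (j - 1) - 1 = n" "i - j - 1 = n - 1" using j assms by (auto simp: n_def)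
  have "trap_weight 0 i j = W1 0 i j + W2 0 i (j - 1)" using j by (simp add: trap_weight_def)
  also have "\<dots> = 2/3 * (real n * sqrt (real n) - real (n - 1) * sqrt (real (n - 1)))
     - 2 * real (n - 1) * (sqrt (real n) - sqrt (real (n - 1)))
     + (2 * real (n + 1) * (sqrt (real (n + 1)) - sqrt (real n))
     - 2/3 * (real (n + 1) * sqrt (real (n + 1)) - real n * sqrt (real n)))"
    using W1_0_eq[OF j] W2_0_eq[of "j - 1" i] j unfolding n n_def[symmetric] by simp
  also have "\<dots> = abel_weight n"
  proof -
    define A B where "A = sqrt (real (n + 1))" and "B = sqrt (real (n - 1))"
    have "real (n - 1) = real n - 1" "real (n + 1) = real n + 1" using n by auto
    then show ?thesis using n(1) unfolding abel_weight_def A_def[symmetric] B_def[symmetric]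
      by (simp add: field_simps)
  qed
  finally show ?thesis by (simp add: n_def)
qed

text \<open>
  Replacing \<open>u powr (- \<alpha>)\<close> by \<open>j powr (- \<alpha>)\<close> under a hat function costs a relative error \<open>1 / j\<close>.  This
  holds even for \<open>j = 1\<close>, where the cell touches the singularity, because the hat function vanishes there:
  \<open>(j / u) powr \<alpha> - 1 \<le> (j - u) / u\<close> and \<open>(u - (j - 1)) / u \<le> 1 / j\<close>.
\<close>
lemma scaled_weight_deviation_left:
  assumes "0 \<le> \<alpha>" "\<alpha> \<le> 1" "1 \<le> j" "real j - 1 \<le> u" "u \<le> real j"
  shows "\<bar>(u - (real j - 1)) * (real j powr \<alpha> * u powr (- \<alpha>) - u powr 0)\<bar> \<le> 1 / real j"
proof (cases "u = 0")
  case False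
  then have u: "u > 0" using assms by linarith
  have "real j powr \<alpha> * u powr (- \<alpha>) = (real j / u) powr \<alpha>" using u by (simp add: powr_divide powr_minus_divide)
  moreover have "(real j / u) powr \<alpha> \<le> (real j / u) powr 1" using u assms by (intro powr_mono) auto
  moreover have "1 \<le> (real j / u) powr \<alpha>" using u assms by (intro ge_one_powr_ge_zero) auto
  ultimately have 1: "0 \<le> real j powr \<alpha> * u powr (- \<alpha>) - u powr 0" "real j powr \<alpha> * u powr (- \<alpha>) - u powr 0 \<le> (real j - u) / u"
    using u assms by (auto simp: diff_divide_distrib)
  have "(u - (real j - 1)) * (real j powr \<alpha> * u powr (- \<alpha>) - u powr 0) \<le> (u - (real j - 1)) * ((real j - u) / u)"
    using 1 assms by (intro mult_left_mono) auto
  also have "\<dots> = (u - (real j - 1)) / u * (real j - u)" by simp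
  also have "\<dots> \<le> 1 / real j * 1"
  proof (rule mult_mono)
    have "(real j - 1) * (real j - u) \<ge> 0" using assms by (intro mult_nonneg_nonneg) auto
    then have "(u - (real j - 1)) * real j \<le> 1 * u" by (simp add: algebra_simps)
    then show "(u - (real j - 1)) / u \<le> 1 / real j" using u assms by (simp add: divide_simps)
  qed (use assms in auto)
  finally show ?thesis using 1 assms by (simp add: abs_mult)
next
  case True
  then have "j = 1" using assms by simp
  then show ?thesis using True by simp
qed

lemma scaled_weight_deviation_right:
  assumes "0 \<le> \<alpha>" "\<alpha> \<le> 1" "1 \<le> j" "real j \<le> u" "u \<le> real j + 1"
  shows "\<bar>(real j + 1 - u) * (real j powr \<alpha> * u powr (- \<alpha>) - u powr 0)\<bar> \<le> 1 / real j"
proof -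
  have u: "u > 0" "real j > 0" using assms by linarith+
  have "real j powr \<alpha> * u powr (- \<alpha>) = (real j / u) powr \<alpha>" using u by (simp add: powr_divide powr_minus_divide)
  moreover have "(real j / u) powr \<alpha> \<ge> (real j / u) powr 1" using u assms by (intro powr_mono') auto
  moreover have "(real j / u) powr \<alpha> \<le> 1" using u assms by (intro powr_le1) auto
  ultimately have "\<bar>real j powr \<alpha> * u powr (- \<alpha>) - u powr 0\<bar> \<le> 1 - real j / u"
    using u assms by auto
  also have "\<dots> = (u - real j) / u" using u by (simp add: diff_divide_distrib)
  also have "\<dots> \<le> 1 / real j" using assms u by (intro frac_le) auto
  finally have "\<bar>real j + 1 - u\<bar> * \<bar>real j powr \<alpha> * u powr (- \<alpha>) - u powr 0\<bar> \<le> 1 * (1 / real j)"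
    using assms by (intro mult_mono) auto
  then show ?thesis by (simp add: abs_mult)
qed

lemma cell_half_power_le:
  assumes "j < i"
  shows "integral {real j..real j + 1} (\<lambda>u. (real i - u) powr (- (1/2))) \<le> 2 * real (i - j) powr (- (1/2))"
proof -
  define n where "n = i - j"
  have n: "real i - real j = real n" "real i - (real j + 1) = real n - 1" "n \<ge> 1" using assms by (auto simp: n_def of_nat_diff)
  have "integral {real j..real j + 1} (\<lambda>u. (real i - u) powr (- (1/2))) = 2 * sqrt (real n) - 2 * sqrt (real n - 1)"
  proof -
    have "0 \<le> real j" "real j \<le> real j + 1" "real j + 1 \<le> real i" using assms by auto
    from has_integral_half_power[OF this] show ?thesis unfolding n(1,2) by (rule integral_unique)
  qed
  also have "\<dots> \<le> 2 / sqrt (real n)"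
  proof -
    have "real n - 1 \<le> sqrt (real n - 1) * sqrt (real n)"
    proof -
      have "sqrt (real n - 1) * sqrt (real n - 1) \<le> sqrt (real n - 1) * sqrt (real n)"
        using n by (intro mult_left_mono) auto
      then show ?thesis using n by simp
    qed
    moreover have "(2 * sqrt (real n) - 2 * sqrt (real n - 1)) * sqrt (real n)
        = 2 * (sqrt (real n) * sqrt (real n)) - 2 * (sqrt (real n - 1) * sqrt (real n))"
      by (simp only: left_diff_distrib mult.assoc)
    moreover have "sqrt (real n) * sqrt (real n) = real n" by simp
    ultimately have "(2 * sqrt (real n) - 2 * sqrt (real n - 1)) * sqrt (real n) \<le> 2" by linarith
    then show ?thesis using n by (simp add: field_simps)
  qed
  also have "\<dots> = 2 * real (i - j) powr (- (1/2))"
    by (simp add: n_def powr_minus_divide powr_half_sqrt)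
  finally show ?thesis .
qed

text \<open>
  Summing the pointwise bounds over the two halves of the hat function: up to the relative error \<open>1 / j\<close>
  the weight matrix is a convolution matrix times a diagonal matrix.
\<close>
lemma trap_weight_deviation:
  assumes "0 \<le> \<alpha>" "\<alpha> < 1" "1 \<le> j" "j \<le> i"
  shows "\<bar>real j powr \<alpha> * trap_weight \<alpha> i j - abel_weight (i - j)\<bar> \<le> 6 * real (i - j + 1) powr (- (1/2)) / real j"
proof -
  have cell: "\<bar>real j powr \<alpha> * integral {real l..real l + 1} (\<lambda>u. \<psi> u * abel_density \<alpha> (real i) u) -
        integral {real l..real l + 1} (\<lambda>u. \<psi> u * abel_density 0 (real i) u)\<bar>
       \<le> 1 / real j * (2 * real (i - l) powr (- (1/2)))"
    if l: "l < i" and \<psi>: "continuous_on {real l..real l + 1} \<psi>"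
      and bound: "\<And>u. u \<in> {real l..real l + 1} \<Longrightarrow> \<bar>\<psi> u * (real j powr \<alpha> * u powr (- \<alpha>) - u powr 0)\<bar> \<le> 1 / real j"
    for l and \<psi> :: "real \<Rightarrow> real"
  proof -
    have int: "(\<lambda>u. \<psi> u * abel_density \<beta> (real i) u) integrable_on {real l..real l + 1}" if "\<beta> < 1" for \<beta>
      using that l \<psi> by (intro integrable_continuous_times_abel_density) auto
    have half: "(\<lambda>u. (real i - u) powr (- (1/2))) integrable_on {real l..real l + 1}"
      using has_integral_half_power[of "real l" "real l + 1" "real i"] l by (intro has_integral_integrable) auto
    have eq: "real j powr \<alpha> * integral {real l..real l + 1} (\<lambda>u. \<psi> u * abel_density \<alpha> (real i) u) -
        integral {real l..real l + 1} (\<lambda>u. \<psi> u * abel_density 0 (real i) u)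
      = integral {real l..real l + 1} (\<lambda>u. real j powr \<alpha> * (\<psi> u * abel_density \<alpha> (real i) u) - \<psi> u * abel_density 0 (real i) u)"
      using int[of \<alpha>] int[of 0] assms by (subst integral_diff) (auto intro: integrable_on_mult_right)
    have "norm (integral {real l..real l + 1} (\<lambda>u. real j powr \<alpha> * (\<psi> u * abel_density \<alpha> (real i) u) - \<psi> u * abel_density 0 (real i) u))
        \<le> integral {real l..real l + 1} (\<lambda>u. 1 / real j * (real i - u) powr (- (1/2)))"
    proof (rule integral_norm_bound_integral)
      show "(\<lambda>u. real j powr \<alpha> * (\<psi> u * abel_density \<alpha> (real i) u) - \<psi> u * abel_density 0 (real i) u) integrable_on {real l..real l + 1}"
        using int[of \<alpha>] int[of 0] assms by (intro integrable_diff integrable_on_mult_right) auto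
      show "(\<lambda>u. 1 / real j * (real i - u) powr (- (1/2))) integrable_on {real l..real l + 1}"
        by (rule integrable_on_mult_right[OF half])
      fix u assume u: "u \<in> {real l..real l + 1}"
      have "real j powr \<alpha> * (\<psi> u * abel_density \<alpha> (real i) u) - \<psi> u * abel_density 0 (real i) u
         = (\<psi> u * (real j powr \<alpha> * u powr (- \<alpha>) - u powr 0)) * (real i - u) powr (- (1/2))"
        by (simp add: abel_density_def algebra_simps)
      then have "norm (real j powr \<alpha> * (\<psi> u * abel_density \<alpha> (real i) u) - \<psi> u * abel_density 0 (real i) u)
         = \<bar>\<psi> u * (real j powr \<alpha> * u powr (- \<alpha>) - u powr 0)\<bar> * (real i - u) powr (- (1/2))"
        by (simp only: real_norm_def abs_mult[of _ "(real i - u) powr (- (1/2))"] abs_of_nonneg[OF powr_ge_zero])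
      also have "\<dots> \<le> 1 / real j * (real i - u) powr (- (1/2))"
        by (intro mult_right_mono bound u) auto
      finally show "norm (real j powr \<alpha> * (\<psi> u * abel_density \<alpha> (real i) u) - \<psi> u * abel_density 0 (real i) u)
          \<le> 1 / real j * (real i - u) powr (- (1/2))" .
    qed
    moreover have "1 / real j * integral {real l..real l + 1} (\<lambda>u. (real i - u) powr (- (1/2)))
        \<le> 1 / real j * (2 * real (i - l) powr (- (1/2)))"
      by (intro mult_left_mono cell_half_power_le l) auto
    ultimately show ?thesis unfolding eq integral_mult_right real_norm_def by (rule order_trans)
  qed
  define p where "p = real (i - j + 1) powr (- (1/2))"
  have L: "\<bar>real j powr \<alpha> * W2 \<alpha> i (j - 1) - W2 0 i (j - 1)\<bar> \<le> 1 / real j * (2 * p)"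
  proof -
    have eq: "i - (j - 1) = i - j + 1" using assms by simp
    have "\<bar>real j powr \<alpha> * W2 \<alpha> i (j - 1) - W2 0 i (j - 1)\<bar> \<le> 1 / real j * (2 * real (i - (j - 1)) powr (- (1/2)))"
      unfolding W2_eq
    proof (rule cell)
      fix u assume "u \<in> {real (j - 1)..real (j - 1) + 1}"
      moreover have "real (j - 1) = real j - 1" using assms by (simp add: of_nat_diff)
      ultimately show "\<bar>(u - real (j - 1)) * (real j powr \<alpha> * u powr (- \<alpha>) - u powr 0)\<bar> \<le> 1 / real j"
        using scaled_weight_deviation_left[of \<alpha> j u] assms by auto
    qed (use assms in \<open>auto intro!: continuous_intros\<close>)
    then show ?thesis unfolding eq p_def .
  qed
  have R: "\<bar>real j powr \<alpha> * W1 \<alpha> i j - W1 0 i j\<bar> \<le> 1 / real j * (4 * p)" if "j < i"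
  proof -
    have "real (i - j) powr (- (1/2)) \<le> (real (i - j + 1) / 4) powr (- (1/2))"
      using that by (intro powr_mono2') auto
    moreover have "(real (i - j + 1) / 4) powr (- (1/2)) = 2 * p"
      by (simp add: p_def powr_divide powr_minus_divide powr_half_sqrt)
    ultimately have "1 / real j * (2 * real (i - j) powr (- (1/2))) \<le> 1 / real j * (2 * (2 * p))"
      by (intro mult_left_mono) auto
    moreover have "\<bar>real j powr \<alpha> * W1 \<alpha> i j - W1 0 i j\<bar> \<le> 1 / real j * (2 * real (i - j) powr (- (1/2)))"
      unfolding W1_eq using that assms scaled_weight_deviation_right[of \<alpha> j]
      by (intro cell) (auto intro!: continuous_intros)
    ultimately show ?thesis by simp
  qed
  have "\<bar>real j powr \<alpha> * trap_weight \<alpha> i j - trap_weight 0 i j\<bar> \<le> 1 / real j * (2 * p) + 1 / real j * (4 * p)"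
  proof (cases "j < i")
    case True
    then show ?thesis using L R[OF True] by (simp add: trap_weight_def distrib_left)
  next
    case False
    moreover have "0 \<le> 1 / real j * (4 * p)" by (simp add: p_def)
    ultimately show ?thesis using L by (simp add: trap_weight_def)
  qed
  also have "\<dots> = 6 * p / real j" by (simp add: field_simps)
  finally show ?thesis using trap_weight_0[OF assms(3,4)] by (simp add: p_def)
qed

text \<open>
  On the last cell \<open>u powr (- \<alpha>) \<ge> i powr (- \<alpha>)\<close>, which reduces the claim to the case \<open>\<alpha> = 0\<close>.
\<close>
lemma trap_weight_diag_pos:
  assumes "0 \<le> \<alpha>" "\<alpha> < 1" "1 \<le> i"
  shows "trap_weight \<alpha> i i > 0"
proof -
  define l where "l = i - 1"
  have l: "l < i" "real i = real l + 1" using assms by (auto simp: l_def)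
  have "4/3 * real i powr (- \<alpha>) = real i powr (- \<alpha>) * W2 0 i l"
    using W2_0_eq[of l i] assms by (simp add: l_def)
  also have "\<dots> = integral {real l..real l + 1} (\<lambda>u. real i powr (- \<alpha>) * ((u - real l) * abel_density 0 (real i) u))"
    unfolding W2_eq by (rule integral_mult_right[symmetric])
  also have "\<dots> \<le> integral {real l..real l + 1} (\<lambda>u. (u - real l) * abel_density \<alpha> (real i) u)"
  proof (rule integral_le)
    show "(\<lambda>u. real i powr (- \<alpha>) * ((u - real l) * abel_density 0 (real i) u)) integrable_on {real l..real l + 1}"
      using l assms by (intro integrable_on_mult_right integrable_continuous_times_abel_density continuous_intros) auto
    show "(\<lambda>u. (u - real l) * abel_density \<alpha> (real i) u) integrable_on {real l..real l + 1}"
      using l assms by (intro integrable_continuous_times_abel_density continuous_intros) auto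
    fix u assume u: "u \<in> {real l..real l + 1}"
    have "real i powr (- \<alpha>) * u powr (- 0) \<le> u powr (- \<alpha>)"
    proof (cases "u = 0")
      case False
      then show ?thesis using u l assms by (auto intro!: powr_mono2')
    qed simp
    then have "((u - real l) * (real i - u) powr (- (1/2))) * (real i powr (- \<alpha>) * u powr (- 0)) \<le>
       ((u - real l) * (real i - u) powr (- (1/2))) * u powr (- \<alpha>)"
      using u by (intro mult_left_mono) auto
    then show "real i powr (- \<alpha>) * ((u - real l) * abel_density 0 (real i) u) \<le> (u - real l) * abel_density \<alpha> (real i) u"
      by (simp only: abel_density_def mult_ac)
  qed
  also have "\<dots> = trap_weight \<alpha> i i" unfolding trap_weight_def W2_eq by (simp add: l_def)
  finally have "4/3 * real i powr (- \<alpha>) \<le> trap_weight \<alpha> i i" .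
  moreover have "0 < 4/3 * real i powr (- \<alpha>)" using assms by simp
  ultimately show ?thesis by linarith
qed

section \<open>Stability of the scheme\<close>

lemma discrete_gronwall:
  fixes x \<omega> :: "nat \<Rightarrow> real"
  assumes "0 \<le> A" "\<And>j. 0 \<le> \<omega> j"
    and le: "\<And>i. 1 \<le> i \<Longrightarrow> i \<le> m \<Longrightarrow> x i \<le> A + (\<Sum>j\<in>{1..<i}. \<omega> j * x j)"
    and i: "1 \<le> i" "i \<le> m"
  shows "x i \<le> A * exp (\<Sum>j\<in>{1..<i}. \<omega> j)"
  using i
proof (induction i rule: less_induct)
  case (less i)
  have step: "1 + (\<Sum>j\<in>{1..<n}. \<omega> j * exp (\<Sum>l\<in>{1..<j}. \<omega> l)) \<le> exp (\<Sum>j\<in>{1..<n}. \<omega> j)"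
    if "1 \<le> n" for n :: nat
    using that
  proof (induction n rule: dec_induct)
    case (step n)
    have "1 + \<omega> n \<le> exp (\<omega> n)" by (rule exp_ge_add_one_self)
    then have "exp (\<Sum>j\<in>{1..<n}. \<omega> j) * (1 + \<omega> n) \<le> exp (\<Sum>j\<in>{1..<n}. \<omega> j) * exp (\<omega> n)"
      by (intro mult_left_mono) auto
    then show ?case using step by (simp add: exp_add algebra_simps)
  qed simp
  have "x i \<le> A + (\<Sum>j\<in>{1..<i}. \<omega> j * x j)" using le less.prems by simp
  also have "\<dots> \<le> A + (\<Sum>j\<in>{1..<i}. \<omega> j * (A * exp (\<Sum>l\<in>{1..<j}. \<omega> l)))"
    using less assms by (intro add_left_mono sum_mono mult_left_mono) auto
  also have "\<dots> = A * (1 + (\<Sum>j\<in>{1..<i}. \<omega> j * exp (\<Sum>l\<in>{1..<j}. \<omega> l)))"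
    by (simp add: distrib_left sum_distrib_left mult_ac)
  also have "\<dots> \<le> A * exp (\<Sum>j\<in>{1..<i}. \<omega> j)"
    using step[of i] less.prems assms by (intro mult_left_mono) auto
  finally show ?case .
qed

text \<open>
  The error equations in the form used for stability: \<open>e\<close> is the error vector, \<open>K i j\<close> stands for
  \<open>k (t\<^sub>i) (t\<^sub>j)\<close>, bounded by \<open>M\<close>, bounded below by \<open>\<kappa>\<close> on the diagonal, and Lipschitz with constant \<open>L\<close> in the
  first variable on a grid of width \<open>h\<close>.  The residuals may grow or decay like the integral of the density over
  \<open>{0..i}\<close>.  The data are parameters so that a bound can be stated uniformly in \<open>m\<close>.
\<close>
definition abel_system ::
  "real \<Rightarrow> real \<Rightarrow> real \<Rightarrow> real \<Rightarrow> real \<Rightarrow> real \<Rightarrow> nat \<Rightarrow> (nat \<Rightarrow> nat \<Rightarrow> real) \<Rightarrow> (nat \<Rightarrow> real) \<Rightarrow> bool"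
where
  "abel_system \<alpha> M \<kappa> L D h m K e \<longleftrightarrow>
     (\<forall>i j. 1 \<le> j \<and> j \<le> i \<and> i \<le> m \<longrightarrow> \<bar>K i j\<bar> \<le> M) \<and>
     (\<forall>i. 1 \<le> i \<and> i \<le> m \<longrightarrow> \<kappa> \<le> \<bar>K i i\<bar>) \<and>
     (\<forall>i l j. 1 \<le> j \<and> j \<le> l \<and> l \<le> i \<and> i \<le> m \<longrightarrow> \<bar>K l j - K i j\<bar> \<le> L * h * real (i - l)) \<and>
     (\<forall>i. 1 \<le> i \<and> i \<le> m \<longrightarrow>
        \<bar>\<Sum>j=1..i. K i j * trap_weight \<alpha> i j * e j\<bar> \<le> D * real i powr (1/2 - \<alpha>))"

text \<open>
  Forward substitution in the first \<open>J\<close> rows.  The constant grows without control in \<open>J\<close>, but it does not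
  depend on \<open>m\<close>; this disposes of the rows near the singularity, where the asymptotic estimates say nothing.
\<close>
lemma initial_errors_bounded:
  assumes "1/2 \<le> \<alpha>" "\<alpha> < 1" "0 < \<kappa>" "0 \<le> M"
  shows "\<exists>C\<ge>0. \<forall>L D h m K e. 0 \<le> D \<longrightarrow> abel_system \<alpha> M \<kappa> L D h m K e \<longrightarrow>
    (\<forall>i. 1 \<le> i \<and> i \<le> m \<and> i \<le> J \<longrightarrow> \<bar>e i\<bar> \<le> C * D)"
proof (induction J)
  case 0
  then show ?case by (intro exI[of _ 0]) auto
next
  case (Suc J)
  then obtain C where C: "C \<ge> 0" and IH: "\<And>L D h m K e i. 0 \<le> D \<Longrightarrow> abel_system \<alpha> M \<kappa> L D h m K e \<Longrightarrow>
     1 \<le> i \<Longrightarrow> i \<le> m \<Longrightarrow> i \<le> J \<Longrightarrow> \<bar>e i\<bar> \<le> C * D" by blast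
  define n where "n = Suc J"
  define w where "w = trap_weight \<alpha> n n"
  have w: "w > 0" unfolding w_def using assms by (intro trap_weight_diag_pos) (auto simp: n_def)
  define C' where "C' = (1 + (\<Sum>j=1..J. M * \<bar>trap_weight \<alpha> n j\<bar> * C)) / (\<kappa> * w)"
  have C': "C' \<ge> 0" unfolding C'_def using C assms w by (auto intro!: divide_nonneg_nonneg add_nonneg_nonneg sum_nonneg)
  have main: "\<bar>e n\<bar> \<le> C' * D" if D: "0 \<le> D" and sys: "abel_system \<alpha> M \<kappa> L D h m K e" and nm: "n \<le> m" for L D h m K e
  proof -
    have n1: "1 \<le> n" by (simp add: n_def)
    have "(\<Sum>j=1..n. K n j * trap_weight \<alpha> n j * e j) = (\<Sum>j=1..J. K n j * trap_weight \<alpha> n j * e j) + K n n * w * e n"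
      by (simp add: n_def w_def)
    moreover have "\<bar>\<Sum>j=1..n. K n j * trap_weight \<alpha> n j * e j\<bar> \<le> D"
    proof -
      have "\<bar>\<Sum>j=1..n. K n j * trap_weight \<alpha> n j * e j\<bar> \<le> D * real n powr (1/2 - \<alpha>)"
        using sys n1 nm unfolding abel_system_def by blast
      also have "\<dots> \<le> D * 1"
        using D assms n1 powr_mono[of "1/2 - \<alpha>" 0 "real n"] by (intro mult_left_mono) auto
      finally show ?thesis by simp
    qed
    moreover have "\<bar>\<Sum>j=1..J. K n j * trap_weight \<alpha> n j * e j\<bar> \<le> (\<Sum>j=1..J. M * \<bar>trap_weight \<alpha> n j\<bar> * (C * D))"
    proof (rule order_trans[OF sum_abs sum_mono])
      fix j assume j: "j \<in> {1..J}"
      have "\<bar>K n j\<bar> \<le> M" using sys j nm unfolding abel_system_def by (auto simp: n_def)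
      moreover have "\<bar>e j\<bar> \<le> C * D" using IH[OF D sys] j nm by (auto simp: n_def)
      ultimately show "\<bar>K n j * trap_weight \<alpha> n j * e j\<bar> \<le> M * \<bar>trap_weight \<alpha> n j\<bar> * (C * D)"
        using assms C D by (simp only: abs_mult) (intro mult_mono; simp)
    qed
    ultimately have "\<bar>K n n * w * e n\<bar> \<le> D + (\<Sum>j=1..J. M * \<bar>trap_weight \<alpha> n j\<bar> * (C * D))" by linarith
    also have "\<dots> = (1 + (\<Sum>j=1..J. M * \<bar>trap_weight \<alpha> n j\<bar> * C)) * D"
      by (simp add: distrib_right sum_distrib_right mult.assoc)
    finally have up: "\<bar>K n n * w * e n\<bar> \<le> (1 + (\<Sum>j=1..J. M * \<bar>trap_weight \<alpha> n j\<bar> * C)) * D" .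
    have "\<kappa> \<le> \<bar>K n n\<bar>" using sys n1 nm unfolding abel_system_def by blast
    then have "\<kappa> * w * \<bar>e n\<bar> \<le> \<bar>K n n\<bar> * w * \<bar>e n\<bar>"
      using w by (intro mult_right_mono) auto
    also have "\<dots> = \<bar>K n n * w * e n\<bar>" using w by (simp add: abs_mult)
    finally have "\<kappa> * w * \<bar>e n\<bar> \<le> (1 + (\<Sum>j=1..J. M * \<bar>trap_weight \<alpha> n j\<bar> * C)) * D" using up by linarith
    then show ?thesis using assms w unfolding C'_def by (simp add: field_simps)
  qed
  show ?case
  proof (intro exI[of _ "max C C'"] conjI allI impI)
    fix L D h m K e i
    assume a: "0 \<le> D" "abel_system \<alpha> M \<kappa> L D h m K e" "1 \<le> i \<and> i \<le> m \<and> i \<le> Suc J"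
    have "\<bar>e i\<bar> \<le> C * D \<or> \<bar>e i\<bar> \<le> C' * D"
    proof (cases "i = n")
      case True
      then show ?thesis using main[OF a(1,2)] a(3) by auto
    next
      case False
      then show ?thesis using IH[OF a(1,2)] a(3) by (auto simp: n_def)
    qed
    moreover have "C * D \<le> max C C' * D" "C' * D \<le> max C C' * D" using a(1) by (auto intro: mult_right_mono)
    ultimately show "\<bar>e i\<bar> \<le> max C C' * D" by linarith
  qed (use C in auto)
qed

lemma sum_interval_convolution:
  fixes f :: "nat \<Rightarrow> nat \<Rightarrow> real"
  assumes "j \<le> i"
  shows "(\<Sum>l=j..i. f (i - l) (l - j)) = (\<Sum>k=0..i - j. f k (i - j - k))"
  using assms
  by (intro sum.reindex_bij_witness[of _ "\<lambda>k. i - k" "\<lambda>l. i - l"]) (auto intro!: arg_cong2[of _ _ _ _ f])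

text \<open>
  The matrix of the system, with its columns scaled by \<open>j powr \<alpha>\<close> and multiplied from the left by the discrete
  half derivative, is the matrix of \<open>abel_symbol\<close> with columns scaled by \<open>K j j\<close>, up to two errors.
  The first comes from the variation of \<open>K l j\<close> with \<open>l\<close>: comparing with \<open>K i j\<close> gives a factor
  \<open>h * (i - l)\<close>, which turns \<open>(i - l) powr (-3/2)\<close> into \<open>(i - l) powr (-1/2)\<close>, and the convolution of two inverse
  square roots is bounded.  The second comes from freezing \<open>u powr (- \<alpha>)\<close>.
\<close>
lemma transformed_row:
  assumes "1/2 \<le> \<alpha>" "\<alpha> < 1" "0 \<le> M" "0 \<le> L"
  shows "\<exists>A\<ge>0. \<forall>D h m K e i j. 0 \<le> h \<longrightarrow> abel_system \<alpha> M \<kappa> L D h m K e \<longrightarrow> 1 \<le> j \<longrightarrow> j \<le> i \<longrightarrow> i \<le> m \<longrightarrow>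
      \<bar>(\<Sum>l=j..i. sqrt_coeff (i - l) * (K l j * (real j powr \<alpha> * trap_weight \<alpha> l j))) - K j j * abel_symbol (i - j)\<bar>
       \<le> (if j < i then A * h else 0) + A * (real (i - j + 1) powr (- (1/2)) / real j)"
proof -
  obtain B where B: "\<And>i::nat. (\<Sum>j=1..i. real j powr (1/2 - 1) * real (i + 1 - j) powr (- (1/2))) \<le> B"
    using beta_sum_bounded[of "1/2"] by auto
  have B0: "0 \<le> B" using B[of 0] by simp
  define A where "A = L * (4 * B + 50) + 288 * M"
  have A0: "A \<ge> 0" using assms B0 by (simp add: A_def)
  have main: "\<bar>(\<Sum>l=j..i. sqrt_coeff (i - l) * (K l j * (real j powr \<alpha> * trap_weight \<alpha> l j))) - K j j * abel_symbol (i - j)\<bar>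
       \<le> (if j < i then A * h else 0) + A * (real (i - j + 1) powr (- (1/2)) / real j)"
    if h: "0 \<le> h" and sys: "abel_system \<alpha> M \<kappa> L D h m K e" and j: "1 \<le> j" "j \<le> i" and i: "i \<le> m" for D h m K e i j
  proof -
    have lip: "\<bar>K l j - K i j\<bar> \<le> L * h * real (i - l)" if "j \<le> l" "l \<le> i" for l
      using sys that j i unfolding abel_system_def by blast
    have K_le: "\<bar>K l j\<bar> \<le> M" if "j \<le> l" "l \<le> i" for l
      using sys that j i unfolding abel_system_def by (meson le_trans)
    define p where "p l = real j powr \<alpha> * trap_weight \<alpha> l j - abel_weight (l - j)" for l
    have p_le: "\<bar>p l\<bar> \<le> 6 * real (l - j + 1) powr (- (1/2)) / real j" if "j \<le> l" for l
      unfolding p_def using assms j that by (intro trap_weight_deviation) auto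
    have symbol: "(\<Sum>l=j..i. sqrt_coeff (i - l) * abel_weight (l - j)) = abel_symbol (i - j)"
      unfolding abel_symbol_def using sum_interval_convolution[OF j(2), of "\<lambda>k n. sqrt_coeff k * abel_weight n"]
      by (simp add: atMost_atLeast0)
    define S1 where "S1 = (\<Sum>l=j..i. sqrt_coeff (i - l) * ((K l j - K i j) * abel_weight (l - j)))"
    define S2 where "S2 = (\<Sum>l=j..i. sqrt_coeff (i - l) * (K l j * p l))"
    have "(\<Sum>l=j..i. sqrt_coeff (i - l) * (K l j * (real j powr \<alpha> * trap_weight \<alpha> l j)))
      = (\<Sum>l=j..i. K i j * (sqrt_coeff (i - l) * abel_weight (l - j))
           + sqrt_coeff (i - l) * ((K l j - K i j) * abel_weight (l - j)) + sqrt_coeff (i - l) * (K l j * p l))"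
      by (intro sum.cong refl) (simp add: p_def algebra_simps)
    also have "\<dots> = K i j * abel_symbol (i - j) + S1 + S2"
      by (simp only: sum.distrib sum_distrib_left[symmetric] symbol S1_def S2_def)
    finally have decomp: "(\<Sum>l=j..i. sqrt_coeff (i - l) * (K l j * (real j powr \<alpha> * trap_weight \<alpha> l j))) - K j j * abel_symbol (i - j)
       = (K i j - K j j) * abel_symbol (i - j) + S1 + S2" by (simp add: algebra_simps)
    have S2: "\<bar>S2\<bar> \<le> 288 * M * (real (i - j + 1) powr (- (1/2)) / real j)"
    proof -
      have "\<bar>S2\<bar> \<le> (\<Sum>l=j..i. 12 * M / real j * (real (i - l + 1) powr (-3/2) * real (l - j + 1) powr (- (1/2))))"
        unfolding S2_def
      proof (rule order_trans[OF sum_abs sum_mono])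
        fix l assume l: "l \<in> {j..i}"
        have "\<bar>sqrt_coeff (i - l)\<bar> * (\<bar>K l j\<bar> * \<bar>p l\<bar>) \<le> (2 * real (i - l + 1) powr (-3/2)) * (M * (6 * real (l - j + 1) powr (- (1/2)) / real j))"
          using l K_le p_le assms by (intro mult_mono abs_sqrt_coeff_le) auto
        then show "\<bar>sqrt_coeff (i - l) * (K l j * p l)\<bar> \<le> 12 * M / real j * (real (i - l + 1) powr (-3/2) * real (l - j + 1) powr (- (1/2)))"
          by (simp add: abs_mult mult_ac)
      qed
      also have "\<dots> = 12 * M / real j * (\<Sum>k=0..i - j. real (k + 1) powr (-3/2) * real (i - j - k + 1) powr (- (1/2)))"
        using sum_interval_convolution[OF j(2), of "\<lambda>k n. real (k + 1) powr (-3/2) * real (n + 1) powr (- (1/2))"]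
        by (simp only: sum_distrib_left[symmetric])
      also have "\<dots> \<le> 12 * M / real j * (24 * real (i - j + 1) powr (- (1/2)))"
        using assms by (intro mult_left_mono convolution_three_halves) auto
      finally show ?thesis by (simp add: mult_ac)
    qed
    have S1: "\<bar>S1\<bar> \<le> 4 * L * h * B"
    proof -
      have "\<bar>S1\<bar> \<le> (\<Sum>l=j..i. 4 * L * h * (real (i - l + 1) powr (- (1/2)) * real (l - j + 1) powr (- (1/2))))"
        unfolding S1_def
      proof (rule order_trans[OF sum_abs sum_mono])
        fix l assume l: "l \<in> {j..i}"
        have "\<bar>sqrt_coeff (i - l)\<bar> * (\<bar>K l j - K i j\<bar> * \<bar>abel_weight (l - j)\<bar>)
           \<le> (2 * real (i - l + 1) powr (-3/2)) * ((L * h * real (i - l + 1)) * (2 * real (l - j + 1) powr (-1/2)))"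
        proof (intro mult_mono abs_sqrt_coeff_le abel_weight_le)
          have "L * h * real (i - l) \<le> L * h * real (i - l + 1)" using assms h by (intro mult_left_mono) auto
          then show "\<bar>K l j - K i j\<bar> \<le> L * h * real (i - l + 1)" using lip[of l] l by auto
        qed (use assms h in auto)
        also have "\<dots> = 4 * L * h * ((real (i - l + 1) powr (-3/2) * real (i - l + 1) powr 1) * real (l - j + 1) powr (- (1/2)))"
          by (simp add: mult_ac)
        also have "real (i - l + 1) powr (-3/2) * real (i - l + 1) powr 1 = real (i - l + 1) powr (- (1/2))"
          by (simp only: powr_add[symmetric]) simp
        finally show "\<bar>sqrt_coeff (i - l) * ((K l j - K i j) * abel_weight (l - j))\<bar>
            \<le> 4 * L * h * (real (i - l + 1) powr (- (1/2)) * real (l - j + 1) powr (- (1/2)))"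
          by (simp add: abs_mult)
      qed
      also have "\<dots> = 4 * L * h * (\<Sum>l=j..i. real (i - l + 1) powr (- (1/2)) * real (l - j + 1) powr (- (1/2)))"
        by (simp only: sum_distrib_left)
      also have "(\<Sum>l=j..i. real (i - l + 1) powr (- (1/2)) * real (l - j + 1) powr (- (1/2)))
         = (\<Sum>k=1..i - j + 1. real k powr (1/2 - 1) * real (i - j + 1 + 1 - k) powr (- (1/2)))"
        by (rule sum.reindex_bij_witness[of _ "\<lambda>k. k + j - 1" "\<lambda>l. l - j + 1"]) (use j in \<open>auto simp: mult.commute add_diff_eq\<close>)
      also have "4 * L * h * \<dots> \<le> 4 * L * h * B"
        using assms h by (intro mult_left_mono B) auto
      finally show ?thesis .
    qed
    have S0: "\<bar>(K i j - K j j) * abel_symbol (i - j)\<bar> \<le> 50 * L * h"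
    proof -
      define n where "n = i - j"
      have "\<bar>K i j - K j j\<bar> * \<bar>abel_symbol (i - j)\<bar> \<le> (L * h * real (n + 1)) * (50 * real (n + 1) powr (-3/2))"
        unfolding n_def
      proof (intro mult_mono abs_abel_symbol_le)
        have "L * h * real (i - j) \<le> L * h * real (i - j + 1)" using assms h by (intro mult_left_mono) auto
        then show "\<bar>K i j - K j j\<bar> \<le> L * h * real (i - j + 1)" using lip[of j] j by (simp add: abs_minus_commute)
      qed (use assms h in auto)
      also have "\<dots> = 50 * L * h * (real (n + 1) powr 1 * real (n + 1) powr (-3/2))" by simp
      also have "\<dots> \<le> 50 * L * h * 1"
      proof (rule mult_left_mono)
        have "real (n + 1) powr 1 * real (n + 1) powr (-3/2) = real (n + 1) powr (- (1/2))"
          by (simp only: powr_add[symmetric]) simp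
        also have "\<dots> \<le> 1" using powr_mono[of "- (1/2)" 0 "real (n + 1)"] by simp
        finally show "real (n + 1) powr 1 * real (n + 1) powr (-3/2) \<le> 1" .
      qed (use assms h in simp)
      finally show ?thesis by (simp add: abs_mult)
    qed
    define r where "r = real (i - j + 1) powr (- (1/2)) / real j"
    have r0: "r \<ge> 0" by (simp add: r_def)
    have Ar: "288 * M * r \<le> A * r" using assms B0 r0 by (intro mult_right_mono) (auto simp: A_def)
    have Ah: "4 * L * h * B + 50 * L * h \<le> A * h"
    proof -
      have "4 * L * h * B + 50 * L * h = (L * (4 * B + 50)) * h" by (simp add: algebra_simps)
      also have "\<dots> \<le> A * h" using assms h by (intro mult_right_mono) (auto simp: A_def)
      finally show ?thesis .
    qed
    show ?thesis
    proof (cases "j < i")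
      case True
      then show ?thesis unfolding decomp r_def[symmetric] using S0 S1 S2[folded r_def] Ar Ah by auto
    next
      case False
      then have "i = j" using j by simp
      then show ?thesis unfolding decomp r_def[symmetric] using S2[folded r_def] Ar by (simp add: S1_def)
    qed
  qed
  show ?thesis using A0 main by (intro exI[of _ A]) blast
qed

lemma sum_triangle_swap:
  fixes f :: "nat \<Rightarrow> nat \<Rightarrow> real"
  shows "(\<Sum>l=1..i. \<Sum>j=1..l. f l j) = (\<Sum>j=1..i. \<Sum>l=j..i. f l j)"
proof -
  have "(\<Sum>l=1..i. \<Sum>j=1..l. f l j) = (\<Sum>(l,j)\<in>(SIGMA l:{1..i}. {1..l}). f l j)"
    by (rule sum.Sigma) auto
  also have "\<dots> = (\<Sum>(j,l)\<in>(SIGMA j:{1..i}. {j..i}). f l j)"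
    by (rule sum.reindex_bij_witness[of _ prod.swap prod.swap]) auto
  also have "\<dots> = (\<Sum>j=1..i. \<Sum>l=j..i. f l j)"
    by (rule sum.Sigma[symmetric]) auto
  finally show ?thesis .
qed

text \<open>
  These move the weight \<open>i powr \<beta>\<close> past a sum over \<open>j\<close>, at the price of a growing factor in \<open>i - j\<close>.
\<close>
lemma index_ratio_bounds:
  fixes \<beta> :: real
  assumes "0 \<le> \<beta>" "\<beta> \<le> 1" "1 \<le> j" "j \<le> i"
  shows "(real i / real j) powr \<beta> \<le> 1 + real (i - j) / real j"
    and "(real i / real j) powr \<beta> \<le> real (i + 1 - j) powr \<beta>"
proof -
  have j: "real j > 0" "real j \<ge> 1" "real i \<ge> real j" using assms by auto
  have "(real i / real j) powr \<beta> \<le> (real i / real j) powr 1"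
    using j assms by (intro powr_mono) (auto simp: divide_simps)
  also have "\<dots> = 1 + real (i - j) / real j" using j assms by (simp add: of_nat_diff field_simps)
  finally show "(real i / real j) powr \<beta> \<le> 1 + real (i - j) / real j" .
  have "(real j - 1) * (real i - real j) \<ge> 0" using j by simp
  then have "real i \<le> real (i + 1 - j) * real j" using assms by (simp add: of_nat_diff algebra_simps)
  then have "real i / real j \<le> real (i + 1 - j)" using j(1) by (simp only: pos_divide_le_eq)
  then show "(real i / real j) powr \<beta> \<le> real (i + 1 - j) powr \<beta>"
    using j assms by (intro powr_mono2) auto
qed

text \<open>
  The transformed system is solved for its diagonal term \<open>4/3 * Y i\<close> with \<open>Y j = K j j * j powr (- \<alpha>) * e j\<close>
  and multiplied by \<open>i powr (\<alpha> - 1/2)\<close>, the inverse of the size of the residual.  The resulting quantity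
  \<open>i powr (\<alpha> - 1/2) * \<bar>Y i\<bar>\<close> is \<open>\<bar>K i i * e i\<bar> / sqrt i\<close>.  Of the three sums, the first is a contraction, the
  second has row sums tending to zero, and the third is of Gronwall type.
\<close>
lemma scaled_error_recurrence:
  assumes \<alpha>: "1/2 \<le> \<alpha>" "\<alpha> < 1" and "0 \<le> M" "0 \<le> L" "0 < \<kappa>"
  shows "\<exists>A\<ge>0. \<forall>D h m K e i. 0 \<le> D \<longrightarrow> 0 \<le> h \<longrightarrow> abel_system \<alpha> M \<kappa> L D h m K e \<longrightarrow> 1 \<le> i \<longrightarrow> i \<le> m \<longrightarrow>
      \<bar>K i i * e i\<bar> / sqrt (real i) \<le> A * D
        + (\<Sum>j\<in>{1..<i}. 3/4 * \<bar>abel_symbol (i - j)\<bar> * (\<bar>K j j * e j\<bar> / sqrt (real j)))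
        + (\<Sum>j=1..i. A * (real (i + 1 - j) powr (- (1 - \<alpha>)) / real j) * (\<bar>K j j * e j\<bar> / sqrt (real j)))
        + (\<Sum>j\<in>{1..<i}. A * h * real m powr (\<alpha> - 1/2) * real j powr (1/2 - \<alpha>) * (\<bar>K j j * e j\<bar> / sqrt (real j)))"
proof -
  obtain A0 where A0: "0 \<le> A0" and row:
    "\<And>D h m K e i j. 0 \<le> h \<Longrightarrow> abel_system \<alpha> M \<kappa> L D h m K e \<Longrightarrow> 1 \<le> j \<Longrightarrow> j \<le> i \<Longrightarrow> i \<le> m \<Longrightarrow>
      \<bar>(\<Sum>l=j..i. sqrt_coeff (i - l) * (K l j * (real j powr \<alpha> * trap_weight \<alpha> l j))) - K j j * abel_symbol (i - j)\<bar>
       \<le> (if j < i then A0 * h else 0) + A0 * (real (i - j + 1) powr (- (1/2)) / real j)"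
    using transformed_row[OF \<alpha> assms(3,4), of \<kappa>] by blast
  define \<beta> where "\<beta> = \<alpha> - 1/2"
  have \<beta>: "0 \<le> \<beta>" "\<beta> \<le> 1" "\<beta> \<le> 1/2" using \<alpha> by (auto simp: \<beta>_def)
  define A where "A = 36 + 50 + A0 / \<kappa>"
  have A: "0 \<le> A" "A0 / \<kappa> + 50 \<le> A" "36 \<le> A" "A0 / \<kappa> \<le> A" using A0 assms by (auto simp: A_def)
  have main: "\<bar>K i i * e i\<bar> / sqrt (real i) \<le> A * D
        + (\<Sum>j\<in>{1..<i}. 3/4 * \<bar>abel_symbol (i - j)\<bar> * (\<bar>K j j * e j\<bar> / sqrt (real j)))
        + (\<Sum>j=1..i. A * (real (i + 1 - j) powr (- (1 - \<alpha>)) / real j) * (\<bar>K j j * e j\<bar> / sqrt (real j)))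
        + (\<Sum>j\<in>{1..<i}. A * h * real m powr (\<alpha> - 1/2) * real j powr (1/2 - \<alpha>) * (\<bar>K j j * e j\<bar> / sqrt (real j)))"
    if D: "0 \<le> D" and h: "0 \<le> h" and sys: "abel_system \<alpha> M \<kappa> L D h m K e" and i: "1 \<le> i" "i \<le> m" for D h m K e i
  proof -
    define y where "y j = real j powr (- \<alpha>) * e j" for j
    define Y where "Y j = K j j * y j" for j
    define x where "x j = \<bar>K j j * e j\<bar> / sqrt (real j)" for j
    have x0: "0 \<le> x j" for j by (simp add: x_def)
    have xY: "x j = real j powr \<beta> * \<bar>Y j\<bar>" for j
    proof -
      have "real j powr \<beta> * \<bar>Y j\<bar> = (real j powr \<beta> * real j powr (- \<alpha>)) * \<bar>K j j * e j\<bar>"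
        by (simp add: Y_def y_def abs_mult)
      also have "real j powr \<beta> * real j powr (- \<alpha>) = real j powr (- (1/2))"
        by (simp only: powr_add[symmetric]) (simp add: \<beta>_def)
      finally show ?thesis by (simp add: x_def powr_minus_divide powr_half_sqrt)
    qed
    define \<rho> where "\<rho> j = (real i / real j) powr \<beta>" for j
    have \<rho>x: "real i powr \<beta> * \<bar>Y j\<bar> = \<rho> j * x j" if "1 \<le> j" for j
      using that i by (simp add: \<rho>_def xY powr_divide)
    define r where "r j = real (i + 1 - j) powr (- (1 - \<alpha>)) / real j" for j
    have r0: "0 \<le> r j" for j by (simp add: r_def)
    define S where "S l = (\<Sum>j=1..l. K l j * trap_weight \<alpha> l j * e j)" for l
    define R where "R j = (\<Sum>l=j..i. sqrt_coeff (i - l) * (K l j * (real j powr \<alpha> * trap_weight \<alpha> l j))) - K j j * abel_symbol (i - j)" for j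
    have S_eq: "S l = (\<Sum>j=1..l. K l j * (real j powr \<alpha> * trap_weight \<alpha> l j) * y j)" for l
      unfolding S_def y_def by (intro sum.cong refl) (auto simp: powr_minus field_simps)
    have "(\<Sum>l=1..i. sqrt_coeff (i - l) * S l)
       = (\<Sum>l=1..i. \<Sum>j=1..l. sqrt_coeff (i - l) * (K l j * (real j powr \<alpha> * trap_weight \<alpha> l j)) * y j)"
      unfolding S_eq sum_distrib_left by (intro sum.cong refl) (simp add: mult_ac)
    also have "\<dots> = (\<Sum>j=1..i. (\<Sum>l=j..i. sqrt_coeff (i - l) * (K l j * (real j powr \<alpha> * trap_weight \<alpha> l j))) * y j)"
      unfolding sum_triangle_swap sum_distrib_right ..
    also have "\<dots> = (\<Sum>j=1..i. abel_symbol (i - j) * Y j) + (\<Sum>j=1..i. R j * y j)"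
      unfolding sum.distrib[symmetric] by (intro sum.cong refl) (simp add: R_def Y_def algebra_simps)
    finally have "(\<Sum>l=1..i. sqrt_coeff (i - l) * S l)
       = (\<Sum>j=1..i. abel_symbol (i - j) * Y j) + (\<Sum>j=1..i. R j * y j)" .
    moreover have "(\<Sum>j=1..i. abel_symbol (i - j) * Y j) = 4/3 * Y i + (\<Sum>j\<in>{1..<i}. abel_symbol (i - j) * Y j)"
    proof -
      have "{1..i} = insert i {1..<i}" using i by auto
      then show ?thesis by (simp add: abel_symbol_0)
    qed
    ultimately have id: "4/3 * Y i = (\<Sum>l=1..i. sqrt_coeff (i - l) * S l)
        - (\<Sum>j\<in>{1..<i}. abel_symbol (i - j) * Y j) - (\<Sum>j=1..i. R j * y j)" by linarith
    have s1: "\<bar>\<Sum>l=1..i. sqrt_coeff (i - l) * S l\<bar> \<le> 48 * D * real i powr (- \<beta>)"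
    proof -
      have "\<bar>\<Sum>l=1..i. sqrt_coeff (i - l) * S l\<bar> \<le> (\<Sum>l=1..i. 2 * D * (real (i - l + 1) powr (-3/2) * real l powr (- \<beta>)))"
      proof (rule order_trans[OF sum_abs sum_mono])
        fix l assume l: "l \<in> {1..i}"
        have "1/2 - \<alpha> = - \<beta>" by (simp add: \<beta>_def)
        then have "\<bar>S l\<bar> \<le> D * real l powr (- \<beta>)"
          using sys l i unfolding abel_system_def S_def by auto
        then have "\<bar>sqrt_coeff (i - l)\<bar> * \<bar>S l\<bar> \<le> (2 * real (i - l + 1) powr (-3/2)) * (D * real l powr (- \<beta>))"
          by (intro mult_mono abs_sqrt_coeff_le) auto
        then show "\<bar>sqrt_coeff (i - l) * S l\<bar> \<le> 2 * D * (real (i - l + 1) powr (-3/2) * real l powr (- \<beta>))"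
          by (simp add: abs_mult mult_ac)
      qed
      also have "\<dots> = 2 * D * (\<Sum>k=0..i - 1. real (k + 1) powr (-3/2) * real (i - 1 - k + 1) powr (- \<beta>))"
        unfolding sum_distrib_left
        by (rule sum.reindex_bij_witness[of _ "\<lambda>k. i - k" "\<lambda>l. i - l"]) (use i in auto)
      also have "\<dots> \<le> 2 * D * (24 * real (i - 1 + 1) powr (- \<beta>))"
        using D \<beta> by (intro mult_left_mono convolution_three_halves) auto
      finally show ?thesis using i by simp
    qed
    have Rb: "\<bar>R j\<bar> \<le> (if j < i then A0 * h else 0) + A0 * (real (i - j + 1) powr (- (1/2)) / real j)" if "j \<in> {1..i}" for j
      unfolding R_def using row[OF h sys] that i by auto
    have yb: "\<bar>y j\<bar> \<le> \<bar>Y j\<bar> / \<kappa>" if "j \<in> {1..i}" for j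
    proof -
      have "\<kappa> \<le> \<bar>K j j\<bar>" using sys that i unfolding abel_system_def by auto
      then have "\<kappa> * \<bar>y j\<bar> \<le> \<bar>Y j\<bar>" by (simp add: Y_def abs_mult mult_right_mono)
      then show ?thesis using assms by (simp add: field_simps)
    qed
    have s3: "real i powr \<beta> * \<bar>\<Sum>j=1..i. R j * y j\<bar> \<le>
        (\<Sum>j=1..i. (if j < i then A0 / \<kappa> * h * real m powr \<beta> * real j powr (- \<beta>) * x j else 0) + A0 / \<kappa> * r j * x j)"
    proof -
      have "real i powr \<beta> * \<bar>\<Sum>j=1..i. R j * y j\<bar> \<le> (\<Sum>j=1..i. real i powr \<beta> * \<bar>R j * y j\<bar>)"
        unfolding sum_distrib_left[symmetric] by (intro mult_left_mono sum_abs) auto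
      also have "\<dots> \<le> (\<Sum>j=1..i. (if j < i then A0 / \<kappa> * h * real m powr \<beta> * real j powr (- \<beta>) * x j else 0) + A0 / \<kappa> * r j * x j)"
      proof (rule sum_mono)
        fix j assume j: "j \<in> {1..i}"
        have 1: "\<rho> j \<le> real m powr \<beta> * real j powr (- \<beta>)"
        proof -
          have "\<rho> j = real i powr \<beta> * real j powr (- \<beta>)" using i j by (simp add: \<rho>_def powr_divide powr_minus_divide)
          also have "\<dots> \<le> real m powr \<beta> * real j powr (- \<beta>)"
            using i \<beta> by (intro mult_right_mono powr_mono2) auto
          finally show ?thesis .
        qed
        have 2: "real (i - j + 1) powr (- (1/2)) / real j * \<rho> j \<le> r j"
        proof -
          have eq: "i - j + 1 = i + 1 - j" using j by auto
          have "real (i + 1 - j) powr (- (1/2)) * \<rho> j \<le> real (i + 1 - j) powr (- (1/2)) * real (i + 1 - j) powr \<beta>"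
            unfolding \<rho>_def using \<beta> j by (intro mult_left_mono index_ratio_bounds) auto
          also have "\<dots> = real (i + 1 - j) powr (- (1 - \<alpha>))"
            by (simp only: powr_add[symmetric]) (simp add: \<beta>_def)
          finally show ?thesis unfolding eq r_def by (simp add: divide_right_mono)
        qed
        have "real i powr \<beta> * \<bar>R j * y j\<bar> \<le> real i powr \<beta> * (((if j < i then A0 * h else 0) + A0 * (real (i - j + 1) powr (- (1/2)) / real j)) * (\<bar>Y j\<bar> / \<kappa>))"
          unfolding abs_mult using Rb[OF j] yb[OF j] A0 h by (intro mult_left_mono mult_mono) auto
        also have "\<dots> = ((if j < i then A0 * h else 0) + A0 * (real (i - j + 1) powr (- (1/2)) / real j)) / \<kappa> * (real i powr \<beta> * \<bar>Y j\<bar>)"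
          by simp
        also have "\<dots> = (if j < i then A0 / \<kappa> * h * \<rho> j * x j else 0) + A0 / \<kappa> * (real (i - j + 1) powr (- (1/2)) / real j * \<rho> j) * x j"
          using j by (subst \<rho>x) (auto simp: algebra_simps add_divide_distrib)
        also have "\<dots> \<le> (if j < i then A0 / \<kappa> * h * (real m powr \<beta> * real j powr (- \<beta>)) * x j else 0) + A0 / \<kappa> * r j * x j"
        proof (rule add_mono)
          have "A0 / \<kappa> * h * \<rho> j * x j \<le> A0 / \<kappa> * h * (real m powr \<beta> * real j powr (- \<beta>)) * x j"
            using A0 assms h by (intro mult_right_mono mult_left_mono 1 x0) simp
          then show "(if j < i then A0 / \<kappa> * h * \<rho> j * x j else 0)
              \<le> (if j < i then A0 / \<kappa> * h * (real m powr \<beta> * real j powr (- \<beta>)) * x j else 0)" by simp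
          show "A0 / \<kappa> * (real (i - j + 1) powr (- (1/2)) / real j * \<rho> j) * x j \<le> A0 / \<kappa> * r j * x j"
            using A0 assms by (intro mult_right_mono mult_left_mono 2 x0) simp
        qed
        finally show "real i powr \<beta> * \<bar>R j * y j\<bar> \<le> (if j < i then A0 / \<kappa> * h * real m powr \<beta> * real j powr (- \<beta>) * x j else 0) + A0 / \<kappa> * r j * x j"
          by (simp only: mult.assoc)
      qed
      finally show ?thesis .
    qed
    have s2: "real i powr \<beta> * \<bar>\<Sum>j\<in>{1..<i}. abel_symbol (i - j) * Y j\<bar> \<le>
        (\<Sum>j\<in>{1..<i}. \<bar>abel_symbol (i - j)\<bar> * x j) + (\<Sum>j=1..i. 50 * r j * x j)"
    proof -
      have "real i powr \<beta> * \<bar>\<Sum>j\<in>{1..<i}. abel_symbol (i - j) * Y j\<bar> \<le> (\<Sum>j\<in>{1..<i}. real i powr \<beta> * \<bar>abel_symbol (i - j) * Y j\<bar>)"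
        unfolding sum_distrib_left[symmetric] by (intro mult_left_mono sum_abs) auto
      also have "\<dots> \<le> (\<Sum>j\<in>{1..<i}. \<bar>abel_symbol (i - j)\<bar> * x j + 50 * r j * x j)"
      proof (rule sum_mono)
        fix j assume j: "j \<in> {1..<i}"
        have "\<bar>abel_symbol (i - j)\<bar> * \<rho> j \<le> \<bar>abel_symbol (i - j)\<bar> * (1 + real (i - j) / real j)"
          unfolding \<rho>_def using \<beta> j by (intro mult_left_mono index_ratio_bounds) auto
        also have "\<dots> = \<bar>abel_symbol (i - j)\<bar> + \<bar>abel_symbol (i - j)\<bar> * real (i - j) / real j"
          by (simp add: distrib_left)
        also have "\<bar>abel_symbol (i - j)\<bar> * real (i - j) / real j \<le> 50 * r j"
        proof -
          have "\<bar>abel_symbol (i - j)\<bar> * real (i - j) \<le> (50 * real (i - j + 1) powr (-3/2)) * real (i - j + 1)"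
            by (intro mult_mono abs_abel_symbol_le) auto
          also have "\<dots> = 50 * (real (i - j + 1) powr (-3/2) * real (i - j + 1) powr 1)" by simp
          also have "real (i - j + 1) powr (-3/2) * real (i - j + 1) powr 1 = real (i - j + 1) powr (- (1/2))"
            by (simp only: powr_add[symmetric]) simp
          also have "50 * real (i - j + 1) powr (- (1/2)) \<le> 50 * real (i - j + 1) powr (- (1 - \<alpha>))"
            using \<alpha> by (intro mult_left_mono powr_mono) auto
          finally have "\<bar>abel_symbol (i - j)\<bar> * real (i - j) \<le> 50 * real (i - j + 1) powr (- (1 - \<alpha>))" .
          then have "\<bar>abel_symbol (i - j)\<bar> * real (i - j) / real j \<le> 50 * real (i - j + 1) powr (- (1 - \<alpha>)) / real j"
            by (intro divide_right_mono) auto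
          moreover have "i + 1 - j = i - j + 1" using j by auto
          ultimately show ?thesis unfolding r_def by (simp only: times_divide_eq_right)
        qed
        finally have "(\<bar>abel_symbol (i - j)\<bar> * \<rho> j) * x j \<le> (\<bar>abel_symbol (i - j)\<bar> + 50 * r j) * x j"
          by (intro mult_right_mono x0) auto
        moreover have "real i powr \<beta> * \<bar>abel_symbol (i - j) * Y j\<bar> = \<bar>abel_symbol (i - j)\<bar> * (real i powr \<beta> * \<bar>Y j\<bar>)"
          by (simp add: abs_mult)
        moreover have "real i powr \<beta> * \<bar>Y j\<bar> = \<rho> j * x j" using j by (intro \<rho>x) auto
        ultimately show "real i powr \<beta> * \<bar>abel_symbol (i - j) * Y j\<bar> \<le> \<bar>abel_symbol (i - j)\<bar> * x j + 50 * r j * x j"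
          by (simp only: distrib_right mult.assoc)
      qed
      also have "\<dots> = (\<Sum>j\<in>{1..<i}. \<bar>abel_symbol (i - j)\<bar> * x j) + (\<Sum>j\<in>{1..<i}. 50 * r j * x j)"
        by (rule sum.distrib)
      also have "(\<Sum>j\<in>{1..<i}. 50 * r j * x j) \<le> (\<Sum>j=1..i. 50 * r j * x j)"
        using x0 r0 by (intro sum_mono2) auto
      finally show ?thesis by simp
    qed
    define S2 where "S2 = (\<Sum>j\<in>{1..<i}. \<bar>abel_symbol (i - j)\<bar> * x j)"
    define S3 where "S3 = (\<Sum>j=1..i. r j * x j)"
    define S4 where "S4 = (\<Sum>j\<in>{1..<i}. h * real m powr \<beta> * real j powr (- \<beta>) * x j)"
    have nn: "0 \<le> S3" "0 \<le> S4" unfolding S3_def S4_def using x0 r0 h by (auto intro!: sum_nonneg)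
    have e50: "(\<Sum>j=1..i. 50 * r j * x j) = 50 * S3" unfolding S3_def sum_distrib_left by (simp add: mult.assoc)
    have eR: "(\<Sum>j=1..i. (if j < i then A0 / \<kappa> * h * real m powr \<beta> * real j powr (- \<beta>) * x j else 0) + A0 / \<kappa> * r j * x j)
       = A0 / \<kappa> * S4 + A0 / \<kappa> * S3"
    proof -
      have "(\<Sum>j=1..i. if j < i then A0 / \<kappa> * h * real m powr \<beta> * real j powr (- \<beta>) * x j else 0)
         = (\<Sum>j\<in>{1..<i}. A0 / \<kappa> * h * real m powr \<beta> * real j powr (- \<beta>) * x j)"
        by (rule sum.mono_neutral_cong_right) auto
      then show ?thesis unfolding S3_def S4_def sum_distrib_left sum.distrib by (simp add: mult.assoc)
    qed
    have "4/3 * x i = real i powr \<beta> * \<bar>4/3 * Y i\<bar>" by (simp add: xY abs_mult)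
    also have "\<dots> \<le> real i powr \<beta> * (\<bar>\<Sum>l=1..i. sqrt_coeff (i - l) * S l\<bar> + \<bar>\<Sum>j\<in>{1..<i}. abel_symbol (i - j) * Y j\<bar> + \<bar>\<Sum>j=1..i. R j * y j\<bar>)"
      unfolding id by (intro mult_left_mono) auto
    also have "\<dots> \<le> 48 * D + (S2 + 50 * S3) + (A0 / \<kappa> * S4 + A0 / \<kappa> * S3)"
    proof -
      have "real i powr \<beta> * \<bar>\<Sum>l=1..i. sqrt_coeff (i - l) * S l\<bar> \<le> real i powr \<beta> * (48 * D * real i powr (- \<beta>))"
        by (intro mult_left_mono s1) auto
      also have "\<dots> = 48 * D" using i by (simp add: powr_minus)
      finally show ?thesis using s2 s3 unfolding e50 eR S2_def[symmetric] distrib_left by linarith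
    qed
    finally have "4/3 * x i \<le> 48 * D + (S2 + 50 * S3) + (A0 / \<kappa> * S4 + A0 / \<kappa> * S3)" .
    moreover have "(A0 / \<kappa> + 50) * S3 = A0 / \<kappa> * S3 + 50 * S3" by (rule distrib_right)
    ultimately have "x i \<le> 36 * D + 3/4 * S2 + 3/4 * ((A0 / \<kappa> + 50) * S3) + 3/4 * (A0 / \<kappa> * S4)"
      by linarith
    also have "\<dots> \<le> A * D + 3/4 * S2 + A * S3 + A * S4"
    proof -
      have "36 * D \<le> A * D" using A D by (intro mult_right_mono) auto
      moreover have "(A0 / \<kappa> + 50) * S3 \<le> A * S3" "A0 / \<kappa> * S4 \<le> A * S4"
        by (rule mult_right_mono[OF A(2) nn(1)], rule mult_right_mono[OF A(4) nn(2)])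
      moreover have "0 \<le> (A0 / \<kappa> + 50) * S3" "0 \<le> A0 / \<kappa> * S4" using A0 assms nn by auto
      ultimately show ?thesis by linarith
    qed
    finally have "x i \<le> A * D + 3/4 * S2 + A * S3 + A * S4" .
    moreover have "3/4 * S2 = (\<Sum>j\<in>{1..<i}. 3/4 * \<bar>abel_symbol (i - j)\<bar> * x j)"
      unfolding S2_def sum_distrib_left by (simp add: mult.assoc)
    moreover have "A * S3 = (\<Sum>j=1..i. A * r j * x j)" unfolding S3_def sum_distrib_left by (simp add: mult.assoc)
    moreover have "A * S4 = (\<Sum>j\<in>{1..<i}. A * h * real m powr (\<alpha> - 1/2) * real j powr (1/2 - \<alpha>) * x j)"
      unfolding S4_def sum_distrib_left by (simp add: mult.assoc \<beta>_def)
    ultimately show ?thesis unfolding x_def r_def by simp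
  qed
  show ?thesis using A(1) main by (intro exI[of _ A]) blast
qed

text \<open>
  In the recurrence for \<open>x i = \<bar>K i i * e i\<bar> / sqrt i\<close> the first sum contributes at most \<open>15/16\<close> of the running
  maximum of \<open>x\<close>, and from some row \<open>J\<close> on the second at most \<open>1/32\<close>.  A row attaining the running maximum is
  therefore bounded by the residual and the Gronwall sum, and the rows up to \<open>J\<close> are bounded directly.
  The Gronwall weights \<open>h * m powr \<beta> * j powr (- \<beta>)\<close> with \<open>\<beta> = \<alpha> - 1/2\<close> sum to
  a constant times \<open>h * m \<le> T\<close>, because \<open>\<beta> < 1\<close>.
\<close>
theorem abel_system_stability:
  assumes \<alpha>: "1/2 \<le> \<alpha>" "\<alpha> < 1" and pos: "0 \<le> M" "0 \<le> L" "0 < \<kappa>" "0 \<le> T"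
  shows "\<exists>C\<ge>0. \<forall>D h m K e i. 0 \<le> D \<longrightarrow> 0 \<le> h \<longrightarrow> h * real m \<le> T \<longrightarrow> abel_system \<alpha> M \<kappa> L D h m K e \<longrightarrow>
      1 \<le> i \<longrightarrow> i \<le> m \<longrightarrow> \<bar>e i\<bar> \<le> C * D * sqrt (real i)"
proof -
  obtain A where A: "0 \<le> A" and rec:
    "\<And>D h m K e i. 0 \<le> D \<Longrightarrow> 0 \<le> h \<Longrightarrow> abel_system \<alpha> M \<kappa> L D h m K e \<Longrightarrow> 1 \<le> i \<Longrightarrow> i \<le> m \<Longrightarrow>
      \<bar>K i i * e i\<bar> / sqrt (real i) \<le> A * D
        + (\<Sum>j\<in>{1..<i}. 3/4 * \<bar>abel_symbol (i - j)\<bar> * (\<bar>K j j * e j\<bar> / sqrt (real j)))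
        + (\<Sum>j=1..i. A * (real (i + 1 - j) powr (- (1 - \<alpha>)) / real j) * (\<bar>K j j * e j\<bar> / sqrt (real j)))
        + (\<Sum>j\<in>{1..<i}. A * h * real m powr (\<alpha> - 1/2) * real j powr (1/2 - \<alpha>) * (\<bar>K j j * e j\<bar> / sqrt (real j)))"
    using scaled_error_recurrence[OF \<alpha> pos(1,2,3)] by blast
  have "(\<lambda>i. A * (\<Sum>j=1..i. real (i + 1 - j) powr (- (1 - \<alpha>)) / real j)) \<longlonglongrightarrow> A * 0"
    using \<alpha> by (intro tendsto_mult tendsto_const harmonic_convolution_tendsto_0) auto
  then have "eventually (\<lambda>i. A * (\<Sum>j=1..i. real (i + 1 - j) powr (- (1 - \<alpha>)) / real j) < 1/32) sequentially"
    by (rule order_tendstoD) simp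
  then obtain J where J: "\<And>i. i \<ge> J \<Longrightarrow> A * (\<Sum>j=1..i. real (i + 1 - j) powr (- (1 - \<alpha>)) / real j) < 1/32"
    by (auto simp: eventually_sequentially)
  obtain C0 where C0: "C0 \<ge> 0" and init: "\<And>L D h m K e i. 0 \<le> D \<Longrightarrow> abel_system \<alpha> M \<kappa> L D h m K e \<Longrightarrow>
     1 \<le> i \<Longrightarrow> i \<le> m \<Longrightarrow> i \<le> J \<Longrightarrow> \<bar>e i\<bar> \<le> C0 * D"
    using initial_errors_bounded[OF \<alpha> pos(3,1), of J] by blast
  define \<beta> where "\<beta> = \<alpha> - 1/2"
  have \<beta>: "0 \<le> \<beta>" "\<beta> < 1" using \<alpha> by (auto simp: \<beta>_def)
  define A2 where "A2 = M * C0 + 32 * A"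
  have A2: "0 \<le> A2" using pos C0 A by (simp add: A2_def)
  define C where "C = A2 * exp (32 * A * T / (1 - \<beta>)) / \<kappa>"
  have C: "0 \<le> C" using A2 pos by (simp add: C_def)
  have main: "\<bar>e i\<bar> \<le> C * D * sqrt (real i)"
    if D: "0 \<le> D" and h: "0 \<le> h" "h * real m \<le> T" and sys: "abel_system \<alpha> M \<kappa> L D h m K e" and i: "1 \<le> i" "i \<le> m"
    for D h m K e i
  proof -
    define x where "x j = \<bar>K j j * e j\<bar> / sqrt (real j)" for j
    have x0: "0 \<le> x j" for j by (simp add: x_def)
    define \<omega> where "\<omega> j = 32 * A * h * real m powr \<beta> * real j powr (- \<beta>)" for j
    have \<omega>0: "0 \<le> \<omega> j" for j using A h by (simp add: \<omega>_def)
    have bound: "x n \<le> A2 * D + (\<Sum>j\<in>{1..<n}. \<omega> j * x j)" if n: "1 \<le> n" "n \<le> m" for n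
    proof -
      have fin: "finite (x ` {1..n})" "x ` {1..n} \<noteq> {}" using n by auto
      obtain i0 where i0: "i0 \<in> {1..n}" "x i0 = Max (x ` {1..n})"
        using Max_in[OF fin] by auto
      have x_le: "x j \<le> x i0" if "j \<in> {1..n}" for j
        unfolding i0(2) using that fin by (intro Max_ge) auto
      have "x i0 \<le> A2 * D + (\<Sum>j\<in>{1..<i0}. \<omega> j * x j)"
      proof (cases "i0 \<le> J")
        case True
        have "\<bar>e i0\<bar> \<le> C0 * D" using init[OF D sys] True i0 n by auto
        moreover have "\<bar>K i0 i0\<bar> \<le> M" using sys i0 n unfolding abel_system_def by auto
        ultimately have "\<bar>K i0 i0 * e i0\<bar> \<le> M * (C0 * D)"
          unfolding abs_mult using pos by (intro mult_mono) auto
        moreover have "x i0 \<le> \<bar>K i0 i0 * e i0\<bar>"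
        proof -
          have "1 \<le> sqrt (real i0)" using i0 by simp
          then have "\<bar>K i0 i0 * e i0\<bar> * 1 \<le> \<bar>K i0 i0 * e i0\<bar> * sqrt (real i0)"
            by (intro mult_left_mono) auto
          then show ?thesis unfolding x_def using i0 by (simp add: divide_simps)
        qed
        ultimately have "x i0 \<le> M * C0 * D" by (simp add: mult.assoc)
        also have "\<dots> \<le> A2 * D" using A D by (intro mult_right_mono) (auto simp: A2_def)
        finally show ?thesis using \<omega>0 x0 by (smt (verit) sum_nonneg mult_nonneg_nonneg)
      next
        case False
        have "x i0 \<le> A * D
          + (\<Sum>j\<in>{1..<i0}. 3/4 * \<bar>abel_symbol (i0 - j)\<bar> * x j)
          + (\<Sum>j=1..i0. A * (real (i0 + 1 - j) powr (- (1 - \<alpha>)) / real j) * x j)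
          + (\<Sum>j\<in>{1..<i0}. A * h * real m powr (\<alpha> - 1/2) * real j powr (1/2 - \<alpha>) * x j)"
          unfolding x_def using i0 n by (intro rec[OF D h(1) sys]) auto
        moreover have "(\<Sum>j\<in>{1..<i0}. 3/4 * \<bar>abel_symbol (i0 - j)\<bar> * x j) \<le> 15/16 * x i0"
        proof -
          have "(\<Sum>j\<in>{1..<i0}. 3/4 * \<bar>abel_symbol (i0 - j)\<bar> * x j) \<le> (\<Sum>j\<in>{1..<i0}. 3/4 * \<bar>abel_symbol (i0 - j)\<bar> * x i0)"
            using x_le i0 by (intro sum_mono mult_left_mono) auto
          also have "\<dots> = 3/4 * (\<Sum>j\<in>{1..<i0}. \<bar>abel_symbol (i0 - j)\<bar>) * x i0"
            by (simp add: sum_distrib_left sum_distrib_right)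
          also have "(\<Sum>j\<in>{1..<i0}. \<bar>abel_symbol (i0 - j)\<bar>) = (\<Sum>k=1..i0 - 1. \<bar>abel_symbol k\<bar>)"
            by (rule sum.reindex_bij_witness[of _ "\<lambda>k. i0 - k" "\<lambda>j. i0 - j"]) auto
          also have "3/4 * \<dots> * x i0 \<le> 3/4 * (5/4) * x i0"
            by (intro mult_right_mono mult_left_mono sum_abs_abel_symbol x0) auto
          finally show ?thesis by simp
        qed
        moreover have "(\<Sum>j=1..i0. A * (real (i0 + 1 - j) powr (- (1 - \<alpha>)) / real j) * x j) \<le> 1/32 * x i0"
        proof -
          have "(\<Sum>j=1..i0. A * (real (i0 + 1 - j) powr (- (1 - \<alpha>)) / real j) * x j)
             \<le> (\<Sum>j=1..i0. A * (real (i0 + 1 - j) powr (- (1 - \<alpha>)) / real j) * x i0)"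
            using x_le i0 A by (intro sum_mono mult_left_mono) auto
          also have "\<dots> = A * (\<Sum>j=1..i0. real (i0 + 1 - j) powr (- (1 - \<alpha>)) / real j) * x i0"
            by (simp only: sum_distrib_left sum_distrib_right)
          also have "\<dots> \<le> 1/32 * x i0"
            using J[of i0] False by (intro mult_right_mono x0) auto
          finally show ?thesis .
        qed
        moreover have "(\<Sum>j\<in>{1..<i0}. \<omega> j * x j) = 32 * (\<Sum>j\<in>{1..<i0}. A * h * real m powr (\<alpha> - 1/2) * real j powr (1/2 - \<alpha>) * x j)"
          unfolding sum_distrib_left by (simp add: \<omega>_def \<beta>_def mult.assoc)
        moreover have "32 * A * D \<le> A2 * D" using pos C0 D by (intro mult_right_mono) (auto simp: A2_def)
        ultimately show ?thesis by linarith
      qed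
      also have "(\<Sum>j\<in>{1..<i0}. \<omega> j * x j) \<le> (\<Sum>j\<in>{1..<n}. \<omega> j * x j)"
        using i0 \<omega>0 x0 by (intro sum_mono2) auto
      finally show ?thesis using x_le[of n] n by auto
    qed
    have "x i \<le> (A2 * D) * exp (\<Sum>j\<in>{1..<i}. \<omega> j)"
      using A2 D \<omega>0 bound i by (intro discrete_gronwall[of _ _ m]) auto
    also have "\<dots> \<le> (A2 * D) * exp (32 * A * T / (1 - \<beta>))"
    proof -
      have "(\<Sum>j\<in>{1..<i}. \<omega> j) \<le> (\<Sum>j=1..m. \<omega> j)" using i \<omega>0 by (intro sum_mono2) auto
      also have "\<dots> = 32 * A * h * real m powr \<beta> * (\<Sum>j=1..m. real j powr ((1 - \<beta>) - 1))"
        unfolding sum_distrib_left by (simp add: \<omega>_def)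
      also have "\<dots> \<le> 32 * A * h * real m powr \<beta> * (real m powr (1 - \<beta>) / (1 - \<beta>))"
        using A h \<beta> by (intro mult_left_mono sum_powr_le) auto
      also have "\<dots> = 32 * A * h * (real m powr \<beta> * real m powr (1 - \<beta>)) / (1 - \<beta>)" by simp
      also have "real m powr \<beta> * real m powr (1 - \<beta>) = real m"
        unfolding powr_add[symmetric] by simp
      also have "32 * A * h * real m / (1 - \<beta>) \<le> 32 * A * T / (1 - \<beta>)"
      proof -
        have "32 * A * (h * real m) \<le> 32 * A * T" using A h by (intro mult_left_mono) auto
        then show ?thesis using \<beta> by (intro divide_right_mono) (auto simp: mult.assoc)
      qed
      finally show ?thesis using A2 D by (intro mult_left_mono) auto
    qed
    finally have xi: "x i \<le> \<kappa> * C * D" using pos by (simp add: C_def mult_ac)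
    have "\<kappa> \<le> \<bar>K i i\<bar>" using sys i unfolding abel_system_def by auto
    then have "\<kappa> * \<bar>e i\<bar> \<le> \<bar>K i i * e i\<bar>" by (simp add: abs_mult mult_right_mono)
    also have "\<dots> = x i * sqrt (real i)" using i by (simp add: x_def)
    also have "\<dots> \<le> \<kappa> * C * D * sqrt (real i)" by (intro mult_right_mono xi) auto
    finally have "\<kappa> * \<bar>e i\<bar> \<le> \<kappa> * (C * D * sqrt (real i))" by (simp add: mult.assoc)
    then show ?thesis using pos by simp
  qed
  show ?thesis using C main by (intro exI[of _ C]) blast
qed

section \<open>Consistency of the scheme\<close>

lemma integral_unit_cells:
  fixes F :: "real \<Rightarrow> real"
  assumes "F integrable_on {0..real i}"
  shows "integral {0..real i} F = (\<Sum>j<i. integral {real j..real j + 1} F)"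
  using assms
proof (induction i)
  case (Suc i)
  have "F integrable_on {0..real i}"
    by (rule integrable_on_subinterval[OF Suc.prems]) auto
  moreover have "integral {0..real i} F + integral {real i..real (Suc i)} F = integral {0..real (Suc i)} F"
    using Suc.prems by (intro Henstock_Kurzweil_Integration.integral_combine) auto
  ultimately show ?case using Suc.IH by (simp add: add.commute)
qed simp

lemma sum_cell_weights:
  assumes "1 \<le> i"
  shows "(\<Sum>j<i. \<phi> j * W1 \<alpha> i j + \<phi> (Suc j) * W2 \<alpha> i j) = \<phi> 0 * W1 \<alpha> i 0 + (\<Sum>j=1..i. \<phi> j * trap_weight \<alpha> i j)"
proof -
  have "(\<Sum>j=1..i. \<phi> j * trap_weight \<alpha> i j) = (\<Sum>j=1..i. if j < i then \<phi> j * W1 \<alpha> i j else 0) + (\<Sum>j=1..i. \<phi> j * W2 \<alpha> i (j - 1))"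
    unfolding sum.distrib[symmetric] by (intro sum.cong) (auto simp: trap_weight_def distrib_left)
  also have "(\<Sum>j=1..i. if j < i then \<phi> j * W1 \<alpha> i j else 0) = (\<Sum>j\<in>{1..<i}. \<phi> j * W1 \<alpha> i j)"
    by (rule sum.mono_neutral_cong_right) auto
  also have "(\<Sum>j=1..i. \<phi> j * W2 \<alpha> i (j - 1)) = (\<Sum>j<i. \<phi> (Suc j) * W2 \<alpha> i j)"
    by (rule sum.reindex_bij_witness[of _ Suc "\<lambda>j. j - 1"]) auto
  finally have "\<phi> 0 * W1 \<alpha> i 0 + (\<Sum>j=1..i. \<phi> j * trap_weight \<alpha> i j)
     = (\<phi> 0 * W1 \<alpha> i 0 + (\<Sum>j\<in>{1..<i}. \<phi> j * W1 \<alpha> i j)) + (\<Sum>j<i. \<phi> (Suc j) * W2 \<alpha> i j)" by simp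
  also have "\<phi> 0 * W1 \<alpha> i 0 + (\<Sum>j\<in>{1..<i}. \<phi> j * W1 \<alpha> i j) = (\<Sum>j<i. \<phi> j * W1 \<alpha> i j)"
  proof -
    have "{..<i} = insert 0 {1..<i}" using assms by auto
    then show ?thesis by simp
  qed
  finally show ?thesis by (simp add: sum.distrib)
qed

text \<open>
  On each cell the quadrature rule integrates the linear interpolant exactly, and the density is
  nonnegative; the interpolation error is therefore integrated against the density.
\<close>
lemma product_trapezoidal_quadrature_error:
  fixes \<phi> :: "real \<Rightarrow> real"
  assumes "\<alpha> < 1" "1 \<le> i" and cont: "continuous_on {0..real i} \<phi>"
    and interp: "\<And>j u. j < i \<Longrightarrow> u \<in> {real j..real j + 1} \<Longrightarrow>
      \<bar>\<phi> u - ((real j + 1 - u) * \<phi> (real j) + (u - real j) * \<phi> (real j + 1))\<bar> \<le> \<epsilon>"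
  shows "\<bar>integral {0..real i} (\<lambda>u. \<phi> u * abel_density \<alpha> (real i) u)
      - (\<phi> 0 * W1 \<alpha> i 0 + (\<Sum>j=1..i. \<phi> (real j) * trap_weight \<alpha> i j))\<bar>
     \<le> \<epsilon> * (real i powr (1/2 - \<alpha>) * Beta (1 - \<alpha>) (1/2))"
proof -
  define w where "w = abel_density \<alpha> (real i)"
  have w_int: "w integrable_on {0..real i}" "integral {0..real i} w = real i powr (1/2 - \<alpha>) * Beta (1 - \<alpha>) (1/2)"
    using has_integral_abel_density[of \<alpha> "real i"] assms unfolding w_def by (auto intro: integral_unique)
  have cell: "\<bar>integral {real j..real j + 1} (\<lambda>u. \<phi> u * w u) - (\<phi> (real j) * W1 \<alpha> i j + \<phi> (real (Suc j)) * W2 \<alpha> i j)\<bar>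
     \<le> \<epsilon> * integral {real j..real j + 1} w" if j: "j < i" for j
  proof -
    have int: "(\<lambda>u. \<psi> u * w u) integrable_on {real j..real j + 1}" if "continuous_on {real j..real j + 1} \<psi>" for \<psi>
      unfolding w_def using that j assms by (intro integrable_continuous_times_abel_density) auto
    have i1: "(\<lambda>u. \<phi> u * w u) integrable_on {real j..real j + 1}"
      using j by (intro int continuous_on_subset[OF cont]) auto
    have i2: "(\<lambda>u. (real j + 1 - u) * w u) integrable_on {real j..real j + 1}" by (intro int continuous_intros)
    have i3: "(\<lambda>u. (u - real j) * w u) integrable_on {real j..real j + 1}" by (intro int continuous_intros)
    define \<delta> where "\<delta> u = \<phi> u * w u - (\<phi> (real j) * ((real j + 1 - u) * w u) + \<phi> (real j + 1) * ((u - real j) * w u))" for u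
    have "(\<delta> has_integral (integral {real j..real j + 1} (\<lambda>u. \<phi> u * w u)
        - (\<phi> (real j) * W1 \<alpha> i j + \<phi> (real j + 1) * W2 \<alpha> i j))) {real j..real j + 1}"
      unfolding \<delta>_def W1_eq W2_eq w_def[symmetric]
      by (intro has_integral_diff has_integral_add has_integral_mult_right integrable_integral i1 i2 i3)
    then have "\<delta> integrable_on {real j..real j + 1}"
      and eq: "integral {real j..real j + 1} \<delta> = integral {real j..real j + 1} (\<lambda>u. \<phi> u * w u)
        - (\<phi> (real j) * W1 \<alpha> i j + \<phi> (real j + 1) * W2 \<alpha> i j)"
      by (auto intro: integral_unique)
    then have "norm (integral {real j..real j + 1} \<delta>) \<le> integral {real j..real j + 1} (\<lambda>u. \<epsilon> * w u)"
    proof (intro integral_norm_bound_integral)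
      show "(\<lambda>u. \<epsilon> * w u) integrable_on {real j..real j + 1}" by (intro int continuous_intros)
      fix u assume u: "u \<in> {real j..real j + 1}"
      have "\<delta> u = (\<phi> u - ((real j + 1 - u) * \<phi> (real j) + (u - real j) * \<phi> (real j + 1))) * w u"
        by (simp add: \<delta>_def algebra_simps)
      then have "norm (\<delta> u) = \<bar>\<phi> u - ((real j + 1 - u) * \<phi> (real j) + (u - real j) * \<phi> (real j + 1))\<bar> * w u"
        using abel_density_nonneg[of \<alpha> "real i" u] by (simp add: abs_mult w_def)
      also have "\<dots> \<le> \<epsilon> * w u"
        using interp[OF j u] abel_density_nonneg by (intro mult_right_mono) (auto simp: w_def)
      finally show "norm (\<delta> u) \<le> \<epsilon> * w u" .
    qed
    then show ?thesis unfolding eq by (simp add: add.commute)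
  qed
  have "(\<lambda>u. \<phi> u * w u) integrable_on {0..real i}"
    unfolding w_def using assms by (intro integrable_continuous_times_abel_density) auto
  then have eq: "integral {0..real i} (\<lambda>u. \<phi> u * w u) - (\<phi> 0 * W1 \<alpha> i 0 + (\<Sum>j=1..i. \<phi> (real j) * trap_weight \<alpha> i j))
     = (\<Sum>j<i. integral {real j..real j + 1} (\<lambda>u. \<phi> u * w u) - (\<phi> (real j) * W1 \<alpha> i j + \<phi> (real (Suc j)) * W2 \<alpha> i j))"
    using sum_cell_weights[OF assms(2), of "\<lambda>j. \<phi> (real j)" \<alpha>] by (simp add: integral_unit_cells sum_subtractf)
  have "\<bar>\<Sum>j<i. integral {real j..real j + 1} (\<lambda>u. \<phi> u * w u) - (\<phi> (real j) * W1 \<alpha> i j + \<phi> (real (Suc j)) * W2 \<alpha> i j)\<bar>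
     \<le> (\<Sum>j<i. \<epsilon> * integral {real j..real j + 1} w)"
    by (rule order_trans[OF sum_abs sum_mono]) (rule cell, simp)
  then show ?thesis
    unfolding w_def[symmetric] eq w_int(2)[symmetric] integral_unit_cells[OF w_int(1)] sum_distrib_left .
qed

text \<open>
  The error is \<open>u - a\<close> times a difference of two values of \<open>\<psi>'\<close>, by the mean value theorem on \<open>{a..u}\<close>
  and on \<open>{a..b}\<close>.
\<close>
lemma linear_interpolation_error:
  fixes \<psi> \<psi>' \<psi>'' :: "real \<Rightarrow> real"
  assumes "a < b"
    and d1: "\<And>x. x \<in> {a..b} \<Longrightarrow> (\<psi> has_real_derivative \<psi>' x) (at x within {a..b})"
    and d2: "\<And>x. x \<in> {a..b} \<Longrightarrow> (\<psi>' has_real_derivative \<psi>'' x) (at x within {a..b})"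
    and bound: "\<And>x. x \<in> {a..b} \<Longrightarrow> \<bar>\<psi>'' x\<bar> \<le> N"
    and u: "u \<in> {a..b}"
  shows "\<bar>\<psi> u - ((b - u) / (b - a) * \<psi> a + (u - a) / (b - a) * \<psi> b)\<bar> \<le> N * (b - a)\<^sup>2"
proof -
  have mvt: "\<exists>z\<in>{x<..<y}. F y - F x = F' z * (y - x)"
    if "x < y" "{x..y} \<subseteq> {a..b}" "\<And>x. x \<in> {a..b} \<Longrightarrow> (F has_real_derivative F' x) (at x within {a..b})"
    for F F' :: "real \<Rightarrow> real" and x y
  proof -
    have "\<exists>z\<in>{x<..<y}. F y - F x = (*) (F' z) (y - x)"
    proof (rule mvt_simple[OF that(1)])
      fix z assume "x \<le> z" "z \<le> y"
      then have "(F has_derivative (*) (F' z)) (at z within {a..b})"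
        using that(2,3) unfolding has_field_derivative_def by auto
      then show "(F has_derivative (*) (F' z)) (at z within {x..y})"
        using that(2) by (rule has_derivative_subset)
    qed
    then show ?thesis .
  qed
  have N: "0 \<le> N" using bound[of a] assms(1) by auto
  have lip: "\<bar>\<psi>' x - \<psi>' y\<bar> \<le> N * (b - a)" if xy: "x \<in> {a..b}" "y \<in> {a..b}" for x y
  proof -
    have *: "\<bar>\<psi>' y - \<psi>' x\<bar> \<le> N * (b - a)" if "x < y" "x \<in> {a..b}" "y \<in> {a..b}" for x y
    proof -
      have "\<exists>z\<in>{x<..<y}. \<psi>' y - \<psi>' x = \<psi>'' z * (y - x)"
        using that by (intro mvt d2) auto
      then obtain z where z: "z \<in> {x<..<y}" "\<psi>' y - \<psi>' x = \<psi>'' z * (y - x)" by blast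
      have "\<bar>\<psi>'' z * (y - x)\<bar> \<le> N * (b - a)"
        unfolding abs_mult using z that N by (intro mult_mono bound) auto
      then show ?thesis using z by simp
    qed
    show ?thesis using *[of x y] *[of y x] xy N assms(1) by (cases x y rule: linorder_cases) (auto simp: abs_minus_commute)
  qed
  show ?thesis
  proof (cases "u = a")
    case True
    then show ?thesis using assms(1) N by simp
  next
    case False
    then have au: "a < u" using u by auto
    have "\<exists>z\<in>{a<..<u}. \<psi> u - \<psi> a = \<psi>' z * (u - a)" "\<exists>y\<in>{a<..<b}. \<psi> b - \<psi> a = \<psi>' y * (b - a)"
      using au u assms(1) by (auto intro!: mvt d1)
    then obtain z y where z: "z \<in> {a<..<u}" "\<psi> u - \<psi> a = \<psi>' z * (u - a)"
      and y: "y \<in> {a<..<b}" "\<psi> b - \<psi> a = \<psi>' y * (b - a)" by blast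
    have "(b - u) / (b - a) * \<psi> a + (u - a) / (b - a) * \<psi> b = \<psi> a + (u - a) / (b - a) * (\<psi> b - \<psi> a)"
    proof -
      have "(b - u) / (b - a) = ((b - a) - (u - a)) / (b - a)" by simp
      also have "\<dots> = 1 - (u - a) / (b - a)" using assms(1) unfolding diff_divide_distrib[of "b - a"] by simp
      finally have "(b - u) / (b - a) = 1 - (u - a) / (b - a)" .
      moreover have "(1 - r) * \<psi> a + r * \<psi> b = \<psi> a + r * (\<psi> b - \<psi> a)" for r by (simp add: algebra_simps)
      ultimately show ?thesis by (simp only:)
    qed
    also have "\<dots> = \<psi> a + (u - a) * \<psi>' y" unfolding y(2) using assms(1) by simp
    finally have "\<psi> u - ((b - u) / (b - a) * \<psi> a + (u - a) / (b - a) * \<psi> b) = (u - a) * (\<psi>' z - \<psi>' y)"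
      using z(2) by (simp add: algebra_simps)
    also have "\<bar>\<dots>\<bar> \<le> (b - a) * (N * (b - a))"
      unfolding abs_mult using u z y au by (intro mult_mono lip) auto
    finally show ?thesis by (simp add: power2_eq_square mult_ac)
  qed
qed

section \<open>Regularity of the kernel\<close>

lemma has_partials_on_snd:
  assumes "has_partials_on (time_triangle T) k k\<^sub>t k\<^sub>u" "0 \<le> u" "u \<le> t" "t \<le> T"
  shows "((\<lambda>v. k t v) has_real_derivative k\<^sub>u t u) (at u within {0..t})"
proof -
  have "((\<lambda>(s, v). k s v) has_derivative (\<lambda>(s, v). k\<^sub>t t u * s + k\<^sub>u t u * v)) (at (t, u) within time_triangle T)"
    using assms unfolding has_partials_on_def time_triangle_def by auto
  then have "((\<lambda>(s, v). k s v) has_derivative (\<lambda>(s, v). k\<^sub>t t u * s + k\<^sub>u t u * v)) (at (t, u) within (\<lambda>v. (t, v)) ` {0..t})"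
    by (rule has_derivative_subset) (use assms in \<open>auto simp: time_triangle_def\<close>)
  moreover have "((\<lambda>v. (t, v)) has_derivative (\<lambda>v. (0, v))) (at u within {0..t})"
    by (auto intro!: derivative_eq_intros)
  ultimately have "((\<lambda>v. (\<lambda>(s, v). k s v) (t, v)) has_derivative (\<lambda>v. (\<lambda>(s, v). k\<^sub>t t u * s + k\<^sub>u t u * v) (0, v))) (at u within {0..t})"
    by (rule has_derivative_in_compose[rotated])
  then show ?thesis unfolding has_field_derivative_def by simp
qed

lemma has_partials_on_fst:
  assumes "has_partials_on (time_triangle T) k k\<^sub>t k\<^sub>u" "0 \<le> u" "u \<le> t" "t \<le> T"
  shows "((\<lambda>s. k s u) has_real_derivative k\<^sub>t t u) (at t within {u..T})"
proof -
  have "((\<lambda>(s, v). k s v) has_derivative (\<lambda>(s, v). k\<^sub>t t u * s + k\<^sub>u t u * v)) (at (t, u) within time_triangle T)"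
    using assms unfolding has_partials_on_def time_triangle_def by auto
  then have "((\<lambda>(s, v). k s v) has_derivative (\<lambda>(s, v). k\<^sub>t t u * s + k\<^sub>u t u * v)) (at (t, u) within (\<lambda>s. (s, u)) ` {u..T})"
    by (rule has_derivative_subset) (use assms in \<open>auto simp: time_triangle_def\<close>)
  moreover have "((\<lambda>s. (s, u)) has_derivative (\<lambda>s. (s, 0))) (at t within {u..T})"
    by (auto intro!: derivative_eq_intros)
  ultimately have "((\<lambda>s. (\<lambda>(s, v). k s v) (s, u)) has_derivative (\<lambda>s. (\<lambda>(s, v). k\<^sub>t t u * s + k\<^sub>u t u * v) (s, 0))) (at t within {u..T})"
    by (rule has_derivative_in_compose[rotated])
  then show ?thesis unfolding has_field_derivative_def by simp
qed

lemma has_partials_on_continuous: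
  assumes "has_partials_on D k k\<^sub>t k\<^sub>u"
  shows "continuous_on D (\<lambda>(t, u). k t u)"
  unfolding continuous_on_eq_continuous_within
proof
  fix p assume p: "p \<in> D"
  obtain t u where tu: "p = (t, u)" by (cases p)
  have "((\<lambda>(s, v). k s v) has_derivative (\<lambda>(s, v). k\<^sub>t t u * s + k\<^sub>u t u * v)) (at p within D)"
    using assms p unfolding has_partials_on_def tu by auto
  then show "continuous (at p within D) (\<lambda>(t, u). k t u)" by (rule has_derivative_continuous)
qed

lemma compact_time_triangle: "compact (time_triangle T)"
proof -
  have eq: "time_triangle T = ({0..T} \<times> {0..T}) \<inter> {p. snd p \<le> fst p}"
    by (auto simp: time_triangle_def)
  have "closed {p :: real \<times> real. snd p \<le> fst p}"
    by (intro closed_Collect_le continuous_intros)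
  then show ?thesis unfolding eq by (intro compact_Int_closed compact_Times compact_Icc)
qed

lemma continuous_compact_bounded:
  fixes F :: "'a::metric_space \<Rightarrow> real"
  assumes "compact S" "continuous_on S F"
  shows "\<exists>B\<ge>0. \<forall>x\<in>S. \<bar>F x\<bar> \<le> B"
proof -
  have "bounded (F ` S)" using assms by (intro compact_imp_bounded compact_continuous_image)
  then obtain B where "\<forall>x\<in>S. \<bar>F x\<bar> \<le> B" by (auto simp: bounded_iff)
  then show ?thesis by (intro exI[of _ "max 0 B"]) (auto simp: max.coboundedI2)
qed

section \<open>The equation on the grid and at the origin\<close>

lemma Beta_half_pos: "0 < Beta (1 - \<alpha>) (1/2)" if "\<alpha> < 1" for \<alpha> :: real
  using that by (simp add: Beta_def Gamma_real_pos)

lemma Beta_half_half: "Beta (1/2) (1/2 :: real) = pi"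
proof -
  have "Beta (1/2) (1/2 :: real) = sqrt pi * sqrt pi" by (simp add: Beta_def Gamma_one_half_real)
  then show ?thesis by simp
qed

lemma volterra_has_integral:
  assumes "volterra_solution T \<alpha> k g f" "0 < t" "t \<le> T"
  shows "((\<lambda>u. f u * k t u * abel_density \<alpha> t u) has_integral g t) {0..t}"
proof -
  have "f u * k t u / (u powr \<alpha> * (t - u) powr (1/2)) = f u * k t u * abel_density \<alpha> t u" for u
    unfolding abel_density_def by (simp only: powr_minus divide_inverse inverse_mult_distrib mult.assoc)
  moreover have "((\<lambda>u. f u * k t u / (u powr \<alpha> * (t - u) powr (1/2))) has_integral g t) {0..t}"
    using assms unfolding volterra_solution_def by blast
  ultimately show ?thesis by (simp only:)
qed

text \<open>
  As \<open>t\<close> tends to zero, \<open>f u * k t u\<close> is uniformly close to \<open>f 0 * k 0 0\<close> for \<open>u\<close> in \<open>{0..t}\<close>, while the density has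
  integral \<open>t powr (1/2 - \<alpha>) * Beta (1 - \<alpha>) (1/2)\<close>.
\<close>
lemma volterra_initial_limit:
  assumes "0 < T" "\<alpha> < 1" and sol: "volterra_solution T \<alpha> k g f"
    and cont: "continuous_on (time_triangle T) (\<lambda>(t, u). f u * k t u)"
  shows "((\<lambda>t. g t * t powr (\<alpha> - 1/2)) \<longlongrightarrow> f 0 * k 0 0 * Beta (1 - \<alpha>) (1/2)) (at_right 0)"
proof (rule tendstoI)
  fix \<epsilon> :: real assume "\<epsilon> > 0"
  define B where "B = Beta (1 - \<alpha>) (1/2)"
  have B: "B > 0" unfolding B_def using assms(2) by (rule Beta_half_pos)
  define \<eta> where "\<eta> = \<epsilon> / (2 * B)"
  have \<eta>: "\<eta> > 0" using \<open>\<epsilon> > 0\<close> B by (simp add: \<eta>_def)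
  have "(0, 0) \<in> time_triangle T" using assms(1) by (simp add: time_triangle_def)
  then obtain d where d: "d > 0" and near: "\<And>p. p \<in> time_triangle T \<Longrightarrow> dist p (0, 0) < d \<Longrightarrow>
      dist ((\<lambda>(t, u). f u * k t u) p) ((\<lambda>(t, u). f u * k t u) (0, 0)) < \<eta>"
    using cont \<eta> unfolding continuous_on_iff by blast
  have "dist (g t * t powr (\<alpha> - 1/2)) (f 0 * k 0 0 * B) < \<epsilon>" if t: "0 < t" "t < min T (d / 2)" for t
  proof -
    define w where "w = abel_density \<alpha> t"
    have w: "(w has_integral t powr (1/2 - \<alpha>) * B) {0..t}"
      unfolding w_def B_def using assms(2) t by (intro has_integral_abel_density) auto
    have i1: "((\<lambda>u. f u * k t u * w u - f 0 * k 0 0 * w u) has_integral g t - f 0 * k 0 0 * (t powr (1/2 - \<alpha>) * B)) {0..t}"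
      unfolding w_def using t by (intro has_integral_diff volterra_has_integral[OF sol] has_integral_mult_right w[unfolded w_def]) auto
    have i2: "((\<lambda>u. \<eta> * w u) has_integral \<eta> * (t powr (1/2 - \<alpha>) * B)) {0..t}"
      by (intro has_integral_mult_right w)
    have i3: "norm (f u * k t u * w u - f 0 * k 0 0 * w u) \<le> \<eta> * w u" if u: "u \<in> {0..t}" for u
    proof -
      have "(t, u) \<in> time_triangle T" using u t by (auto simp: time_triangle_def)
      moreover have "dist (t, u) (0, 0) < d"
      proof -
        have "dist (t, u) (0, 0) \<le> \<bar>t\<bar> + \<bar>u\<bar>"
          using norm_Pair_le[of t u] by (simp add: dist_norm)
        then show ?thesis using u t by auto
      qed
      ultimately have "\<bar>f u * k t u - f 0 * k 0 0\<bar> \<le> \<eta>" using near[of "(t, u)"] by (simp add: dist_real_def)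
      then have "\<bar>f u * k t u - f 0 * k 0 0\<bar> * w u \<le> \<eta> * w u"
        by (intro mult_right_mono) (auto simp: w_def abel_density_nonneg)
      moreover have "norm (f u * k t u * w u - f 0 * k 0 0 * w u) = \<bar>f u * k t u - f 0 * k 0 0\<bar> * w u"
        using abel_density_nonneg[of \<alpha> t u] unfolding w_def[symmetric]
        by (simp add: left_diff_distrib[symmetric] abs_mult)
      ultimately show ?thesis by simp
    qed
    have "norm (g t - f 0 * k 0 0 * (t powr (1/2 - \<alpha>) * B)) \<le> \<eta> * (t powr (1/2 - \<alpha>) * B)"
      using integral_norm_bound_integral[OF has_integral_integrable[OF i1] has_integral_integrable[OF i2] i3]
      unfolding integral_unique[OF i1] integral_unique[OF i2] .
    then have "\<bar>g t - f 0 * k 0 0 * (t powr (1/2 - \<alpha>) * B)\<bar> * t powr (\<alpha> - 1/2) \<le> (\<eta> * (t powr (1/2 - \<alpha>) * B)) * t powr (\<alpha> - 1/2)"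
      by (intro mult_right_mono) auto
    moreover have tt: "t powr (1/2 - \<alpha>) * t powr (\<alpha> - 1/2) = 1"
      unfolding powr_add[symmetric] using t by simp
    have "(\<eta> * (t powr (1/2 - \<alpha>) * B)) * t powr (\<alpha> - 1/2) = \<eta> * B * (t powr (1/2 - \<alpha>) * t powr (\<alpha> - 1/2))" by simp
    moreover have "\<eta> * B = \<epsilon> / 2" using B by (simp add: \<eta>_def)
    moreover have "\<bar>g t - f 0 * k 0 0 * (t powr (1/2 - \<alpha>) * B)\<bar> * t powr (\<alpha> - 1/2) = \<bar>g t * t powr (\<alpha> - 1/2) - f 0 * k 0 0 * B\<bar>"
    proof -
      have "(g t - f 0 * k 0 0 * (t powr (1/2 - \<alpha>) * B)) * t powr (\<alpha> - 1/2)
        = g t * t powr (\<alpha> - 1/2) - f 0 * k 0 0 * B * (t powr (1/2 - \<alpha>) * t powr (\<alpha> - 1/2))" by (simp add: algebra_simps)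
      then have "\<bar>(g t - f 0 * k 0 0 * (t powr (1/2 - \<alpha>) * B)) * t powr (\<alpha> - 1/2)\<bar> = \<bar>g t * t powr (\<alpha> - 1/2) - f 0 * k 0 0 * B\<bar>"
        unfolding tt by simp
      then show ?thesis by (simp add: abs_mult)
    qed
    ultimately show ?thesis using \<open>\<epsilon> > 0\<close> unfolding tt by (simp add: dist_real_def)
  qed
  moreover have "eventually (\<lambda>t. 0 < t \<and> t < min T (d / 2)) (at_right (0::real))"
    using assms(1) d by (auto simp: eventually_at_right_field intro!: exI[of _ "min T (d / 2)"])
  ultimately show "eventually (\<lambda>t. dist (g t * t powr (\<alpha> - 1/2)) (f 0 * k 0 0 * Beta (1 - \<alpha>) (1/2)) < \<epsilon>) (at_right 0)"
    unfolding B_def by (rule eventually_mono[rotated]) auto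
qed

text \<open>
  The starting value of the scheme is exact: for \<open>\<alpha> > 1/2\<close> a bounded \<open>g\<close> is only possible if \<open>f 0 = 0\<close>, and
  for \<open>\<alpha> = 1/2\<close> the Beta integral equals \<open>pi\<close>.
\<close>
lemma volterra_initial_value:
  assumes "0 < T" "1/2 \<le> \<alpha>" "\<alpha> < 1" and sol: "volterra_solution T \<alpha> k g f"
    and cont: "continuous_on (time_triangle T) (\<lambda>(t, u). f u * k t u)"
    and g: "continuous_on {0..T} g" and k: "k 0 0 \<noteq> 0"
  shows "f 0 = (if \<alpha> = 1/2 then g 0 / (pi * k 0 0) else 0)"
proof -
  have lim: "((\<lambda>t. g t * t powr (\<alpha> - 1/2)) \<longlongrightarrow> f 0 * k 0 0 * Beta (1 - \<alpha>) (1/2)) (at_right 0)"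
    using volterra_initial_limit[OF assms(1,3,4,5)] .
  have "(g \<longlongrightarrow> g 0) (at 0 within {0..T})"
    using g assms(1) by (simp add: continuous_on)
  then have g_lim: "(g \<longlongrightarrow> g 0) (at_right 0)"
    using assms(1) at_within_Icc_at_right by (metis)
  show ?thesis
  proof (cases "\<alpha> = 1/2")
    case True
    have "((\<lambda>t. g t * t powr (\<alpha> - 1/2)) \<longlongrightarrow> g 0) (at_right 0)"
    proof (rule Lim_transform_eventually[OF g_lim])
      show "eventually (\<lambda>t. g t = g t * t powr (\<alpha> - 1/2)) (at_right 0)"
        using True by (auto simp: eventually_at_right_field intro!: exI[of _ 1])
    qed
    with lim have "f 0 * k 0 0 * Beta (1 - \<alpha>) (1/2) = g 0"
      by (rule tendsto_unique[rotated]) simp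
    then have "f 0 * (pi * k 0 0) = g 0" using True by (simp add: Beta_half_half mult_ac)
    then show ?thesis using True k by (simp add: field_simps)
  next
    case False
    have "((\<lambda>t. t powr (\<alpha> - 1/2)) \<longlongrightarrow> 0) (at_right (0::real))"
    proof (rule tendsto_zero_powrI[OF _ tendsto_const])
      show "eventually (\<lambda>t. 0 \<le> t) (at_right (0::real))"
        by (auto simp: eventually_at_right_field intro!: exI[of _ 1])
    qed (use False assms in auto)
    then have "((\<lambda>t. g t * t powr (\<alpha> - 1/2)) \<longlongrightarrow> g 0 * 0) (at_right 0)"
      by (rule tendsto_mult[OF g_lim])
    with lim have "f 0 * k 0 0 * Beta (1 - \<alpha>) (1/2) = g 0 * 0"
      by (rule tendsto_unique[rotated]) simp
    then show ?thesis using False k Beta_half_pos[OF assms(3)] by simp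
  qed
qed

text \<open>
  The substitution \<open>u = h * v\<close> turns the grid into the integers.
\<close>
lemma volterra_rescaled:
  assumes "volterra_solution T \<alpha> k g f" "0 < h" "1 \<le> i" "real i * h \<le> T"
  shows "((\<lambda>v. f (h * v) * k (real i * h) (h * v) * abel_density \<alpha> (real i) v)
            has_integral h powr (\<alpha> - 1/2) * g (real i * h)) {0..real i}"
proof -
  define t where "t = real i * h"
  define F where "F u = f u * k t u * abel_density \<alpha> t u" for u
  have t: "0 < t" "t \<le> T" using assms by (auto simp: t_def)
  have "(F has_integral g t) {0..t}" unfolding F_def using assms(1) t by (rule volterra_has_integral)
  from has_integral_stretch_real[OF this, of h]
  have "((\<lambda>v. F (h * v)) has_integral g t / h) ((\<lambda>x. x / h) ` {0..t})" using assms(2) by simp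
  also have "(\<lambda>x. x / h) ` {0..t} = {0..real i}"
  proof -
    have "v = (v * h) / h \<and> v * h \<in> {0..t}" if "v \<in> {0..real i}" for v
      using that assms(2) by (auto simp: t_def)
    then have "{0..real i} \<subseteq> (\<lambda>x. x / h) ` {0..t}" by blast
    moreover have "(\<lambda>x. x / h) ` {0..t} \<subseteq> {0..real i}" using assms(2) by (auto simp: t_def divide_simps)
    ultimately show ?thesis by blast
  qed
  finally have "((\<lambda>v. h powr (\<alpha> + 1/2) * F (h * v)) has_integral h powr (\<alpha> + 1/2) * (g t / h)) {0..real i}"
    by (rule has_integral_mult_right)
  moreover have "h powr (\<alpha> + 1/2) * (g t / h) = h powr (\<alpha> - 1/2) * g t"
  proof -
    have "h powr (\<alpha> + 1/2) = h powr (\<alpha> - 1/2) * h powr 1" unfolding powr_add[symmetric] by (simp add: add.commute)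
    then show ?thesis using assms(2) by simp
  qed
  moreover have "h powr (\<alpha> + 1/2) * F (h * v) = f (h * v) * k t (h * v) * abel_density \<alpha> (real i) v"
    if v: "v \<in> {0..real i}" for v
  proof -
    have "t - h * v = h * (real i - v)" by (simp add: t_def algebra_simps)
    then have "abel_density \<alpha> t (h * v) = (h powr (- \<alpha>) * h powr (- (1/2))) * abel_density \<alpha> (real i) v"
      using v assms(2) by (simp add: abel_density_def powr_mult)
    also have "h powr (- \<alpha>) * h powr (- (1/2)) = h powr (- (\<alpha> + 1/2))"
      unfolding powr_add[symmetric] by simp
    finally have "h powr (\<alpha> + 1/2) * abel_density \<alpha> t (h * v) = (h powr (\<alpha> + 1/2) * h powr (- (\<alpha> + 1/2))) * abel_density \<alpha> (real i) v"
      by simp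
    also have "h powr (\<alpha> + 1/2) * h powr (- (\<alpha> + 1/2)) = 1"
      unfolding powr_add[symmetric] using assms(2) by simp
    finally show ?thesis by (simp add: F_def mult_ac)
  qed
  ultimately show ?thesis unfolding t_def[symmetric] by (metis (no_types, lifting) has_integral_eq)
qed

lemma product_trapezoidal_row:
  assumes "product_trapezoidal T \<alpha> k g m F" "1 \<le> i" "i \<le> m"
  shows "(T / real m) powr (\<alpha> - 1/2) * g (grid T m i) =
    k (grid T m i) (grid T m 0) * W1 \<alpha> i 0 * F 0 + (\<Sum>j=1..i. k (grid T m i) (grid T m j) * trap_weight \<alpha> i j * F j)"
proof -
  have split: "{1..i} = insert i {1..i - 1}" using assms(2) by auto
  have "(\<Sum>j=1..i. k (grid T m i) (grid T m j) * trap_weight \<alpha> i j * F j)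
    = k (grid T m i) (grid T m i) * trap_weight \<alpha> i i * F i + (\<Sum>j=1..i - 1. k (grid T m i) (grid T m j) * trap_weight \<alpha> i j * F j)"
    unfolding split using assms(2) by (subst sum.insert) auto
  also have "(\<Sum>j=1..i - 1. k (grid T m i) (grid T m j) * trap_weight \<alpha> i j * F j)
    = (\<Sum>j=1..i - 1. k (grid T m i) (grid T m j) * (W1 \<alpha> i j + W2 \<alpha> i (j - 1)) * F j)"
    by (intro sum.cong) (auto simp: trap_weight_def)
  finally show ?thesis using assms unfolding product_trapezoidal_def by (simp add: trap_weight_def)
qed

section \<open>Convergence\<close>

theorem theorem5p3:
  fixes T \<alpha> :: real
    and g f f' f'' f''' :: "real \<Rightarrow> real"
    and k k\<^sub>t k\<^sub>u k\<^sub>t\<^sub>t k\<^sub>t\<^sub>u k\<^sub>u\<^sub>t k\<^sub>u\<^sub>u k\<^sub>u\<^sub>u\<^sub>u k\<^sub>t\<^sub>u\<^sub>u :: "real \<Rightarrow> real \<Rightarrow> real"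
    and F :: "nat \<Rightarrow> nat \<Rightarrow> real"
  assumes T: "T > 0"
    and alpha: "1/2 \<le> \<alpha>" "\<alpha> < 1"
    and g_cont: "continuous_on {0..T} g"
    and k_diag: "\<And>t. t \<in> {0..T} \<Longrightarrow> k t t \<noteq> 0"
    and solution: "volterra_solution T \<alpha> k g f"
    \<comment> \<open>the kernel is twice continuously differentiable\<close>
    and k_deriv: "has_partials_on (time_triangle T) k k\<^sub>t k\<^sub>u"
      "has_partials_on (time_triangle T) k\<^sub>t k\<^sub>t\<^sub>t k\<^sub>u\<^sub>t"
      "has_partials_on (time_triangle T) k\<^sub>u k\<^sub>t\<^sub>u k\<^sub>u\<^sub>u"
    and k_C2: "continuous_on (time_triangle T) (\<lambda>(t, u). k\<^sub>t\<^sub>t t u)"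
      "continuous_on (time_triangle T) (\<lambda>(t, u). k\<^sub>t\<^sub>u t u)"
      "continuous_on (time_triangle T) (\<lambda>(t, u). k\<^sub>u\<^sub>t t u)"
      "continuous_on (time_triangle T) (\<lambda>(t, u). k\<^sub>u\<^sub>u t u)"
    \<comment> \<open>the solution is twice continuously differentiable\<close>
    and f_deriv: "\<And>t. t \<in> {0..T} \<Longrightarrow> (f has_real_derivative f' t) (at t within {0..T})"
      "\<And>t. t \<in> {0..T} \<Longrightarrow> (f' has_real_derivative f'' t) (at t within {0..T})"
    and f_C2: "continuous_on {0..T} f''"
    \<comment> \<open>existence and boundedness of the third derivatives\<close>
    and f_third: "\<And>t. t \<in> {0..T} \<Longrightarrow> (f'' has_real_derivative f''' t) (at t within {0..T})"
    and k_third_uuu: "\<And>t u. (t, u) \<in> time_triangle T \<Longrightarrow>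
      ((\<lambda>v. k\<^sub>u\<^sub>u t v) has_real_derivative k\<^sub>u\<^sub>u\<^sub>u t u) (at u within {0..t})"
    and k_third_tuu: "\<And>t u. (t, u) \<in> time_triangle T \<Longrightarrow>
      ((\<lambda>s. k\<^sub>u\<^sub>u s u) has_real_derivative k\<^sub>t\<^sub>u\<^sub>u t u) (at t within {u..T})"
    and third_bounded: "bounded (f''' ` {0..T})"
      "bounded ((\<lambda>(t, u). k\<^sub>u\<^sub>u\<^sub>u t u) ` time_triangle T)"
      "bounded ((\<lambda>(t, u). k\<^sub>t\<^sub>u\<^sub>u t u) ` time_triangle T)"
    and trapezoidal: "\<And>m. m \<ge> 1 \<Longrightarrow> product_trapezoidal T \<alpha> k g m (F m)"
  shows "(\<lambda>m. Max ((\<lambda>i. \<bar>f (grid T m i) - F m i\<bar>) ` {0..m})) \<in> O(\<lambda>m. (T / real m) powr (3/2))"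
proof -
  let ?D = "time_triangle T"
  have k_cont: "continuous_on ?D (\<lambda>(t, u). k t u)" "continuous_on ?D (\<lambda>(t, u). k\<^sub>t t u)" "continuous_on ?D (\<lambda>(t, u). k\<^sub>u t u)"
    using k_deriv by (auto intro: has_partials_on_continuous)
  have f_cont: "continuous_on {0..T} f" "continuous_on {0..T} f'"
    by (rule DERIV_continuous_on[OF f_deriv(1)] DERIV_continuous_on[OF f_deriv(2)]; assumption)+
  obtain Bk where Bk: "Bk \<ge> 0" "\<And>t u. (t, u) \<in> ?D \<Longrightarrow> \<bar>k t u\<bar> \<le> Bk"
    using continuous_compact_bounded[OF compact_time_triangle k_cont(1)] by fastforce
  obtain Bt where Bt: "Bt \<ge> 0" "\<And>t u. (t, u) \<in> ?D \<Longrightarrow> \<bar>k\<^sub>t t u\<bar> \<le> Bt"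
    using continuous_compact_bounded[OF compact_time_triangle k_cont(2)] by fastforce
  obtain Bu where Bu: "Bu \<ge> 0" "\<And>t u. (t, u) \<in> ?D \<Longrightarrow> \<bar>k\<^sub>u t u\<bar> \<le> Bu"
    using continuous_compact_bounded[OF compact_time_triangle k_cont(3)] by fastforce
  obtain Buu where Buu: "Buu \<ge> 0" "\<And>t u. (t, u) \<in> ?D \<Longrightarrow> \<bar>k\<^sub>u\<^sub>u t u\<bar> \<le> Buu"
    using continuous_compact_bounded[OF compact_time_triangle k_C2(4)] by fastforce
  obtain B0 where B0: "B0 \<ge> 0" "\<And>t. t \<in> {0..T} \<Longrightarrow> \<bar>f t\<bar> \<le> B0"
    using continuous_compact_bounded[OF compact_Icc f_cont(1)] by blast
  obtain B1 where B1: "B1 \<ge> 0" "\<And>t. t \<in> {0..T} \<Longrightarrow> \<bar>f' t\<bar> \<le> B1"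
    using continuous_compact_bounded[OF compact_Icc f_cont(2)] by blast
  obtain B2 where B2: "B2 \<ge> 0" "\<And>t. t \<in> {0..T} \<Longrightarrow> \<bar>f'' t\<bar> \<le> B2"
    using continuous_compact_bounded[OF compact_Icc f_C2] by blast
  have diag_cont: "continuous_on {0..T} (\<lambda>t. \<bar>k t t\<bar>)"
  proof -
    have "continuous_on {0..T} (\<lambda>t. (\<lambda>(t, u). k t u) (t, t))"
      by (rule continuous_on_compose2[OF k_cont(1)]) (auto intro!: continuous_intros simp: time_triangle_def)
    then show ?thesis by (auto intro: continuous_on_rabs)
  qed
  obtain t0 where t0: "t0 \<in> {0..T}" "\<And>t. t \<in> {0..T} \<Longrightarrow> \<bar>k t0 t0\<bar> \<le> \<bar>k t t\<bar>"
    using continuous_attains_inf[OF compact_Icc _ diag_cont] T by auto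
  define \<kappa> where "\<kappa> = \<bar>k t0 t0\<bar>"
  have \<kappa>: "\<kappa> > 0" using k_diag[OF t0(1)] by (simp add: \<kappa>_def)
  define B where "B = Beta (1 - \<alpha>) (1/2)"
  have B: "B > 0" unfolding B_def using alpha(2) by (rule Beta_half_pos)
\<comment> \<open>a bound for the second derivative in \<open>s\<close> of \<open>f s * k t s\<close>\<close>
  define N where "N = B2 * Bk + 2 * (B1 * Bu) + B0 * Buu"
  have N: "N \<ge> 0" using B0(1) B1(1) B2(1) Bk(1) Bu(1) Buu(1) by (simp add: N_def)
  obtain C where C: "C \<ge> 0" and stab: "\<And>D h m K e i. 0 \<le> D \<Longrightarrow> 0 \<le> h \<Longrightarrow> h * real m \<le> T \<Longrightarrow>
      abel_system \<alpha> Bk \<kappa> Bt D h m K e \<Longrightarrow> 1 \<le> i \<Longrightarrow> i \<le> m \<Longrightarrow> \<bar>e i\<bar> \<le> C * D * sqrt (real i)"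
    using abel_system_stability[OF alpha Bk(1) Bt(1) \<kappa> less_imp_le[OF T]] by blast
  have f_init: "f 0 = (if \<alpha> = 1/2 then g 0 / (pi * k 0 0) else 0)"
  proof (rule volterra_initial_value[OF T alpha solution _ g_cont])
    have "continuous_on ?D (\<lambda>p. f (snd p) * (\<lambda>(t, u). k t u) p)"
      by (intro continuous_on_mult k_cont(1) continuous_on_compose2[OF f_cont(1)] continuous_intros)
        (auto simp: time_triangle_def)
    then show "continuous_on ?D (\<lambda>(t, u). f u * k t u)" by (simp add: case_prod_unfold)
    show "k 0 0 \<noteq> 0" using T by (intro k_diag) simp
  qed
  have k_lipschitz: "\<bar>k r u - k s u\<bar> \<le> Bt * (s - r)" if "0 \<le> u" "u \<le> r" "r \<le> s" "s \<le> T" for r s u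
  proof -
    have "norm (k r u - k s u) \<le> Bt * norm (r - s)"
    proof (rule field_differentiable_bound[where S = "{u..T}" and f' = "\<lambda>z. k\<^sub>t z u"])
      fix z assume z: "z \<in> {u..T}"
      show "((\<lambda>z. k z u) has_field_derivative k\<^sub>t z u) (at z within {u..T})"
        using has_partials_on_fst[OF k_deriv(1)] z that by auto
      show "norm (k\<^sub>t z u) \<le> Bt" using Bt(2)[of z u] z that by (auto simp: time_triangle_def)
    qed (use that in auto)
    then show ?thesis using that by simp
  qed
  define A where "A = C * (N * B) * sqrt T"
  have error: "\<bar>f (grid T m i) - F m i\<bar> \<le> A * (T / real m) powr (3/2)" if m: "1 \<le> m" and i: "i \<le> m" for m i
  proof -
    define h where "h = T / real m"
    have h: "h > 0" "h * real m = T" using T m by (auto simp: h_def)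
    have grid: "grid T m j = real j * h" for j by (simp add: grid_def h_def)
    have in_range: "0 \<le> real j * h" "real j * h \<le> T" if "j \<le> m" for j
    proof -
      have "real j * h \<le> real m * h" using that h by (intro mult_right_mono) auto
      then show "0 \<le> real j * h" "real j * h \<le> T" using h by (auto simp: mult.commute)
    qed
    have triangle: "(real l * h, real j * h) \<in> ?D" if "j \<le> l" "l \<le> m" for l j
    proof -
      have "real j * h \<le> real l * h" using that h by (intro mult_right_mono) auto
      then show ?thesis using in_range[of l] in_range[of j] that by (auto simp: time_triangle_def)
    qed
    define K where "K l j = k (real l * h) (real j * h)" for l j :: nat
    define e where "e j = f (real j * h) - F m j" for j
    have scheme: "product_trapezoidal T \<alpha> k g m (F m)" using trapezoidal[OF m] .
    have start: "F m 0 = f 0" using scheme f_init unfolding product_trapezoidal_def by simp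
    have consistency: "\<bar>\<Sum>j=1..l. K l j * trap_weight \<alpha> l j * e j\<bar> \<le> N * h\<^sup>2 * B * real l powr (1/2 - \<alpha>)"
      if l: "1 \<le> l" "l \<le> m" for l
    proof -
      define t where "t = real l * h"
      have t: "0 < t" "t \<le> T" using l h in_range[of l] by (auto simp: t_def)
      define \<psi> where "\<psi> s = f s * k t s" for s
      define \<psi>' where "\<psi>' s = f' s * k t s + f s * k\<^sub>u t s" for s
      define \<psi>'' where "\<psi>'' s = f'' s * k t s + 2 * (f' s * k\<^sub>u t s) + f s * k\<^sub>u\<^sub>u t s" for s
      have d: "(f has_real_derivative f' s) (at s within {0..t})" "(f' has_real_derivative f'' s) (at s within {0..t})"
          "(k t has_real_derivative k\<^sub>u t s) (at s within {0..t})" "(k\<^sub>u t has_real_derivative k\<^sub>u\<^sub>u t s) (at s within {0..t})"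
        if "s \<in> {0..t}" for s
        using that t has_partials_on_snd[OF k_deriv(1), of s t] has_partials_on_snd[OF k_deriv(3), of s t]
        by (auto intro: DERIV_subset[OF f_deriv(1)] DERIV_subset[OF f_deriv(2)])
      have d1: "(\<psi> has_real_derivative \<psi>' s) (at s within {0..t})" if "s \<in> {0..t}" for s
        unfolding \<psi>_def \<psi>'_def using d[OF that] by (auto intro!: derivative_eq_intros)
      have d2: "(\<psi>' has_real_derivative \<psi>'' s) (at s within {0..t})" if "s \<in> {0..t}" for s
        unfolding \<psi>'_def \<psi>''_def using d[OF that] by (auto intro!: derivative_eq_intros simp: algebra_simps)
      have d2_bound: "\<bar>\<psi>'' s\<bar> \<le> N" if s: "s \<in> {0..t}" for s
      proof -
        have s': "(t, s) \<in> ?D" "s \<in> {0..T}" using s t by (auto simp: time_triangle_def)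
        have "\<bar>f'' s * k t s\<bar> \<le> B2 * Bk" "\<bar>f' s * k\<^sub>u t s\<bar> \<le> B1 * Bu" "\<bar>f s * k\<^sub>u\<^sub>u t s\<bar> \<le> B0 * Buu"
          unfolding abs_mult using s' B0 B1 B2 Bk Bu Buu by (auto intro!: mult_mono)
        then show ?thesis unfolding \<psi>''_def N_def by linarith
      qed
      define \<phi> where "\<phi> v = \<psi> (h * v)" for v
      have \<phi>_grid: "\<phi> (real j) = f (real j * h) * K l j" for j
        by (simp add: \<phi>_def \<psi>_def K_def t_def mult.commute)
      have \<phi>_cont: "continuous_on {0..real l} \<phi>"
      proof -
        have "continuous_on {0..t} \<psi>" using d1 by (rule DERIV_continuous_on)
        then show ?thesis unfolding \<phi>_def
          by (rule continuous_on_compose2) (use h in \<open>auto intro!: continuous_intros simp: t_def mult.commute\<close>)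
      qed
      have interp: "\<bar>\<phi> v - ((real j + 1 - v) * \<phi> (real j) + (v - real j) * \<phi> (real j + 1))\<bar> \<le> N * h\<^sup>2"
        if j: "j < l" and v: "v \<in> {real j..real j + 1}" for j v
      proof -
        define a b where "a = h * real j" and "b = h * (real j + 1)"
        have ab: "b - a = h" "a < b" using h by (auto simp: a_def b_def algebra_simps)
        have sub: "{a..b} \<subseteq> {0..t}"
        proof -
          have "h * (real j + 1) \<le> h * real l" using j h by (intro mult_left_mono) auto
          then show ?thesis using h by (auto simp: a_def b_def t_def mult.commute)
        qed
        have hv: "h * v \<in> {a..b}" using v h by (auto simp: a_def b_def)
        have "\<bar>\<psi> (h * v) - ((b - h * v) / (b - a) * \<psi> a + (h * v - a) / (b - a) * \<psi> b)\<bar> \<le> N * (b - a)\<^sup>2"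
        proof (rule linear_interpolation_error[OF ab(2) _ _ _ hv])
          fix x assume "x \<in> {a..b}"
          then have x: "x \<in> {0..t}" using sub by blast
          show "(\<psi> has_real_derivative \<psi>' x) (at x within {a..b})" by (rule DERIV_subset[OF d1[OF x] sub])
          show "(\<psi>' has_real_derivative \<psi>'' x) (at x within {a..b})" by (rule DERIV_subset[OF d2[OF x] sub])
          show "\<bar>\<psi>'' x\<bar> \<le> N" by (rule d2_bound[OF x])
        qed
        moreover have "(b - h * v) / (b - a) = real j + 1 - v" "(h * v - a) / (b - a) = v - real j"
          unfolding ab(1) using h by (auto simp: a_def b_def field_simps)
        ultimately have "\<bar>\<psi> (h * v) - ((real j + 1 - v) * \<psi> a + (v - real j) * \<psi> b)\<bar> \<le> N * h\<^sup>2"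
          unfolding ab(1) by (simp only:)
        then show ?thesis unfolding \<phi>_def a_def b_def .
      qed
      have "integral {0..real l} (\<lambda>v. \<phi> v * abel_density \<alpha> (real l) v) = h powr (\<alpha> - 1/2) * g t"
        using volterra_rescaled[OF solution h(1) l(1)] t unfolding \<phi>_def \<psi>_def t_def by (intro integral_unique) auto
      moreover have "h powr (\<alpha> - 1/2) * g t = K l 0 * W1 \<alpha> l 0 * F m 0 + (\<Sum>j=1..l. K l j * trap_weight \<alpha> l j * F m j)"
        using product_trapezoidal_row[OF scheme l] unfolding grid K_def t_def h_def[symmetric] .
      moreover have "\<phi> 0 * W1 \<alpha> l 0 = K l 0 * W1 \<alpha> l 0 * F m 0"
        using \<phi>_grid[of 0] by (simp add: start mult_ac)
      moreover have "(\<Sum>j=1..l. \<phi> (real j) * trap_weight \<alpha> l j)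
          = (\<Sum>j=1..l. K l j * trap_weight \<alpha> l j * F m j) + (\<Sum>j=1..l. K l j * trap_weight \<alpha> l j * e j)"
        unfolding sum.distrib[symmetric] \<phi>_grid e_def by (intro sum.cong) (auto simp: algebra_simps)
      moreover have "\<bar>integral {0..real l} (\<lambda>v. \<phi> v * abel_density \<alpha> (real l) v)
          - (\<phi> 0 * W1 \<alpha> l 0 + (\<Sum>j=1..l. \<phi> (real j) * trap_weight \<alpha> l j))\<bar> \<le> N * h\<^sup>2 * (real l powr (1/2 - \<alpha>) * B)"
        unfolding B_def by (rule product_trapezoidal_quadrature_error[OF alpha(2) l(1) \<phi>_cont interp])
      ultimately have "\<bar>\<Sum>j=1..l. K l j * trap_weight \<alpha> l j * e j\<bar> \<le> N * h\<^sup>2 * (real l powr (1/2 - \<alpha>) * B)"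
        by linarith
      then show ?thesis by (simp add: mult_ac)
    qed
    have sys: "abel_system \<alpha> Bk \<kappa> Bt (N * h\<^sup>2 * B) h m K e"
      unfolding abel_system_def
    proof (intro conjI allI impI)
      fix l j assume "1 \<le> j \<and> j \<le> l \<and> l \<le> m"
      then show "\<bar>K l j\<bar> \<le> Bk" unfolding K_def using triangle by (intro Bk(2)) auto
    next
      fix l assume "1 \<le> l \<and> l \<le> m"
      then show "\<kappa> \<le> \<bar>K l l\<bar>" unfolding K_def \<kappa>_def using in_range by (intro t0(2)) auto
    next
      fix l l' j assume a: "1 \<le> j \<and> j \<le> l' \<and> l' \<le> l \<and> l \<le> m"
      have "\<bar>K l' j - K l j\<bar> \<le> Bt * (real l * h - real l' * h)"
        unfolding K_def using a h in_range by (intro k_lipschitz mult_right_mono) auto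
      also have "\<dots> = Bt * h * real (l - l')" using a by (simp add: of_nat_diff algebra_simps)
      finally show "\<bar>K l' j - K l j\<bar> \<le> Bt * h * real (l - l')" .
    next
      fix l assume "1 \<le> l \<and> l \<le> m"
      then show "\<bar>\<Sum>j=1..l. K l j * trap_weight \<alpha> l j * e j\<bar> \<le> N * h\<^sup>2 * B * real l powr (1/2 - \<alpha>)"
        using consistency by blast
    qed
    have "\<bar>e i\<bar> \<le> C * (N * h\<^sup>2 * B) * sqrt (real m)"
    proof (cases "i = 0")
      case True
      then show ?thesis using C N B by (simp add: e_def start)
    next
      case False
      have "\<bar>e i\<bar> \<le> C * (N * h\<^sup>2 * B) * sqrt (real i)"
        using False i h N B by (intro stab[OF _ _ _ sys]) auto
      also have "\<dots> \<le> C * (N * h\<^sup>2 * B) * sqrt (real m)"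
        using i C N B by (intro mult_left_mono) auto
      finally show ?thesis .
    qed
    also have "\<dots> = A * h powr (3/2)"
    proof -
      have "h powr (3/2) = h powr 1 * h powr (1/2)" unfolding powr_add[symmetric] by simp
      then have pw: "h powr (3/2) = h * sqrt h" using h by (simp add: powr_half_sqrt)
\<comment> \<open>\<open>h * m = T\<close> turns half a power of \<open>h\<close> and \<open>sqrt m\<close> into \<open>sqrt T\<close>\<close>
      have "h\<^sup>2 * sqrt (real m) = h * (sqrt h * sqrt h) * sqrt (real m)" using h by (simp add: power2_eq_square)
      also have "\<dots> = h * sqrt h * sqrt (h * real m)" by (simp add: real_sqrt_mult)
      finally show ?thesis unfolding pw A_def h(2) by (simp add: mult_ac)
    qed
    finally show ?thesis unfolding grid e_def h_def .
  qed
  show ?thesis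
  proof (rule bigoI[of _ A])
    show "eventually (\<lambda>m. norm (Max ((\<lambda>i. \<bar>f (grid T m i) - F m i\<bar>) ` {0..m})) \<le> A * norm ((T / real m) powr (3/2))) sequentially"
      using eventually_ge_at_top[of 1]
    proof eventually_elim
      case (elim m)
      let ?E = "(\<lambda>i. \<bar>f (grid T m i) - F m i\<bar>) ` {0..m}"
      have "Max ?E \<in> ?E" by (intro Max_in) auto
      then obtain i where "i \<in> {0..m}" "Max ?E = \<bar>f (grid T m i) - F m i\<bar>" by (rule imageE)
      then show ?case using error[OF elim, of i] by simp
    qed
  qed
qed

end
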